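(* Let $T$ be a Calderón–Zygmund operator in $\mathbb{R}^n$ with maximal truncated version $T_{\natural}$, and let $X$ be a Banach function space over $\mathbb{R}^n$ equipped with Lebesgue measure. Then, for any appropriate $f$, $$\|T_{\natural}f\|_{X}\le c(T,n)\sup_{\mathscr{D},\mathcal{S}}\big\|\mathcal{A}_{\mathscr{D},\mathcal{S}}|f|\big\|_{X},$$ where the supremum is taken over arbitrary general dyadic grids $\mathscr{D}$ and sparse families $\mathcal{S}\subset\mathscr{D}$, and the constant $c(T,n)$ depends only on $T$ and $n$.
   Context: The phrase "any appropriate $f$" is the original wording; the class of functions $f$ is not specified further in the statement (the proof works with $f$ bounded and with compact support). Calderón–Zygmund operator: an $L^2(\mathbb{R}^n)$-bounded integral operator $T$ with kernel $K$ satisfying, for some constant $c$: (i) $|K(x,y)|\le \frac{c}{|x-y|^n}$ for all $x\ne y$; (ii) there exists $0<\delta\le 1$ such that $|K(x,y)-K(x',y)|+|K(y,x)-K(y,x')|\le c\frac{|x-x'|^{\delta}}{|x-y|^{n+\delta}}$ whenever $|x-x'|<|x-y|/2$. Its maximal truncated version is $$T_{\natural}f(x)=\sup_{0<\varepsilon<\nu}\Big|\int_{\varepsilon<|x-y|<\nu}K(x,y)f(y)\,dy\Big|.$$ General dyadic grid $\mathscr{D}$: a collection of cubes in $\mathbb{R}^n$ such that (i) every $Q\in\mathscr{D}$ has sidelength $\ell_Q=2^k$ for some $k\in\mathbb{Z}$; (ii) $Q\cap R\in\{Q,R,\emptyset\}$ for all $Q,R\in\mathscr{D}$; (iii) the cubes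 of each fixed sidelength $2^k$ form a partition of $\mathbb{R}^n$. Sparse family $\mathcal{S}=\{Q_j^k\}$ of cubes of $\mathscr{D}$: (i) the cubes $Q_j^k$ are disjoint in $j$, with $k$ fixed; (ii) if $\Omega_k=\bigcup_jQ_j^k$, then $\Omega_{k+1}\subset\Omega_k$; (iii) $|\Omega_{k+1}\cap Q_j^k|\le\frac12|Q_j^k|$. $\mathcal{A}_{\mathscr{D},\mathcal{S}}f(x)=\sum_{j,k}f_{Q_j^k}\chi_{Q_j^k}(x)$, where $f_Q=\frac1{|Q|}\int_Qf$. Banach function space is understood in the sense of Bennett–Sharpley: $\|f\|_X=\rho(|f|)$, where $\rho$ is a functional on non-negative measurable functions with values in $[0,\infty]$ that is a norm up to a.e. equality, is monotone ($0\le g\le f$ a.e. implies $\rho(g)\le\rho(f)$), has the Fatou property ($0\le f_m\uparrow f$ a.e. implies $\rho(f_m)\uparrow\rho(f)$), satisfies $\rho(\chi_E)<\infty$ whenever $|E|<\infty$, and $\int_E f\le C_E\,\rho(f)$ whenever $|E|<\infty$. *)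

theory Defs
  imports "HOL-Analysis.Analysis"
begin

section \<open>Calderon--Zygmund operators\<close>

text \<open>Values on the diagonal are unconstrained. Measurability of \<open>K\<close> off the diagonal is not
  assumed, since the second estimate makes \<open>K\<close> continuous there.\<close>

definition calderon_zygmund_kernel :: "(real^'n \<Rightarrow> real^'n \<Rightarrow> complex) \<Rightarrow> bool" where
  "calderon_zygmund_kernel K \<longleftrightarrow> (\<exists>c::real.
     (\<forall>x y. x \<noteq> y \<longrightarrow> cmod (K x y) \<le> c / norm (x - y) ^ CARD('n)) \<and>
     (\<exists>\<delta>::real. 0 < \<delta> \<and> \<delta> \<le> 1 \<and>
       (\<forall>x x' y. norm (x - x') < norm (x - y) / 2 \<longrightarrow>
          cmod (K x y - K x' y) + cmod (K y x - K y x')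
            \<le> c * (norm (x - x') powr \<delta> / norm (x - y) powr (real CARD('n) + \<delta>)))))"

definition L2_functions :: "(real^'n \<Rightarrow> complex) set" where
  "L2_functions = {f. f \<in> borel_measurable lebesgue \<and> integrable lebesgue (\<lambda>x. (cmod (f x))\<^sup>2)}"

definition L2_norm :: "(real^'n \<Rightarrow> complex) \<Rightarrow> real" where
  "L2_norm f = sqrt (LINT x|lebesgue. (cmod (f x))\<^sup>2)"

text \<open>An operator on \<open>L\<^sup>2\<close> is represented by its action on functions, identities between functions
  holding almost everywhere. Linearity and the norm bound force it to respect almost everywhere
  equality. The kernel represents \<open>T f\<close> away from the support of \<open>f\<close> only: this allows singular
  integrals such as the Hilbert transform, whose integrals diverge on the support.\<close>

locale calderon_zygmund_operator =
  fixes T :: "(real^'n \<Rightarrow> complex) \<Rightarrow> real^'n \<Rightarrow> complex"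
    and K :: "real^'n \<Rightarrow> real^'n \<Rightarrow> complex"
  assumes L2_closed: "f \<in> L2_functions \<Longrightarrow> T f \<in> L2_functions"
    and L2_linear: "\<lbrakk>f \<in> L2_functions; g \<in> L2_functions\<rbrakk> \<Longrightarrow>
      AE x in lebesgue. T (\<lambda>y. a * f y + b * g y) x = a * T f x + b * T g x"
    and L2_bounded: "\<exists>B. \<forall>f\<in>L2_functions. L2_norm (T f) \<le> B * L2_norm f"
    and kernel: "calderon_zygmund_kernel K"
    and kernel_representation: "\<lbrakk>f \<in> L2_functions; compact (closure {y. f y \<noteq> 0})\<rbrakk> \<Longrightarrow>
      AE x in lebesgue. x \<notin> closure {y. f y \<noteq> 0} \<longrightarrow> T f x = (LINT y|lebesgue. K x y * f y)"

definition maximal_truncation ::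
    "(real^'n \<Rightarrow> real^'n \<Rightarrow> complex) \<Rightarrow> (real^'n \<Rightarrow> complex) \<Rightarrow> real^'n \<Rightarrow> ennreal" where
  "maximal_truncation K f x =
     (SUP (\<epsilon>, \<nu>) \<in> {(\<epsilon>, \<nu>). 0 < \<epsilon> \<and> \<epsilon> < \<nu>}.
        ennreal (cmod (LINT y:{y. \<epsilon> < norm (x - y) \<and> norm (x - y) < \<nu>}|lebesgue. K x y * f y)))"

definition locally_integrable :: "(real^'n \<Rightarrow> complex) \<Rightarrow> bool" where
  "locally_integrable f \<longleftrightarrow> (\<forall>A. compact A \<longrightarrow> set_integrable lebesgue A f)"

section \<open>Dyadic grids and sparse families\<close>

text \<open>Cubes are half-open, so that cubes of equal sidelength can partition the space.\<close>

definition half_open_cube :: "real^'n \<Rightarrow> real \<Rightarrow> (real^'n) set" where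
  "half_open_cube a l = {x. \<forall>i. a $ i \<le> x $ i \<and> x $ i < a $ i + l}"

definition dyadic_grid :: "(real^'n) set set \<Rightarrow> bool" where
  "dyadic_grid D \<longleftrightarrow>
     (\<forall>Q\<in>D. \<exists>a. \<exists>k::int. Q = half_open_cube a (2 powi k)) \<and>
     (\<forall>Q\<in>D. \<forall>R\<in>D. Q \<inter> R \<in> {Q, R, {}}) \<and>
     (\<forall>k::int. partition_on UNIV {Q\<in>D. \<exists>a. Q = half_open_cube a (2 powi k)})"

text \<open>\<open>S k\<close> is the set of the cubes \<open>Q\<^sub>j\<^sup>k\<close> over all \<open>j\<close>; it may be empty. The levels are
  \<open>k = 0, 1, 2, \<dots>\<close>.\<close>

definition sparse_family :: "(real^'n) set set \<Rightarrow> (nat \<Rightarrow> (real^'n) set set) \<Rightarrow> bool" where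
  "sparse_family D S \<longleftrightarrow>
     (\<forall>k. S k \<subseteq> D) \<and>
     (\<forall>k. disjoint (S k)) \<and>
     (\<forall>k. \<Union>(S (Suc k)) \<subseteq> \<Union>(S k)) \<and>
     (\<forall>k. \<forall>Q\<in>S k. measure lebesgue (\<Union>(S (Suc k)) \<inter> Q) \<le> 1/2 * measure lebesgue Q)"

definition average :: "(real^'n) set \<Rightarrow> (real^'n \<Rightarrow> ennreal) \<Rightarrow> ennreal" where
  "average Q g = (\<integral>\<^sup>+x\<in>Q. g x \<partial>lebesgue) / emeasure lebesgue Q"

definition sparse_operator ::
    "(nat \<Rightarrow> (real^'n) set set) \<Rightarrow> (real^'n \<Rightarrow> ennreal) \<Rightarrow> real^'n \<Rightarrow> ennreal" where
  "sparse_operator S g x = (\<Sum>\<^sub>\<infinity>(k, Q)\<in>(SIGMA k:UNIV. S k). average Q g * indicator Q x)"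

section \<open>Banach function norms\<close>

text \<open>The Banach function space given by \<open>\<rho>\<close> has the norm \<open>\<rho> \<bar>f\<bar>\<close>. Only the values of \<open>\<rho>\<close> on
  measurable functions matter.\<close>

locale banach_function_norm =
  fixes M :: "'a measure" and \<rho> :: "('a \<Rightarrow> ennreal) \<Rightarrow> ennreal"
  assumes zero_iff: "f \<in> borel_measurable M \<Longrightarrow> \<rho> f = 0 \<longleftrightarrow> (AE x in M. f x = 0)"
    and scale: "\<lbrakk>f \<in> borel_measurable M; 0 \<le> (a::real)\<rbrakk> \<Longrightarrow>
      \<rho> (\<lambda>x. ennreal a * f x) = ennreal a * \<rho> f"
    and triangle: "\<lbrakk>f \<in> borel_measurable M; g \<in> borel_measurable M\<rbrakk> \<Longrightarrow>
      \<rho> (\<lambda>x. f x + g x) \<le> \<rho> f + \<rho> g"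
    and monotone: "\<lbrakk>f \<in> borel_measurable M; g \<in> borel_measurable M; AE x in M. g x \<le> f x\<rbrakk> \<Longrightarrow>
      \<rho> g \<le> \<rho> f"
    and fatou: "\<lbrakk>\<And>m::nat. F m \<in> borel_measurable M; f \<in> borel_measurable M;
        AE x in M. incseq (\<lambda>m. F m x) \<and> (\<lambda>m. F m x) \<longlonglongrightarrow> f x\<rbrakk> \<Longrightarrow>
      incseq (\<lambda>m. \<rho> (F m)) \<and> (\<lambda>m. \<rho> (F m)) \<longlonglongrightarrow> \<rho> f"
    and finite_indicator: "\<lbrakk>E \<in> sets M; emeasure M E < \<infinity>\<rbrakk> \<Longrightarrow> \<rho> (indicator E) < \<infinity>"
    and local_integral_bound: "\<lbrakk>E \<in> sets M; emeasure M E < \<infinity>\<rbrakk> \<Longrightarrow>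
      \<exists>C<\<infinity>. \<forall>f\<in>borel_measurable M. (\<integral>\<^sup>+x\<in>E. f x \<partial>M) \<le> C * \<rho> f"

end

theory Submission
  imports Defs
begin

text \<open>
  The maximal truncation is dominated pointwise by finitely many sparse operators, so that only
  monotonicity, the triangle inequality and the Fatou property of the norm are needed, and no duality.

  Averaging the truncated integrals over small balls gives Cotlar's inequality in the form
  \<open>\<bar>T\<^sub>\<epsilon> g\<bar>\<^sup>2 \<le> C (M \<bar>g\<bar>\<^sup>2 + M \<bar>T g\<bar>\<^sup>2)\<close>, hence the maximal truncation is of weak type (2,2), and a
  Calderon--Zygmund decomposition over the maximal dyadic cells of a level set of \<open>M\<close> upgrades this to
  weak type (1,1). For a cube \<open>Q\<close> let \<open>E\<close> be the open set where the maximal truncation or the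
  maximal function of \<open>f \<chi>\<^bsub>3Q\<^esub>\<close> exceeds a large multiple of the average of \<open>\<bar>f\<bar>\<close> over \<open>3Q\<close>; then
  \<open>\<bar>E \<inter> Q\<bar> \<le> \<bar>Q\<bar>/2\<close>. The parent of a maximal dyadic cell \<open>P\<close> of \<open>E \<inter> Q\<close> contains a point outside \<open>E\<close>,
  and comparison with that point bounds the maximal truncation of \<open>f \<chi>\<^bsub>3Q - 3P\<^esub>\<close> on \<open>P\<close> by the same
  average. Iteration gives a sparse family of cubes \<open>Q\<close> such that the sum of \<open>f\<^bsub>3Q\<^esub> \<chi>\<^bsub>Q\<^esub>\<close> is a bound.

  Every \<open>3Q\<close> lies in a cell of comparable size of one of the \<open>2\<^sup>n\<close> dyadic grids that are shifted by one
  third in some of the coordinates. These cells satisfy a Carleson packing condition, so keeping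
  only every \<open>m\<close>-th generation of them, for a large \<open>m\<close>, leaves sparse families.
\<close>

section \<open>Shifted dyadic grids\<close>

text \<open>Boundedness on \<open>L2\<close> is all that is known about \<open>T\<close>, which is
  why squares enter Cotlar's inequality: \<open>|T g|^2\<close> is integrable, so the weak type
  (1,1) of the maximal function applies to it and no earlier weak type (1,1) of \<open>T\<close> is
  required. Two conditions define the exceptional set because a bound on the maximal truncation at
  one point passes to a nearby point only up to a multiple of maximal averages there. Triples appear
  because a point of \<open>P\<close> has distance at least the side of \<open>P\<close> from
  everything outside \<open>3P\<close>, so that there the size of the kernel suffices. The cells
  containing the triples need not be sparse: cubes of many levels may be lifted to long chains of
  nested cells. What survives is that the portions of the stopping cubes missed by the next level
  are disjoint and large. Since \<open>f\<close> is only locally integrable, the iteration runs on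
  \<open>f\<close> cut to \<open>3Q0\<close>; the whole space is reached by letting
  \<open>Q0\<close> grow and using the Fatou property. The number of sparse operators depends on the
  dimension only, so the triangle inequality bounds their sum by a multiple of the supremum.\<close>

declare emeasure_completion [simp del]

section \<open>Half-open cubes: corner, side and concentric triple\<close>

lemma mem_half_open_cube: "x \<in> half_open_cube a l \<longleftrightarrow> (\<forall>i. a $ i \<le> x $ i \<and> x $ i < a $ i + l)"
  by (simp add: half_open_cube_def)

lemma half_open_cube_subset_iff:
  assumes "0 < l"
  shows "half_open_cube a l \<subseteq> half_open_cube b m \<longleftrightarrow> (\<forall>i. b $ i \<le> a $ i \<and> a $ i + l \<le> b $ i + m)"
proof
  assume sub: "half_open_cube a l \<subseteq> half_open_cube b m"
  have "a \<in> half_open_cube a l"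
    using assms by (simp add: mem_half_open_cube)
  then have "a \<in> half_open_cube b m" using sub by blast
  then have 1: "\<forall>i. b $ i \<le> a $ i" by (simp add: mem_half_open_cube)
  have 2: "a $ i + l \<le> b $ i + m" for i
  proof (rule ccontr)
    assume c: "\<not> a $ i + l \<le> b $ i + m"
    \<comment> \<open>Moving the corner by \<open>?t\<close> along the diagonal stays inside the
      first cube, as \<open>?t < l\<close>, but reaches the excluded upper face of the second one in
      coordinate \<open>i\<close>.\<close>
    let ?t = "max 0 (b $ i + m - a $ i)"
    have "(\<chi> j. a $ j + ?t) \<in> half_open_cube a l"
      using assms c by (auto simp: mem_half_open_cube)
    then have "(\<chi> j. a $ j + ?t) \<in> half_open_cube b m" using sub by blast
    then show False by (auto simp: mem_half_open_cube dest: spec[of _ i])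
  qed
  show "\<forall>i. b $ i \<le> a $ i \<and> a $ i + l \<le> b $ i + m" using 1 2 by blast
next
  assume "\<forall>i. b $ i \<le> a $ i \<and> a $ i + l \<le> b $ i + m"
  then show "half_open_cube a l \<subseteq> half_open_cube b m"
    unfolding subset_iff mem_half_open_cube by (meson order_trans order.strict_trans2)
qed

lemma half_open_cube_eq_iff:
  assumes "0 < l" "0 < m"
  shows "half_open_cube a l = half_open_cube b m \<longleftrightarrow> a = b \<and> l = m"
proof
  assume "half_open_cube a l = half_open_cube b m"
  then have "\<forall>i. b $ i \<le> a $ i \<and> a $ i + l \<le> b $ i + m" "\<forall>i. a $ i \<le> b $ i \<and> b $ i + m \<le> a $ i + l"
    using assms half_open_cube_subset_iff by (metis order_refl)+
  then have "\<forall>i. a $ i = b $ i" "l = m" by (force simp: order_eq_iff)+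
  then show "a = b \<and> l = m" by (simp add: vec_eq_iff)
qed simp

text \<open>Grids and sparse families are sets of sets, so corner and side have to be recovered from
  the set itself. Uniqueness is \<open>half_open_cube_eq_iff\<close>; the value on sets that are not
  cubes is unspecified.\<close>

definition side :: "(real^'n) set \<Rightarrow> real" where
  "side Q = (THE l. 0 < l \<and> (\<exists>a. Q = half_open_cube a l))"

definition corner :: "(real^'n) set \<Rightarrow> real^'n" where
  "corner Q = (THE a. \<exists>l>0. Q = half_open_cube a l)"

definition tripled :: "(real^'n) set \<Rightarrow> (real^'n) set" where
  "tripled Q = half_open_cube (corner Q - (\<chi> i. side Q)) (3 * side Q)"

definition cube :: "(real^'n) set \<Rightarrow> bool" where
  "cube Q \<longleftrightarrow> (\<exists>a l. 0 < l \<and> Q = half_open_cube a l)"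

lemma side_half_open_cube [simp]: "0 < l \<Longrightarrow> side (half_open_cube a l) = l"
  unfolding side_def by (rule the_equality) (auto simp: half_open_cube_eq_iff)

lemma corner_half_open_cube [simp]: "0 < l \<Longrightarrow> corner (half_open_cube a l) = a"
  unfolding corner_def by (rule the_equality) (auto simp: half_open_cube_eq_iff)

lemma cube_eq: "cube Q \<Longrightarrow> Q = half_open_cube (corner Q) (side Q)"
  by (auto simp: cube_def)

lemma cube_side_pos: "cube Q \<Longrightarrow> 0 < side Q"
  by (auto simp: cube_def)

lemma mem_cube: "cube Q \<Longrightarrow> x \<in> Q \<longleftrightarrow> (\<forall>i. corner Q $ i \<le> x $ i \<and> x $ i < corner Q $ i + side Q)"
  by (subst cube_eq, assumption) (simp add: mem_half_open_cube)

lemma mem_tripled: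
  "x \<in> tripled Q \<longleftrightarrow> (\<forall>i. corner Q $ i - side Q \<le> x $ i \<and> x $ i < corner Q $ i + 2 * side Q)"
  by (simp add: tripled_def mem_half_open_cube algebra_simps)

lemma cube_tripled: "cube Q \<Longrightarrow> cube (tripled Q)"
  unfolding tripled_def cube_def by (metis cube_def cube_side_pos mult_pos_pos zero_less_numeral)

lemma cube_subset_iff:
  assumes "cube Q" "cube R"
  shows "Q \<subseteq> R \<longleftrightarrow> (\<forall>i. corner R $ i \<le> corner Q $ i \<and> corner Q $ i + side Q \<le> corner R $ i + side R)"
  using cube_eq[OF assms(1)] cube_eq[OF assms(2)] half_open_cube_subset_iff[OF cube_side_pos[OF assms(1)]]
  by metis

lemma side_tripled: "cube Q \<Longrightarrow> side (tripled Q) = 3 * side Q"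
  by (simp add: tripled_def cube_side_pos)

lemma subset_tripled: "cube Q \<Longrightarrow> Q \<subseteq> tripled Q"
  by (auto simp: mem_cube mem_tripled dest: cube_side_pos)
     (smt (verit) cube_side_pos)+

lemma cube_subset_side: "cube Q \<Longrightarrow> cube R \<Longrightarrow> Q \<subseteq> R \<Longrightarrow> side Q \<le> side R"
  by (smt (verit) cube_subset_iff)

lemma tripled_mono:
  assumes "cube Q" "cube R" "Q \<subseteq> R"
  shows "tripled Q \<subseteq> tripled R"
proof -
  have "\<forall>i. corner R $ i \<le> corner Q $ i \<and> corner Q $ i + side Q \<le> corner R $ i + side R"
    using assms cube_subset_iff by blast
  moreover have "side Q \<le> side R" using assms by (rule cube_subset_side)
  ultimately show ?thesis by (auto simp: mem_tripled) (smt (verit))+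
qed

lemma half_open_cube_between:
  fixes a :: "real^'n"
  shows "box a (a + (\<chi> i. l)) \<subseteq> half_open_cube a l" "half_open_cube a l \<subseteq> cbox a (a + (\<chi> i. l))"
  by (auto simp: mem_half_open_cube mem_box_cart less_imp_le)

lemma half_open_cube_borel [measurable]: "half_open_cube (a::real^'n) l \<in> sets borel"
proof -
  have "half_open_cube a l = (\<Inter>i\<in>UNIV. {x. a $ i \<le> x $ i} \<inter> {x. x $ i < a $ i + l})"
    by (auto simp: mem_half_open_cube)
  also have "\<dots> \<in> sets borel"
    by (intro sets.finite_INT sets.Int borel_closed borel_open closed_Collect_le open_Collect_less
        continuous_intros) auto
  finally show ?thesis .
qed

lemma emeasure_half_open_cube:
  assumes "0 \<le> l"
  shows "emeasure lebesgue (half_open_cube (a::real^'n) l) = ennreal (l ^ CARD('n))"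
proof -
  have b: "b \<in> Basis \<Longrightarrow> (\<chi> i. l) \<bullet> b = l" for b :: "real^'n"
    by (auto simp: Basis_vec_def inner_axis)
  have "emeasure lborel (box a (a + (\<chi> i. l))) = ennreal (l ^ CARD('n))"
    using assms by (subst emeasure_lborel_box_eq) (auto simp: inner_add_left b)
  moreover have "emeasure lborel (cbox a (a + (\<chi> i. l))) = ennreal (l ^ CARD('n))"
    using assms by (subst emeasure_lborel_cbox_eq) (auto simp: inner_add_left b)
  moreover have "emeasure lborel (box a (a + (\<chi> i. l))) \<le> emeasure lborel (half_open_cube a l)"
    "emeasure lborel (half_open_cube a l) \<le> emeasure lborel (cbox a (a + (\<chi> i. l)))"
    by (intro emeasure_mono half_open_cube_between; simp add: half_open_cube_borel)+
  ultimately show ?thesis by (simp add: emeasure_completion half_open_cube_borel)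
qed

lemma cube_borel: "cube Q \<Longrightarrow> Q \<in> sets borel"
  by (auto simp: cube_def half_open_cube_borel)

lemma cube_lebesgue [simp]: "cube Q \<Longrightarrow> Q \<in> sets lebesgue"
  using cube_borel by (metis sets_completionI_sets sets_lborel)

lemma emeasure_cube: "cube (Q::(real^'n) set) \<Longrightarrow> emeasure lebesgue Q = ennreal (side Q ^ CARD('n))"
  by (metis cube_eq emeasure_half_open_cube cube_side_pos less_imp_le)

lemma measure_cube: "cube (Q::(real^'n) set) \<Longrightarrow> measure lebesgue Q = side Q ^ CARD('n)"
  by (simp add: measure_def emeasure_cube cube_side_pos less_imp_le)

lemma cube_lmeasurable: "cube Q \<Longrightarrow> Q \<in> lmeasurable"
  by (rule fmeasurableI) (simp, simp only: emeasure_cube ennreal_less_top infinity_ennreal_def)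

text \<open>The l1 norm dominates the Euclidean one. Diameters thus carry the factor
  \<open>CARD('n)\<close> instead of its square root, which is the source of the powers of
  \<open>CARD('n)\<close> in the later constants.\<close>

lemma norm_less_if_components:
  fixes z :: "real^'n" and l :: real
  assumes "\<And>i. \<bar>z $ i\<bar> < l"
  shows "norm z < CARD('n) * l"
proof -
  have "(\<Sum>i\<in>UNIV. \<bar>z $ i\<bar>) < (\<Sum>i\<in>(UNIV::'n set). l)"
    by (intro sum_strict_mono assms) auto
  then show ?thesis using norm_le_l1_cart[of z] by simp
qed

lemma cube_dist_less:
  fixes Q :: "(real^'n) set"
  assumes "cube Q" "x \<in> Q" "y \<in> Q"
  shows "norm (x - y) < CARD('n) * side Q"
  using assms by (intro norm_less_if_components) (auto simp: mem_cube abs_less_iff, (smt (verit))+)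

lemma corner_in_cube: "cube Q \<Longrightarrow> corner Q \<in> Q"
  by (simp add: mem_cube cube_side_pos)

lemma tripled_dist_less:
  fixes Q :: "(real^'n) set"
  assumes "cube Q" "x \<in> Q" "y \<in> tripled Q"
  shows "norm (x - y) < 3 * CARD('n) * side Q"
  using cube_dist_less[OF cube_tripled[OF assms(1)], of x y] assms subset_tripled[OF assms(1)]
  by (auto simp: side_tripled mult.assoc mult.left_commute)

text \<open>Some coordinate of \<open>y\<close> is off by a full side. This keeps \<open>K x\<close>
  away from its singularity as soon as the triple of a cube containing \<open>x\<close> is
  removed.\<close>

lemma not_tripled_dist_ge:
  fixes Q :: "(real^'n) set"
  assumes "cube Q" "x \<in> Q" "y \<notin> tripled Q"
  shows "side Q \<le> norm (x - y)"
proof -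
  obtain i where "\<not> (corner Q $ i - side Q \<le> y $ i \<and> y $ i < corner Q $ i + 2 * side Q)"
    using assms(3) by (auto simp: mem_tripled)
  moreover have "corner Q $ i \<le> x $ i" "x $ i < corner Q $ i + side Q" using assms by (auto simp: mem_cube)
  ultimately have "side Q \<le> \<bar>(x - y) $ i\<bar>" by auto
  then show ?thesis using component_le_norm_cart[of "x - y" i] by linarith
qed

section \<open>Cells of the shifted grids and their nesting\<close>

lemma powi_le_iff: "(2::real) powi k \<le> 2 powi l \<longleftrightarrow> k \<le> l"
  by (meson not_le one_less_numeral_iff power_int_increasing power_int_strict_increasing semiring_norm(76) less_imp_le)

text \<open>The sign alternates because \<open>2\<^sup>k/3\<close> and \<open>- 2\<^bsup>k+1\<^esup>/3\<close> differ by \<open>2\<^sup>k\<close>, which makes the shifted grids nested.\<close>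

definition grid_shift :: "'n set \<Rightarrow> int \<Rightarrow> 'n \<Rightarrow> real" where
  "grid_shift A k i = (if i \<in> A then if even k then 1/3 else - 1/3 else 0)"

definition cell_index :: "'n set \<Rightarrow> int \<Rightarrow> real^'n \<Rightarrow> 'n \<Rightarrow> int" where
  "cell_index A k x i = \<lfloor>x $ i / 2 powi k - grid_shift A k i\<rfloor>"

text \<open>As fibres of an integer index, the cells of one level partition the space by
  construction; that they are cubes is shown in \<open>cell_eq_half_open_cube\<close>.\<close>

definition cell :: "'n set \<Rightarrow> int \<Rightarrow> real^'n \<Rightarrow> (real^'n) set" where
  "cell A k x = {y. cell_index A k y = cell_index A k x}"

definition shifted_grid :: "'n set \<Rightarrow> (real^'n) set set" where
  "shifted_grid A = {cell A k x | k x. True}"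

lemma cell_eq_half_open_cube:
  "cell A k x = half_open_cube (\<chi> i. 2 powi k * (cell_index A k x i + grid_shift A k i)) (2 powi k)"
proof -
  have "\<lfloor>u / 2 powi k - s\<rfloor> = m \<longleftrightarrow> 2 powi k * (real_of_int m + s) \<le> u \<and> u < 2 powi k * (real_of_int m + s) + 2 powi k"
    for u s :: real and m
  proof -
    have "\<lfloor>u / 2 powi k - s\<rfloor> = m \<longleftrightarrow> real_of_int m + s \<le> u / 2 powi k \<and> u / 2 powi k < (real_of_int m + s) + 1"
      by (auto simp: floor_eq_iff)
    also have "\<dots> \<longleftrightarrow> 2 powi k * (real_of_int m + s) \<le> u \<and> u < 2 powi k * (real_of_int m + s) + 2 powi k"
      by (simp add: field_simps)
    finally show ?thesis .
  qed
  then show ?thesis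
    unfolding cell_def half_open_cube_def by (auto simp: fun_eq_iff cell_index_def)
qed

lemma cube_cell [simp]: "cube (cell A k x)"
  unfolding cube_def using cell_eq_half_open_cube by (metis zero_less_numeral zero_less_power_int)

lemma side_cell [simp]: "side (cell A k x) = 2 powi k"
  by (simp add: cell_eq_half_open_cube)

lemma mem_cell_self [simp]: "x \<in> cell A k x"
  by (simp add: cell_def)

lemma cell_eq: "y \<in> cell A k x \<Longrightarrow> cell A k y = cell A k x"
  by (simp add: cell_def)

lemma cell_index_parent:
  "cell_index A k x i = cell_index A k y i \<Longrightarrow> cell_index A (k + 1) x i = cell_index A (k + 1) y i"
proof -
  define s where "s = grid_shift A (k + 1) i"
  \<comment> \<open>\<open>m\<close> is \<open>3 * s\<close>, an integer. As
    \<open>u / 2^(k+1) - s = (u / 2^k + s - 3 * s) / 2\<close> and level \<open>k\<close> has the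
    opposite shift \<open>- s\<close>, the index at level \<open>k + 1\<close> arises from the one
    at level \<open>k\<close> by an integer division.\<close>
  define m :: int where "m = (if i \<in> A then if even (k + 1) then 1 else - 1 else 0)"
  have ms: "real_of_int m = 3 * s" and s': "grid_shift A k i = - s"
    by (auto simp: m_def s_def grid_shift_def)
  have "cell_index A (k + 1) z i = (cell_index A k z i - m) div 2" for z
  proof -
    have "z $ i / 2 powi (k + 1) - s = (z $ i / 2 powi k + s - of_int m) / real_of_int 2"
      by (simp add: ms power_int_add field_simps)
    then have "cell_index A (k + 1) z i = \<lfloor>(z $ i / 2 powi k + s - of_int m) / real_of_int 2\<rfloor>"
      by (simp only: cell_index_def s_def[symmetric])
    also have "\<dots> = \<lfloor>z $ i / 2 powi k + s - of_int m\<rfloor> div 2"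
      by (rule floor_divide_real_eq_div) simp
    finally show ?thesis by (simp add: cell_index_def s')
  qed
  moreover assume "cell_index A k x i = cell_index A k y i"
  ultimately show ?thesis by simp
qed

lemma cell_mono: "k \<le> l \<Longrightarrow> cell A k x \<subseteq> cell A l x"
proof (induction l rule: int_ge_induct)
  case (step l)
  have "cell A l x \<subseteq> cell A (l + 1) x"
    by (auto simp: cell_def fun_eq_iff intro: cell_index_parent)
  then show ?case using step by blast
qed simp

lemma cell_in_grid [simp]: "cell A k x \<in> shifted_grid A"
  by (auto simp: shifted_grid_def)

lemma cube_grid: "Q \<in> shifted_grid A \<Longrightarrow> cube Q"
  by (auto simp: shifted_grid_def)

lemma gridE:
  assumes "Q \<in> shifted_grid A" "x \<in> Q"
  obtains k where "Q = cell A k x"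
proof -
  from assms(1) obtain k y where Q: "Q = cell A k y" by (auto simp: shifted_grid_def)
  with assms(2) have "Q = cell A k x" by (simp add: cell_eq)
  then show ?thesis by (rule that)
qed

lemma grid_nested:
  assumes "Q \<in> shifted_grid A" "R \<in> shifted_grid A" "Q \<inter> R \<noteq> {}" "side Q \<le> side R"
  shows "Q \<subseteq> R"
proof -
  obtain x where x: "x \<in> Q" "x \<in> R" using assms by blast
  obtain k l where "Q = cell A k x" "R = cell A l x"
    using assms x by (meson gridE)
  moreover from this assms(4) have "k \<le> l" by (simp add: powi_le_iff)
  ultimately show ?thesis by (simp add: cell_mono)
qed

lemma grid_eqI:
  assumes "Q \<in> shifted_grid A" "R \<in> shifted_grid A" "Q \<inter> R \<noteq> {}" "side Q = side R"
  shows "Q = R"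
  using grid_nested[of Q A R] grid_nested[of R A Q] assms by (simp add: Int_commute subset_antisym)

lemma grid_cases:
  assumes "Q \<in> shifted_grid A" "R \<in> shifted_grid A"
  obtains "Q \<inter> R = {}" | "Q \<subseteq> R" | "R \<subseteq> Q"
  using grid_nested[of Q A R] grid_nested[of R A Q] assms by (metis Int_commute linear)

lemma grid_psubset_side:
  assumes "Q \<in> shifted_grid A" "R \<in> shifted_grid A" "Q \<subset> R"
  shows "2 * side Q \<le> side R"
proof -
  obtain k x where Q: "Q = cell A k x" using assms by (auto simp: shifted_grid_def)
  then have "x \<in> R" using assms(3) mem_cell_self by blast
  then obtain l where R: "R = cell A l x" by (rule gridE[OF assms(2)])
  have "\<not> l \<le> k" using cell_mono[of l k A x] assms Q R by blast
  then have "k + 1 \<le> l" by simp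
  then have "(2::real) powi (k + 1) \<le> 2 powi l" by (simp add: power_int_increasing)
  then show ?thesis by (simp add: Q R power_int_add)
qed

lemma countable_grid: "countable (shifted_grid (A :: 'n::finite set))"
proof -
  have "shifted_grid A \<subseteq> (\<Union>k. (\<lambda>m. {y. cell_index A k y = m}) ` UNIV)"
    by (auto simp: shifted_grid_def cell_def)
  moreover have "countable (UNIV :: ('n \<Rightarrow> int) set)" by simp
  ultimately show ?thesis by (meson countable_UN countable_image countable_subset uncountable_def countableI_type)
qed

lemma dyadic_grid_shifted_grid: "dyadic_grid (shifted_grid (A :: 'n::finite set))"
proof -
  have "partition_on UNIV {Q \<in> shifted_grid A. \<exists>a. Q = half_open_cube a (2 powi k)}" for k :: int
  proof (rule partition_onI)
    show "\<Union> {Q \<in> shifted_grid A. \<exists>a. Q = half_open_cube a (2 powi k)} = UNIV"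
      using cell_eq_half_open_cube[of A k] mem_cell_self[of _ A k] cell_in_grid[of A k] by blast
    fix p q :: "(real^'n) set"
    assume "p \<in> {Q \<in> shifted_grid A. \<exists>a. Q = half_open_cube a (2 powi k)}"
      "q \<in> {Q \<in> shifted_grid A. \<exists>a. Q = half_open_cube a (2 powi k)}" "p \<noteq> q"
    then have "p \<in> shifted_grid A" "q \<in> shifted_grid A" "side p = side q" "p \<noteq> q" by auto
    then show "disjnt p q" unfolding disjnt_def using grid_eqI by blast
  next
    show "{} \<notin> {Q \<in> shifted_grid A. \<exists>a. Q = half_open_cube a (2 powi k)}"
      by (metis (mono_tags, lifting) corner_in_cube cube_grid empty_iff mem_Collect_eq)
  qed
  moreover have "Q \<inter> R \<in> {Q, R, {}}" if "Q \<in> shifted_grid A" "R \<in> shifted_grid A" for Q R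
    using that by (rule grid_cases) auto
  moreover have "\<exists>a. \<exists>k::int. Q = half_open_cube a (2 powi k)" if "Q \<in> shifted_grid A" for Q
    using that by (auto simp: shifted_grid_def cell_eq_half_open_cube)
  ultimately show ?thesis unfolding dyadic_grid_def by blast
qed

text \<open>The endpoints of the two one-dimensional grids of step \<open>s\<close> are at distance at least \<open>s/3\<close>
  from each other, so an interval shorter than that is cut by at most one of them.\<close>

lemma one_third_trick:
  fixes u v t :: real
  assumes "v \<le> u + 1/3" "\<bar>t\<bar> = 1/3"
  shows "(\<exists>m::int. m \<le> u \<and> v \<le> m + 1) \<or> (\<exists>m::int. m + t \<le> u \<and> v \<le> m + t + 1)"
proof (cases "v \<le> of_int \<lfloor>u\<rfloor> + 1")
  case True then show ?thesis by (intro disjI1 exI[of _ "\<lfloor>u\<rfloor>"]) linarith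
next
  case False
  show ?thesis
  proof (cases "t > 0")
    case True
    then have "t = 1/3" using assms by linarith
    with False assms show ?thesis by (intro disjI2 exI[of _ "\<lfloor>u\<rfloor>"]) linarith
  next
    case f: False
    then have "t = -1/3" using assms by linarith
    with False assms show ?thesis by (intro disjI2 exI[of _ "\<lfloor>u\<rfloor> + 1"]) linarith
  qed
qed

text \<open>\<open>one_third_trick\<close> is applied to each coordinate separately, and
  \<open>A\<close> collects the coordinates that need the shift; hence one grid for each set of
  coordinates. The triple may fill at most a third of the cell, so the cell needs at least 9 times
  the side of \<open>Q\<close>, and 16 is the next power of two.\<close>

lemma tripled_subset_shifted_cell:
  fixes Q :: "(real^'n) set"
  assumes "Q \<in> shifted_grid B"
  obtains A R where "R \<in> shifted_grid A" "side R = 16 * side Q" "tripled Q \<subseteq> R"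
proof -
  obtain k x where Q: "Q = cell B k x" using assms by (auto simp: shifted_grid_def)
  then have cQ: "cube Q" and sQ: "side Q = 2 powi k" by simp_all
  define s :: real where "s = 2 powi (k + 4)"
  have s: "s = 16 * side Q" "0 < s" by (auto simp: s_def sQ power_int_add)
  define c where "c = corner Q"
  define t :: real where "t = (if even (k + 4) then 1/3 else - 1/3)"
  have "\<exists>m::int. \<exists>e\<in>{0, t}. s * (m + e) \<le> c $ i - side Q \<and> c $ i + 2 * side Q \<le> s * (m + e) + s" for i
  proof -
    have "(c $ i + 2 * side Q) / s \<le> (c $ i - side Q) / s + 1/3"
      using s cube_side_pos[OF cQ] by (simp add: field_simps)
    moreover have "\<bar>t\<bar> = 1/3" by (simp add: t_def)
    ultimately have "\<exists>m::int. \<exists>e\<in>{0, t}. m + e \<le> (c $ i - side Q) / s \<and> (c $ i + 2 * side Q) / s \<le> m + e + 1"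
      using one_third_trick[of "(c $ i + 2 * side Q) / s" "(c $ i - side Q) / s" t]
      by (metis add.right_neutral insertI1 insertI2 singletonI)
    then obtain m :: int and e :: real where "e \<in> {0, t}" "m + e \<le> (c $ i - side Q) / s" "(c $ i + 2 * side Q) / s \<le> m + e + 1"
      by blast
    then show ?thesis using s(2) by (intro exI[of _ m] bexI[of _ e]) (auto simp: field_simps)
  qed
  then obtain m :: "'n \<Rightarrow> int" and e :: "'n \<Rightarrow> real" where me: "\<And>i. e i \<in> {0, t}"
    "\<And>i. s * (m i + e i) \<le> c $ i - side Q \<and> c $ i + 2 * side Q \<le> s * (m i + e i) + s"
    by metis
  define A where "A = {i. e i \<noteq> 0}"
  define z :: "real^'n" where "z = (\<chi> i. s * (m i + e i))"
  have e: "grid_shift A (k + 4) i = e i" for i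
    using me(1)[of i] by (auto simp: A_def grid_shift_def t_def)
  have "cell_index A (k + 4) z i = m i" for i
    using s(2) by (simp add: cell_index_def e z_def s_def[symmetric])
  then have R: "cell A (k + 4) z = half_open_cube z s"
    by (simp add: cell_eq_half_open_cube e z_def s_def[symmetric])
  show ?thesis
  proof (rule that)
    show "cell A (k + 4) z \<in> shifted_grid A" by simp
    show "side (cell A (k + 4) z) = 16 * side Q" using s by (simp add: R)
    show "tripled Q \<subseteq> cell A (k + 4) z" unfolding R tripled_def
      using cube_side_pos[OF cQ] me(2) 
      by (subst half_open_cube_subset_iff) (auto simp: z_def c_def algebra_simps)
  qed
qed

text \<open>This fails in coordinates without shift, where all cells stay on one side of 0.\<close>

lemma eventually_mem_cell:
  fixes x :: "real^'n"
  shows "\<forall>\<^sub>F k in sequentially. x \<in> cell UNIV (int k) 0"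
proof -
  have "\<forall>\<^sub>F k in sequentially. \<bar>x $ i\<bar> / 2 ^ k < 1/3" for i
  proof -
    have "(\<lambda>k. \<bar>x $ i\<bar> / 2 ^ k) \<longlonglongrightarrow> 0"
      using LIMSEQ_divide_realpow_zero[of 2 "\<bar>x $ i\<bar>"] by simp
    then show ?thesis by (rule order_tendstoD) simp
  qed
  then have "\<forall>\<^sub>F k in sequentially. \<forall>i. \<bar>x $ i\<bar> / 2 ^ k < 1/3"
    by (rule eventually_all_finite)
  then show ?thesis
  proof eventually_elim
    case (elim k)
    have "cell_index UNIV (int k) x i = cell_index UNIV (int k) 0 i" for i
    proof -
      define u where "u = x $ i / 2 ^ k"
      have "\<bar>u\<bar> < 1/3" using elim by (simp add: u_def abs_divide)
      then have "\<lfloor>u - 1/3\<rfloor> = -1" "\<lfloor>u + 1/3\<rfloor> = 0" by (auto simp: floor_eq_iff)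
      then show ?thesis
        by (simp add: cell_index_def grid_shift_def u_def[symmetric])
    qed
    then show ?case by (simp add: cell_def fun_eq_iff)
  qed
qed

lemma powi_small: "0 < (e::real) \<Longrightarrow> \<exists>k::int. 2 powi k < e"
proof -
  assume "0 < e"
  then obtain j where "(1/2::real) ^ j < e" using real_arch_pow_inv[of e "1/2"] by auto
  then have "2 powi (- int j) < e" by (simp add: power_int_minus power_one_over field_simps)
  then show ?thesis by blast
qed

text \<open>All levels from some point downwards are provided, because \<open>Union_children\<close>
  also has to stay below the level of a given cube.\<close>

lemma small_cell:
  fixes x :: "real^'n"
  assumes "open U" "x \<in> U"
  shows "\<exists>k. \<forall>l\<le>k. cell A l x \<subseteq> U"
proof -
  obtain e where e: "0 < e" "ball x e \<subseteq> U" using assms by (meson open_contains_ball)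
  obtain k :: int where k: "2 powi k < e / CARD('n)" using powi_small[of "e / CARD('n)"] e by auto
  have "cell A l x \<subseteq> U" if "l \<le> k" for l
  proof
    fix y assume "y \<in> cell A l x"
    then have "norm (x - y) < CARD('n) * 2 powi l" using cube_dist_less[of "cell A l x" x y] by simp
    also have "\<dots> \<le> CARD('n) * 2 powi k" using that by (simp add: power_int_increasing)
    also have "\<dots> < e" using k by (simp add: field_simps)
    finally show "y \<in> U" using e by (auto simp: dist_norm)
  qed
  then show ?thesis by blast
qed

section \<open>Maximal cells inside a set\<close>

definition maximal_cells :: "'n set \<Rightarrow> (real^'n) set \<Rightarrow> (real^'n) set set" where
  "maximal_cells A E = {Q \<in> shifted_grid A. Q \<subseteq> E \<and> (\<forall>R\<in>shifted_grid A. Q \<subset> R \<longrightarrow> \<not> R \<subseteq> E)}"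

lemma maximal_cells_grid: "maximal_cells A E \<subseteq> shifted_grid A"
  by (auto simp: maximal_cells_def)

lemma disjoint_maximal_cells: "disjoint (maximal_cells A E)"
proof (rule disjointI)
  fix Q R assume QR: "Q \<in> maximal_cells A E" "R \<in> maximal_cells A E" "Q \<noteq> R"
  then have "\<not> Q \<subset> R" "\<not> R \<subset> Q" by (auto simp: maximal_cells_def)
  moreover have "Q \<in> shifted_grid A" "R \<in> shifted_grid A" using QR by (auto simp: maximal_cells_def)
  ultimately show "Q \<inter> R = {}" using \<open>Q \<noteq> R\<close> by (metis grid_cases psubsetI)
qed

text \<open>The parent is strictly larger, so maximality forbids it to lie in \<open>E\<close>. Its
  point outside \<open>E\<close> is within a multiple of the side of \<open>Q\<close>, and this is
  how quantities on \<open>Q\<close> are controlled later.\<close>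

lemma maximal_cells_parent:
  assumes "Q \<in> maximal_cells A E"
  obtains R where "R \<in> shifted_grid A" "Q \<subseteq> R" "side R = 2 * side Q" "\<not> R \<subseteq> E"
proof -
  obtain k x where Q: "Q = cell A k x" using assms by (auto simp: maximal_cells_def shifted_grid_def)
  have sub: "Q \<subseteq> cell A (k + 1) x" by (simp add: Q cell_mono)
  have side: "side (cell A (k + 1) x) = 2 * side Q" by (simp add: Q power_int_add)
  moreover have "0 < side Q" by (simp add: Q)
  ultimately have "Q \<noteq> cell A (k + 1) x" by auto
  with sub side assms show ?thesis
    by (intro that[of "cell A (k + 1) x"]) (auto simp: maximal_cells_def)
qed

text \<open>Finite measure bounds the levels of the cells of \<open>x\<close> inside
  \<open>E\<close>, so there is a highest one. Small cells are assumed instead of openness because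
  \<open>E\<close> is later also the trace of an open set on a half-open cube.\<close>

lemma Union_maximal_cells:
  fixes E :: "(real^'n) set"
  assumes small: "\<And>x. x \<in> E \<Longrightarrow> \<exists>k. cell A k x \<subseteq> E" and E: "emeasure lebesgue E < \<infinity>" "E \<in> sets lebesgue"
  shows "\<Union> (maximal_cells A E) = E"
proof
  show "E \<subseteq> \<Union> (maximal_cells A E)"
  proof
    fix x assume "x \<in> E"
    define K where "K = {k. cell A k x \<subseteq> E}"
    obtain b :: real where b: "emeasure lebesgue E = ennreal b" "0 \<le> b" using E by (cases "emeasure lebesgue E") auto
    have bd: "k \<le> int (nat \<lceil>b\<rceil>)" if "k \<in> K" for k
    proof (rule ccontr)
      assume "\<not> k \<le> int (nat \<lceil>b\<rceil>)"
      then have k: "0 \<le> k" "b \<le> nat k" by linarith+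
      have "emeasure lebesgue (cell A k x) \<le> ennreal b"
        using that E b by (metis K_def emeasure_mono mem_Collect_eq)
      then have "(2 powi k) ^ CARD('n) \<le> b" using b(2) by (simp add: emeasure_cube)
      moreover have "(2::real) powi k \<le> (2 powi k) ^ CARD('n)"
        using self_le_power[of "2 powi k::real" "CARD('n)"] one_le_power_int[of 2 k] k by simp
      moreover have "real (nat k) < 2 ^ nat k" by simp
      ultimately show False using k by (simp add: power_int_def)
    qed
    obtain k0 where "k0 \<in> K" using small[OF \<open>x \<in> E\<close>] by (auto simp: K_def)
    \<comment> \<open>The set \<open>K\<close> of integer levels is unbounded below, so the maximum
      is taken above a known member \<open>k0\<close> only.\<close>
    define k where "k = Max {k\<in>K. k0 \<le> k}"
    have fin: "finite {k\<in>K. k0 \<le> k}"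
      by (rule finite_subset[of _ "{k0..int (nat \<lceil>b\<rceil>)}"]) (auto dest: bd)
    then have "k \<in> {k\<in>K. k0 \<le> k}" unfolding k_def by (rule Max_in) (use \<open>k0 \<in> K\<close> in auto)
    moreover have "l \<le> k" if "l \<in> K" for l
    proof (cases "k0 \<le> l")
      case True then show ?thesis unfolding k_def using fin that by (intro Max_ge) auto
    next
      case False
      then show ?thesis using \<open>k \<in> {k\<in>K. k0 \<le> k}\<close> by simp
    qed
    ultimately have k: "cell A k x \<subseteq> E" "\<And>l. cell A l x \<subseteq> E \<Longrightarrow> l \<le> k" by (auto simp: K_def)
    have "\<not> R \<subseteq> E" if R: "R \<in> shifted_grid A" "cell A k x \<subset> R" for R
    proof
      assume "R \<subseteq> E"
      have "x \<in> R" using that(2) mem_cell_self by blast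
      then obtain l where l: "R = cell A l x" by (rule gridE[OF R(1)])
      then have "l \<le> k" using \<open>R \<subseteq> E\<close> k(2) by simp
      then have "R \<subseteq> cell A k x" unfolding l by (rule cell_mono)
      with that show False by blast
    qed
    then have "cell A k x \<in> maximal_cells A E" using k(1) by (simp add: maximal_cells_def)
    then show "x \<in> \<Union> (maximal_cells A E)" by (meson UnionI mem_cell_self)
  qed
qed (auto simp: maximal_cells_def)

lemma countable_maximal_cells: "countable (maximal_cells A (E :: (real^'n) set))"
  using countable_grid maximal_cells_grid by (rule countable_subset[rotated])

section \<open>Level sets of the maximal function\<close>

lemma borel_sets_lebesgue: "A \<in> sets borel \<Longrightarrow> A \<in> sets lebesgue"
  by (metis sets_completionI_sets sets_lborel)

lemma open_sets_lebesgue: "open A \<Longrightarrow> A \<in> sets lebesgue"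
  by (simp add: borel_sets_lebesgue)

lemma ball_sets_lebesgue [measurable]: "ball x r \<in> sets lebesgue"
  by (simp add: open_sets_lebesgue)

text \<open>With \<open>g\<close> as a density this is countable additivity. Writing sums over a
  countable family as integrals over \<open>count_space\<close> spares an enumeration and makes
  Tonelli's theorem available for exchanging them with Lebesgue integrals.\<close>

lemma nn_integral_UN_countable:
  assumes "countable I" "\<And>i. i \<in> I \<Longrightarrow> X i \<in> sets M" "disjoint_family_on X I"
    "g \<in> borel_measurable M"
  shows "(\<integral>\<^sup>+x\<in>\<Union>(X ` I). g x \<partial>M) = (\<integral>\<^sup>+i. (\<integral>\<^sup>+x\<in>X i. g x \<partial>M) \<partial>count_space I)"
proof -
  have "\<Union>(X ` I) \<in> sets M" using assms by (intro sets.countable_UN') auto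
  then have "(\<integral>\<^sup>+x\<in>\<Union>(X ` I). g x \<partial>M) = emeasure (density M g) (\<Union>(X ` I))"
    using assms by (simp add: emeasure_density)
  also have "\<dots> = (\<integral>\<^sup>+i. emeasure (density M g) (X i) \<partial>count_space I)"
    using assms by (intro emeasure_UN_countable) auto
  also have "\<dots> = (\<integral>\<^sup>+i. (\<integral>\<^sup>+x\<in>X i. g x \<partial>M) \<partial>count_space I)"
    using assms by (intro nn_integral_cong) (simp add: emeasure_density)
  finally show ?thesis .
qed

lemma emeasure_UN_count_space_le:
  assumes "countable I" "\<And>i. i \<in> I \<Longrightarrow> X i \<in> sets M"
  shows "emeasure M (\<Union>(X ` I)) \<le> (\<integral>\<^sup>+i. emeasure M (X i) \<partial>count_space I)"
proof -
  have "\<Union>(X ` I) \<in> sets M" using assms by (intro sets.countable_UN') auto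
  then have "emeasure M (\<Union>(X ` I)) = (\<integral>\<^sup>+x. indicator (\<Union>(X ` I)) x \<partial>M)" by simp
  also have "\<dots> \<le> (\<integral>\<^sup>+x. (\<integral>\<^sup>+i. indicator (X i) x \<partial>count_space I) \<partial>M)"
  proof (rule nn_integral_mono)
    fix x
    show "indicator (\<Union>(X ` I)) x \<le> (\<integral>\<^sup>+i. indicator (X i) x \<partial>count_space I)"
    proof (cases "x \<in> \<Union>(X ` I)")
      case True
      then obtain i where i: "i \<in> I" "x \<in> X i" by auto
      then have "1 \<le> (\<integral>\<^sup>+i. indicator (X i) x \<partial>count_space I)"
        using nn_integral_ge_point[OF i(1), of "\<lambda>i. indicator (X i) x"] by simp
      with True show ?thesis by simp
    qed simp
  qed
  also have "\<dots> = (\<integral>\<^sup>+i. (\<integral>\<^sup>+x. indicator (X i) x \<partial>M) \<partial>count_space I)"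
    using assms by (intro nn_integral_count_space_nn_integral) auto
  also have "\<dots> = (\<integral>\<^sup>+i. emeasure M (X i) \<partial>count_space I)"
    using assms by (intro nn_integral_cong) simp
  finally show ?thesis .
qed

lemma nn_integral_set_mono:
  "A \<subseteq> B \<Longrightarrow> (\<integral>\<^sup>+x\<in>A. g x \<partial>M) \<le> (\<integral>\<^sup>+x\<in>B. g x \<partial>M)" for g :: "_ \<Rightarrow> ennreal"
  by (intro nn_integral_mono) (auto simp: indicator_def)

text \<open>The level sets of the centred maximal function, with averages normalised by \<open>r\<^sup>n\<close> instead of the volume
  of the ball.\<close>

definition maximal_level :: "(real^'n \<Rightarrow> ennreal) \<Rightarrow> real \<Rightarrow> (real^'n) set" where
  "maximal_level g t = {x. \<exists>r>0. ennreal (t * r ^ CARD('n)) < (\<integral>\<^sup>+y\<in>ball x r. g y \<partial>lebesgue)}"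

lemma not_maximal_levelD:
  "x \<notin> maximal_level g t \<Longrightarrow> 0 < r \<Longrightarrow>
    (\<integral>\<^sup>+y\<in>ball x r. g y \<partial>lebesgue) \<le> ennreal (t * r ^ CARD('n))" for x :: "real^'n" and r t :: real
  by (rule ccontr) (auto simp: maximal_level_def not_le)

lemma not_maximal_level_subset:
  fixes x :: "real^'n" and r t :: real
  assumes "x \<notin> maximal_level g t" "0 < r" "A \<subseteq> ball x r"
  shows "(\<integral>\<^sup>+y\<in>A. g y \<partial>lebesgue) \<le> ennreal (t * r ^ CARD('n))"
  using nn_integral_set_mono[OF assms(3)] not_maximal_levelD[OF assms(1,2)] by (rule order_trans)

text \<open>The strict inequality survives a slightly larger radius \<open>s\<close>, and the ball
  of radius \<open>s\<close> about any point within \<open>s - r\<close> of \<open>x\<close> still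
  contains \<open>ball x r\<close>.\<close>

lemma open_maximal_level: "open (maximal_level g t)" for g :: "real^'n \<Rightarrow> ennreal"
  unfolding open_contains_ball
proof
  fix x assume "x \<in> maximal_level g t"
  then obtain r where r: "0 < r" "ennreal (t * r ^ CARD('n)) < (\<integral>\<^sup>+y\<in>ball x r. g y \<partial>lebesgue)"
    by (auto simp: maximal_level_def)
  have "((\<lambda>s. ennreal (t * s ^ CARD('n))) \<longlongrightarrow> ennreal (t * r ^ CARD('n))) (at_right r)"
    by (intro tendsto_intros)
  then have "\<forall>\<^sub>F s in at_right r. ennreal (t * s ^ CARD('n)) < (\<integral>\<^sup>+y\<in>ball x r. g y \<partial>lebesgue)"
    using r(2) by (rule order_tendstoD)
  then obtain b where b: "r < b" "\<And>s. r < s \<Longrightarrow> s < b \<Longrightarrow> ennreal (t * s ^ CARD('n)) < (\<integral>\<^sup>+y\<in>ball x r. g y \<partial>lebesgue)"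
    unfolding eventually_at_right_field by blast
  define s where "s = (r + b) / 2"
  have s: "r < s" "ennreal (t * s ^ CARD('n)) < (\<integral>\<^sup>+y\<in>ball x r. g y \<partial>lebesgue)"
    using b by (auto simp: s_def)
  have "ball x (s - r) \<subseteq> maximal_level g t"
  proof
    fix z assume z: "z \<in> ball x (s - r)"
    have "ball x r \<subseteq> ball z s"
    proof
      fix y assume "y \<in> ball x r"
      then show "y \<in> ball z s" using z dist_triangle[of z y x] by (simp add: dist_commute)
    qed
    from s(2) nn_integral_set_mono[OF this] have "ennreal (t * s ^ CARD('n)) < (\<integral>\<^sup>+y\<in>ball z s. g y \<partial>lebesgue)"
      by (rule less_le_trans)
    then show "z \<in> maximal_level g t" using r s(1) unfolding maximal_level_def
      by (intro CollectI exI[of _ s]) auto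
  qed
  then show "\<exists>e>0. ball x e \<subseteq> maximal_level g t" using s(1) by (intro exI[of _ "s - r"]) auto
qed

lemma emeasure_lebesgue_ball:
  fixes r :: real
  shows "0 \<le> r \<Longrightarrow> emeasure lebesgue (ball (x :: real^'n) r) = ennreal (unit_ball_vol CARD('n) * r ^ CARD('n))"
  using emeasure_ball[of r x] by (simp add: emeasure_completion)

text \<open>Weak type (1,1) of the maximal function. The Vitali covering lemma selects disjoint
  balls of mass more than \<open>t * r ^ CARD('n)\<close> whose fivefold dilates cover the level
  set.\<close>

lemma emeasure_maximal_level:
  fixes g :: "real^'n \<Rightarrow> ennreal" and t :: real
  assumes g: "g \<in> borel_measurable lebesgue" and t: "0 < t"
  shows "ennreal t * emeasure lebesgue (maximal_level g t)
    \<le> ennreal (5 ^ CARD('n) * unit_ball_vol CARD('n)) * (\<integral>\<^sup>+x. g x \<partial>lebesgue)"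
proof (cases "(\<integral>\<^sup>+x. g x \<partial>lebesgue) = \<infinity>")
  case True
  have "0 < 5 ^ CARD('n) * unit_ball_vol CARD('n)" by (intro mult_pos_pos unit_ball_vol_pos) auto
  then have "ennreal (5 ^ CARD('n) * unit_ball_vol CARD('n)) \<noteq> 0"
    by (simp only: ennreal_eq_0_iff not_le)
  then have "ennreal (5 ^ CARD('n) * unit_ball_vol CARD('n)) * \<infinity> = \<infinity>"
    by (metis ennreal_mult_eq_top_iff infinity_ennreal_def)
  then show ?thesis using True by simp
next
  case False
  then obtain b where b: "(\<integral>\<^sup>+x. g x \<partial>lebesgue) = ennreal b" "0 \<le> b"
    by (cases "\<integral>\<^sup>+x. g x \<partial>lebesgue") auto
  define K where "K = maximal_level g t"
  define c where "c = 5 ^ CARD('n) * unit_ball_vol CARD('n)"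
  have c: "0 < c" unfolding c_def by (intro mult_pos_pos unit_ball_vol_pos) auto
  have "\<exists>r>0. ennreal (t * r ^ CARD('n)) < (\<integral>\<^sup>+y\<in>ball x r. g y \<partial>lebesgue)" if "x \<in> K" for x
    using that by (auto simp: K_def maximal_level_def)
  then obtain r where r: "\<And>x. x \<in> K \<Longrightarrow> 0 < r x"
    "\<And>x. x \<in> K \<Longrightarrow> ennreal (t * r x ^ CARD('n)) < (\<integral>\<^sup>+y\<in>ball x (r x). g y \<partial>lebesgue)"
    by metis
  \<comment> \<open>The covering lemma requires bounded radii; the bound comes from the finite total
    mass \<open>b\<close>.\<close>
  have rB: "r x \<le> max 1 (b / t)" if "x \<in> K" for x
  proof (cases "r x \<le> 1")
    case False
    have "(\<integral>\<^sup>+y\<in>ball x (r x). g y \<partial>lebesgue) \<le> (\<integral>\<^sup>+y. g y \<partial>lebesgue)"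
      by (intro nn_integral_mono) (auto simp: indicator_def)
    then have "ennreal (t * r x ^ CARD('n)) < ennreal b" using r(2)[OF that] b(1) by simp
    then have 1: "t * r x ^ CARD('n) < b" using r(1)[OF that] t by (subst (asm) ennreal_less_iff) auto
    have "r x \<le> r x ^ CARD('n)" using False by (intro self_le_power) auto
    then have "t * r x \<le> t * r x ^ CARD('n)" using t by simp
    with 1 have "t * r x \<le> b" by linarith
    then have "r x \<le> b / t" using t by (simp add: field_simps)
    then show ?thesis by simp
  qed simp
  have cover: "K \<subseteq> (\<Union>x\<in>K. ball x (r x))" using r(1) by (auto intro!: bexI)
  obtain C where C: "countable C" "C \<subseteq> K"
     "pairwise (\<lambda>i j. disjnt (ball i (r i)) (ball j (r j))) C"
     "K \<subseteq> (\<Union>i\<in>C. ball i (5 * r i))"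
    by (rule Vitali_covering_lemma_balls[OF cover, of "max 1 (b / t)"]) (use r(1) rB in auto)
  have "emeasure lebesgue K \<le> emeasure lebesgue (\<Union>i\<in>C. ball i (5 * r i))"
    using C by (intro emeasure_mono sets.countable_UN') auto
  also have "\<dots> \<le> (\<integral>\<^sup>+i. emeasure lebesgue (ball i (5 * r i)) \<partial>count_space C)"
    using C by (intro emeasure_UN_count_space_le) auto
  finally have "ennreal t * emeasure lebesgue K \<le> ennreal t * (\<integral>\<^sup>+i. emeasure lebesgue (ball i (5 * r i)) \<partial>count_space C)"
    by (rule mult_left_mono) simp
  also have "\<dots> = (\<integral>\<^sup>+i. ennreal t * emeasure lebesgue (ball i (5 * r i)) \<partial>count_space C)"
    by (intro nn_integral_cmult[symmetric]) auto
  also have "\<dots> \<le> (\<integral>\<^sup>+i. ennreal c * (\<integral>\<^sup>+y\<in>ball i (r i). g y \<partial>lebesgue) \<partial>count_space C)"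
  proof (rule nn_integral_mono)
    fix i assume "i \<in> space (count_space C)"
    then have i: "i \<in> K" using C by auto
    have "ennreal t * emeasure lebesgue (ball i (5 * r i)) = ennreal (c * (t * r i ^ CARD('n)))"
      using r(1)[OF i] t by (subst emeasure_lebesgue_ball) (auto simp: c_def power_mult_distrib ennreal_mult'[symmetric] mult_ac)
    also have "\<dots> = ennreal c * ennreal (t * r i ^ CARD('n))"
      using c by (simp add: ennreal_mult')
    also have "\<dots> \<le> ennreal c * (\<integral>\<^sup>+y\<in>ball i (r i). g y \<partial>lebesgue)"
      using r(2)[OF i] by (intro mult_left_mono) auto
    finally show "ennreal t * emeasure lebesgue (ball i (5 * r i)) \<le> ennreal c * (\<integral>\<^sup>+y\<in>ball i (r i). g y \<partial>lebesgue)" .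
  qed
  also have "\<dots> = ennreal c * (\<integral>\<^sup>+i. (\<integral>\<^sup>+y\<in>ball i (r i). g y \<partial>lebesgue) \<partial>count_space C)"
    by (intro nn_integral_cmult) auto
  also have "\<dots> = ennreal c * (\<integral>\<^sup>+y\<in>(\<Union>i\<in>C. ball i (r i)). g y \<partial>lebesgue)"
    using C g by (subst nn_integral_UN_countable) (auto simp: disjoint_family_on_def pairwise_def disjnt_def)
  also have "\<dots> \<le> ennreal c * (\<integral>\<^sup>+x. g x \<partial>lebesgue)"
    by (intro mult_left_mono nn_integral_mono) (auto simp: indicator_def)
  finally show ?thesis by (simp add: K_def c_def)
qed

text \<open>A geometric series of ratio \<open>2 powr (- \<delta>)\<close> over dyadic shells. The
  factor \<open>2 ^ CARD('n)\<close> compares the inner radius of a shell, which bounds the kernel,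
  with the outer one, which bounds the mass.\<close>

definition tail_const :: "'n itself \<Rightarrow> real \<Rightarrow> real" where
  "tail_const _ \<delta> = 2 ^ CARD('n) / (1 - 2 powr (- \<delta>))"

lemma tail_const_pos: "0 < \<delta> \<Longrightarrow> 0 < tail_const TYPE('n::finite) \<delta>"
  by (simp add: tail_const_def powr_less_one)

text \<open>A radial kernel with integrable tail is dominated by the maximal averages at its centre.
  The quantitative uses of the smoothness of \<open>K\<close> all end in this estimate.\<close>

lemma tail_integral:
  fixes g :: "real^'n \<Rightarrow> ennreal" and r t \<delta> :: real
  assumes [measurable]: "g \<in> borel_measurable lebesgue" and x: "x \<notin> maximal_level g t"
    and t: "0 \<le> t" and r: "0 < r" and \<delta>: "0 < \<delta>"
  shows "(\<integral>\<^sup>+y\<in>{y. r \<le> norm (x - y)}. ennreal (r powr \<delta> / norm (x - y) powr (CARD('n) + \<delta>)) * g y \<partial>lebesgue)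
    \<le> ennreal (tail_const TYPE('n) \<delta> * t)"
proof -
  define q where "q = 2 powr (- \<delta>)"
  have q: "0 < q" "q < 1" using \<delta> by (auto simp: q_def powr_less_one)
  \<comment> \<open>\<open>c j\<close> is \<open>q ^ j / (2 ^ j * r) ^ CARD('n)\<close>, written
    with the outer radius of the shell so that it cancels against the maximal bound for the ball of
    that radius.\<close>
  define c where "c j = q ^ j * 2 ^ CARD('n) / (2 ^ (j + 1) * r) ^ CARD('n)" for j
  have c: "0 \<le> c j" for j using q r by (simp add: c_def)
  have "(\<integral>\<^sup>+y\<in>{y. r \<le> norm (x - y)}. ennreal (r powr \<delta> / norm (x - y) powr (CARD('n) + \<delta>)) * g y \<partial>lebesgue)
    \<le> (\<integral>\<^sup>+y. (\<Sum>j. ennreal (c j) * (g y * indicator (ball x (2 ^ (j + 1) * r)) y)) \<partial>lebesgue)"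
  proof (rule nn_integral_mono)
    fix y
    show "ennreal (r powr \<delta> / norm (x - y) powr (CARD('n) + \<delta>)) * g y * indicator {y. r \<le> norm (x - y)} y
      \<le> (\<Sum>j. ennreal (c j) * (g y * indicator (ball x (2 ^ (j + 1) * r)) y))"
    proof (cases "r \<le> norm (x - y)")
      case True
      define \<rho> where "\<rho> = norm (x - y)"
      have \<rho>: "r \<le> \<rho>" "0 < \<rho>" using True r by (auto simp: \<rho>_def)
      define j where "j = nat \<lfloor>log 2 (\<rho> / r)\<rfloor>"
      have "0 \<le> log 2 (\<rho> / r)" using \<rho> r by simp
      then have "real j \<le> log 2 (\<rho> / r)" "log 2 (\<rho> / r) < real j + 1" by (auto simp: j_def)
      then have "2 powr j \<le> \<rho> / r" "\<rho> / r < 2 powr (real j + 1)"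
        using \<rho> r by (auto simp: le_log_iff log_less_iff)
      then have j: "2 ^ j * r \<le> \<rho>" "\<rho> < 2 ^ (j + 1) * r"
        using r by (simp_all add: powr_realpow powr_add field_simps)
      have "r powr \<delta> / \<rho> powr (CARD('n) + \<delta>) \<le> r powr \<delta> / (2 ^ j * r) powr (CARD('n) + \<delta>)"
        using j r \<delta> \<rho> by (intro divide_left_mono powr_mono2 mult_pos_pos) auto
      also have "\<dots> = r powr \<delta> / ((2 ^ j * r) ^ CARD('n) * ((2 ^ j) powr \<delta> * r powr \<delta>))"
        using r by (simp add: powr_add powr_realpow powr_mult power_mult_distrib)
      also have "\<dots> = 1 / ((2 ^ j * r) ^ CARD('n) * (2 ^ j) powr \<delta>)"
        using r by simp
      also have "\<dots> = q ^ j / (2 ^ j * r) ^ CARD('n)"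
        by (simp add: q_def powr_minus power_inverse powr_realpow[symmetric] powr_powr mult.commute divide_simps)
      also have "\<dots> = c j" using r by (simp add: c_def power_mult_distrib)
      finally have "r powr \<delta> / \<rho> powr (CARD('n) + \<delta>) \<le> c j" .
      then have "ennreal (r powr \<delta> / norm (x - y) powr (CARD('n) + \<delta>)) * g y * indicator {y. r \<le> norm (x - y)} y
        \<le> ennreal (c j) * (g y * indicator (ball x (2 ^ (j + 1) * r)) y)"
        using True j(2) unfolding \<rho>_def
        by (auto simp: dist_norm intro!: mult_right_mono ennreal_leI)
      \<comment> \<open>The sum runs over whole balls instead of shells; for a given
        \<open>y\<close> the term of its own shell is already large enough.\<close>
      also have "\<dots> \<le> (\<Sum>j. ennreal (c j) * (g y * indicator (ball x (2 ^ (j + 1) * r)) y))"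
        using sum_le_suminf[of "\<lambda>j. ennreal (c j) * (g y * indicator (ball x (2 ^ (j + 1) * r)) y)" "{j}"]
        by simp
      finally show ?thesis .
    qed simp
  qed
  also have "\<dots> = (\<Sum>j. \<integral>\<^sup>+y. ennreal (c j) * (g y * indicator (ball x (2 ^ (j + 1) * r)) y) \<partial>lebesgue)"
    by (intro nn_integral_suminf) measurable
  also have "\<dots> = (\<Sum>j. ennreal (c j) * (\<integral>\<^sup>+y\<in>ball x (2 ^ (j + 1) * r). g y \<partial>lebesgue))"
    by (intro suminf_cong nn_integral_cmult) measurable
  also have "\<dots> \<le> (\<Sum>j. ennreal (q ^ j * (2 ^ CARD('n) * t)))"
  proof (rule suminf_le)
    fix j
    have "ennreal (c j) * (\<integral>\<^sup>+y\<in>ball x (2 ^ (j + 1) * r). g y \<partial>lebesgue)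
      \<le> ennreal (c j) * ennreal (t * (2 ^ (j + 1) * r) ^ CARD('n))"
      using r by (intro mult_left_mono not_maximal_levelD x) auto
    also have "\<dots> = ennreal (q ^ j * (2 ^ CARD('n) * t))"
      using r c t by (subst ennreal_mult'[symmetric]) (auto simp: c_def field_simps)
    finally show "ennreal (c j) * (\<integral>\<^sup>+y\<in>ball x (2 ^ (j + 1) * r). g y \<partial>lebesgue) \<le> ennreal (q ^ j * (2 ^ CARD('n) * t))" .
  qed auto
  also have "\<dots> = ennreal (\<Sum>j. q ^ j * (2 ^ CARD('n) * t))"
    using q t by (intro suminf_ennreal2 summable_mult2 summable_geometric) auto
  also have "(\<Sum>j. q ^ j * (2 ^ CARD('n) * t)) = tail_const TYPE('n) \<delta> * t"
    using q by (subst suminf_mult2[symmetric]) (auto simp: suminf_geometric tail_const_def q_def intro: summable_geometric)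
  finally show ?thesis .
qed

text \<open>In the normalisation by \<open>r ^ CARD('n)\<close> all averages of the constant 1 equal
  the volume of the unit ball, and level sets are defined by a strict inequality. With this weight
  \<open>tail_integral\<close> becomes a plain tail estimate.\<close>

lemma maximal_level_const: "x \<notin> maximal_level (\<lambda>_. 1) (unit_ball_vol CARD('n))" for x :: "real^'n"
  by (auto simp: maximal_level_def emeasure_lebesgue_ball)

lemma tail_integral_const:
  fixes x :: "real^'n" and r \<delta> :: real
  assumes "0 < r" "0 < \<delta>"
  shows "(\<integral>\<^sup>+y\<in>{y. r \<le> norm (x - y)}. ennreal (r powr \<delta> / norm (x - y) powr (CARD('n) + \<delta>)) \<partial>lebesgue)
    \<le> ennreal (tail_const TYPE('n) \<delta> * unit_ball_vol CARD('n))"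
  using tail_integral[OF _ maximal_level_const _ assms, of x] by simp

text \<open>A substitute for Lebesgue differentiation: outside the level set the averages over all cells are
  controlled, and the cells of an open set close to a given set nearly exhaust that set.\<close>

lemma AE_le_outside_maximal_level:
  fixes g :: "real^'n \<Rightarrow> ennreal" and t :: real
  assumes g[measurable]: "g \<in> borel_measurable lebesgue" and fin: "(\<integral>\<^sup>+x. g x \<partial>lebesgue) < \<infinity>"
    and t: "0 < t"
  shows "AE x in lebesgue. x \<notin> maximal_level g t \<longrightarrow> g x \<le> ennreal (2 * CARD('n) ^ CARD('n) * t)"
proof -
  define c where "c = CARD('n) ^ CARD('n) * t"
  have c: "0 < c" using t by (simp add: c_def)
  define B where "B = {x. x \<notin> maximal_level g t \<and> \<not> g x \<le> ennreal (2 * c)}"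
  have B[measurable]: "B \<in> sets lebesgue"
  proof -
    have "B = (UNIV - maximal_level g t) \<inter> {x\<in>space lebesgue. \<not> g x \<le> ennreal (2 * c)}" by (auto simp: B_def)
    also have "\<dots> \<in> sets lebesgue"
    proof (rule sets.Int)
      show "UNIV - maximal_level g t \<in> sets lebesgue"
        using sets.compl_sets[OF open_sets_lebesgue[OF open_maximal_level[of g t]]] by simp
    qed measurable
    finally show ?thesis .
  qed
  have low: "ennreal (2 * c) * emeasure lebesgue B \<le> (\<integral>\<^sup>+x\<in>B. g x \<partial>lebesgue)"
  proof -
    have "ennreal (2 * c) * emeasure lebesgue B = (\<integral>\<^sup>+x. ennreal (2 * c) * indicator B x \<partial>lebesgue)"
      by (simp add: nn_integral_cmult_indicator)
    also have "\<dots> \<le> (\<integral>\<^sup>+x\<in>B. g x \<partial>lebesgue)"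
      by (intro nn_integral_mono) (auto simp: B_def indicator_def)
    finally show ?thesis .
  qed
  also have "\<dots> \<le> (\<integral>\<^sup>+x. g x \<partial>lebesgue)"
    by (intro nn_integral_mono) (auto simp: indicator_def)
  finally have "ennreal (2 * c) * emeasure lebesgue B < \<infinity>" using fin by simp
  then have finB: "emeasure lebesgue B < \<infinity>" using c by (auto simp: ennreal_mult_less_top)
  then obtain b where b: "emeasure lebesgue B = ennreal b" "0 \<le> b" by (cases "emeasure lebesgue B") auto
  \<comment> \<open>On \<open>B\<close> the function exceeds \<open>2 * c\<close>, whereas each cell
    of \<open>U\<close> meeting \<open>B\<close> contains a point outside the level set and so has
    average at most \<open>c\<close>. Together this gives
    \<open>2 * c * b \<le> c * (b + e)\<close>; the factor 2 in the claim is the slack that forces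
    \<open>b \<le> e\<close>.\<close>
  have "b \<le> e" if e: "0 < e" for e :: real
  proof -
    obtain U where U: "open U" "B \<subseteq> U" "U - B \<in> lmeasurable" "emeasure lebesgue (U - B) < ennreal e"
      using sets_lebesgue_outer_open[OF B e] by metis
    have "emeasure lebesgue U = emeasure lebesgue B + emeasure lebesgue (U - B)"
      using U B by (subst plus_emeasure) (auto simp: Un_absorb1)
    also have "\<dots> \<le> ennreal b + ennreal e" using U b by (intro add_mono) auto
    finally have mU: "emeasure lebesgue U \<le> ennreal (b + e)" using b that by simp
    define W where "W = {Q \<in> maximal_cells {} U. Q \<inter> B \<noteq> {}}"
    have cW: "countable W" unfolding W_def by (rule countable_subset[OF _ countable_maximal_cells]) auto
    have sW: "Q \<in> sets lebesgue" if "Q \<in> W" for Q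
      using that maximal_cells_grid cube_grid unfolding W_def by (blast intro: cube_lebesgue)
    have dW: "disjoint_family_on (\<lambda>Q. Q) W"
      using disjoint_maximal_cells[of "{}" U] unfolding W_def by (auto simp: disjoint_family_on_def disjoint_def)
    have "\<Union> (maximal_cells {} U) = U"
    proof (rule Union_maximal_cells)
      show "\<exists>k. cell {} k x \<subseteq> U" if "x \<in> U" for x using small_cell[OF U(1) that] by blast
      show "emeasure lebesgue U < \<infinity>" using mU by (simp add: order_le_less_trans)
      show "U \<in> sets lebesgue" using U by (intro open_sets_lebesgue)
    qed
    then have "B \<subseteq> \<Union> W" using U(2) unfolding W_def by blast
    then have "(\<integral>\<^sup>+x\<in>B. g x \<partial>lebesgue) \<le> (\<integral>\<^sup>+x\<in>\<Union>((\<lambda>Q. Q) ` W). g x \<partial>lebesgue)"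
      by (intro nn_integral_set_mono) auto
    also have "\<dots> = (\<integral>\<^sup>+Q. (\<integral>\<^sup>+x\<in>Q. g x \<partial>lebesgue) \<partial>count_space W)"
      using cW sW dW g by (intro nn_integral_UN_countable)
    also have "\<dots> \<le> (\<integral>\<^sup>+Q. ennreal c * emeasure lebesgue Q \<partial>count_space W)"
    proof (rule nn_integral_mono)
      fix Q assume "Q \<in> space (count_space W)"
      then have Q: "Q \<in> maximal_cells {} U" "Q \<inter> B \<noteq> {}" by (auto simp: W_def)
      then have cQ: "cube Q" using maximal_cells_grid cube_grid by blast
      obtain x where x: "x \<in> Q" "x \<notin> maximal_level g t" using Q by (auto simp: B_def)
      have "Q \<subseteq> ball x (CARD('n) * side Q)"
        using cube_dist_less[OF cQ x(1)] by (auto simp: dist_norm)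
      then have "(\<integral>\<^sup>+x\<in>Q. g x \<partial>lebesgue) \<le> ennreal (t * (CARD('n) * side Q) ^ CARD('n))"
        using x cube_side_pos[OF cQ] by (intro not_maximal_level_subset) auto
      also have "\<dots> = ennreal c * emeasure lebesgue Q"
        using c cube_side_pos[OF cQ]
        by (simp add: emeasure_cube[OF cQ] ennreal_mult'[symmetric] c_def power_mult_distrib mult_ac)
      finally show "(\<integral>\<^sup>+x\<in>Q. g x \<partial>lebesgue) \<le> ennreal c * emeasure lebesgue Q" .
    qed
    also have "\<dots> = ennreal c * (\<integral>\<^sup>+Q. emeasure lebesgue Q \<partial>count_space W)"
      by (intro nn_integral_cmult) auto
    also have "(\<integral>\<^sup>+Q. emeasure lebesgue Q \<partial>count_space W) = emeasure lebesgue (\<Union>((\<lambda>Q. Q) ` W))"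
      using cW sW dW by (intro emeasure_UN_countable[symmetric])
    also have "\<dots> \<le> emeasure lebesgue U"
      using U(1) by (intro emeasure_mono open_sets_lebesgue) (auto simp: W_def maximal_cells_def)
    also note mU
    finally have "ennreal (2 * c) * emeasure lebesgue B \<le> ennreal c * ennreal (b + e)"
      using low by (meson mult_left_mono order_trans zero_le)
    moreover have "ennreal (2 * c) * emeasure lebesgue B = ennreal (2 * c * b)"
      using c b by (simp add: ennreal_mult'[symmetric])
    moreover have "ennreal c * ennreal (b + e) = ennreal (c * (b + e))"
      using c by (simp add: ennreal_mult' del: ennreal_plus)
    ultimately have "ennreal (2 * c * b) \<le> ennreal (c * (b + e))" by simp
    then have "2 * c * b \<le> c * (b + e)" using c b that by (subst (asm) ennreal_le_iff) auto
    then have "c * b \<le> c * e" by (simp add: algebra_simps)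
    then show "b \<le> e" using c by simp
  qed
  then have "b \<le> 0" by (rule field_le_epsilon[of b 0, simplified])
  then have "emeasure lebesgue B = 0" using b by simp
  then have "B \<in> null_sets lebesgue" using B by auto
  then show ?thesis
    by (rule AE_I') (auto simp: B_def c_def mult.assoc)
qed

section \<open>Truncated integrals\<close>

lemma norm_set_integral_le:
  fixes F :: "'a \<Rightarrow> complex"
  assumes "(\<integral>\<^sup>+y\<in>A. ennreal (cmod (F y)) \<partial>M) \<le> ennreal B" "0 \<le> B"
  shows "cmod (LINT y:A|M. F y) \<le> B"
proof (cases "set_integrable M A F")
  case True
  then have "ennreal (cmod (LINT y:A|M. F y)) \<le> (\<integral>\<^sup>+y. ennreal (cmod (indicator A y *\<^sub>R F y)) \<partial>M)"
    unfolding set_lebesgue_integral_def set_integrable_def by (rule integral_norm_bound_ennreal)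
  also have "\<dots> = (\<integral>\<^sup>+y\<in>A. ennreal (cmod (F y)) \<partial>M)"
    by (intro nn_integral_cong) (auto simp: indicator_def)
  also note assms(1)
  finally show ?thesis using assms(2) by simp
next
  \<comment> \<open>A function that is not integrable has Bochner integral 0, so the bound holds
    trivially.\<close>
  case False
  then show ?thesis using assms(2)
    unfolding set_lebesgue_integral_def set_integrable_def by (simp add: not_integrable_integral_eq)
qed

lemma AE_norm_diff_neq: "AE y in lebesgue. norm (x - y) \<noteq> r" for x :: "real^'n"
proof (rule AE_I')
  show "sphere x r \<in> null_sets lebesgue" using negligible_sphere[of x r] by (simp add: negligible_iff_null_sets)
qed (auto simp: dist_norm)

definition annulus :: "real \<Rightarrow> real \<Rightarrow> real^'n \<Rightarrow> (real^'n) set" where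
  "annulus \<epsilon> \<nu> x = {y. \<epsilon> < norm (x - y) \<and> norm (x - y) < \<nu>}"

lemma open_far: "open {y :: real^'n. s < norm (x - y)}"
  by (intro open_Collect_less continuous_intros)

lemma open_annulus: "open (annulus \<epsilon> \<nu> x)"
  unfolding annulus_def by (intro open_Collect_conj open_Collect_less continuous_intros)

lemma closed_far: "closed {y :: real^'n. s \<le> norm (x - y)}"
  by (intro closed_Collect_le continuous_intros)

lemma far_sets [measurable]: "{y :: real^'n. s < norm (x - y)} \<in> sets lebesgue" "{y :: real^'n. s \<le> norm (x - y)} \<in> sets lebesgue"
  "annulus s r x \<in> sets lebesgue"
  by (rule borel_sets_lebesgue, (rule borel_open[OF open_far] borel_closed[OF closed_far] borel_open[OF open_annulus]))+

lemma set_integral_split: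
  fixes F :: "real^'n \<Rightarrow> complex"
  assumes "set_integrable lebesgue A F" "B \<subseteq> A" "A \<in> sets lebesgue" "B \<in> sets lebesgue"
  shows "(LINT y:A|lebesgue. F y) = (LINT y:B|lebesgue. F y) + (LINT y:A - B|lebesgue. F y)"
proof -
  have "(LINT y:B \<union> (A - B)|lebesgue. F y) = (LINT y:B|lebesgue. F y) + (LINT y:A - B|lebesgue. F y)"
    using assms by (intro set_integral_Un) (auto intro: set_integrable_subset)
  then show ?thesis using assms(2) by (simp add: Un_absorb1)
qed

text \<open>Fixed constants replace the existential ones of \<open>calderon_zygmund_kernel\<close>.
  Passing to \<open>max c 1\<close> makes \<open>c\<close> positive, and the sum of the two
  differences is split into separate bounds for the two variables.\<close>

locale cz_kernel =
  fixes K :: "real^'n \<Rightarrow> real^'n \<Rightarrow> complex" and c \<delta> :: real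
  assumes c: "0 < c" and \<delta>: "0 < \<delta>"
    and size: "x \<noteq> y \<Longrightarrow> cmod (K x y) \<le> c / norm (x - y) ^ CARD('n)"
    and smooth1: "norm (x - x') < norm (x - y) / 2 \<Longrightarrow>
      cmod (K x y - K x' y) \<le> c * (norm (x - x') powr \<delta> / norm (x - y) powr (CARD('n) + \<delta>))"
    and smooth2: "norm (x - x') < norm (x - y) / 2 \<Longrightarrow>
      cmod (K y x - K y x') \<le> c * (norm (x - x') powr \<delta> / norm (x - y) powr (CARD('n) + \<delta>))"

lemma calderon_zygmund_kernelE:
  assumes "calderon_zygmund_kernel K"
  obtains c \<delta> where "cz_kernel K c \<delta>"
proof -
  obtain c \<delta> where c: "\<And>x y. x \<noteq> y \<Longrightarrow> cmod (K x y) \<le> c / norm (x - y) ^ CARD('a)"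
    and \<delta>: "0 < \<delta>" "\<And>x x' y. norm (x - x') < norm (x - y) / 2 \<Longrightarrow>
          cmod (K x y - K x' y) + cmod (K y x - K y x')
            \<le> c * (norm (x - x') powr \<delta> / norm (x - y) powr (real CARD('a) + \<delta>))"
    using assms unfolding calderon_zygmund_kernel_def by metis
  have le: "c * u \<le> max c 1 * u" if "0 \<le> u" for u
    using that by (intro mult_right_mono) auto
  have "cz_kernel K (max c 1) \<delta>"
  proof
    show "cmod (K x y) \<le> max c 1 / norm (x - y) ^ CARD('a)" if "x \<noteq> y" for x y
      using c[OF that] le[of "1 / norm (x - y) ^ CARD('a)"] by simp
    show "cmod (K x y - K x' y) \<le> max c 1 * (norm (x - x') powr \<delta> / norm (x - y) powr (CARD('a) + \<delta>))"
      "cmod (K y x - K y x') \<le> max c 1 * (norm (x - x') powr \<delta> / norm (x - y) powr (CARD('a) + \<delta>))"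
      if "norm (x - x') < norm (x - y) / 2" for x x' y
      using \<delta>(2)[OF that] le[of "norm (x - x') powr \<delta> / norm (x - y) powr (CARD('a) + \<delta>)"]
        norm_ge_zero[of "K x y - K x' y"] norm_ge_zero[of "K y x - K y x'"]
      by (simp_all del: norm_ge_zero)
  qed (use \<delta> in auto)
  then show ?thesis by (rule that)
qed

section \<open>Size and smoothness estimates for truncated integrals\<close>

context cz_kernel
begin

text \<open>Only the inner radius is cut off, so that two points can be compared with a single edge
  to take care of. For integrable \<open>h\<close> an annulus is a difference of two such
  truncations.\<close>

definition trunc :: "real \<Rightarrow> (real^'n \<Rightarrow> complex) \<Rightarrow> real^'n \<Rightarrow> complex" where
  "trunc s h x = (LINT y:{y. s < norm (x - y)}|lebesgue. K x y * h y)"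

lemma modulus_tendsto_0: "((\<lambda>z. c * (norm (w - z) powr \<delta> / M)) \<longlongrightarrow> 0) (at w)" for w :: "real^'n"
proof -
  have "((\<lambda>z. norm (w - z) powr \<delta>) \<longlongrightarrow> 0) (at w)"
    by (rule tendsto_zero_powrI[where b=\<delta>]) (use \<delta> in \<open>auto intro!: tendsto_eq_intros\<close>)
  then have "((\<lambda>z. c * (norm (w - z) powr \<delta> / M)) \<longlongrightarrow> c * (0 / M)) (at w)"
    unfolding divide_inverse by (intro tendsto_intros)
  then show ?thesis by simp
qed

lemma eventually_near: "w \<noteq> v \<Longrightarrow> \<forall>\<^sub>F z in at w. norm (w - z) < norm (w - v) / 2" for w :: "real^'n"
proof -
  assume "w \<noteq> v"
  have "((\<lambda>z. norm (w - z)) \<longlongrightarrow> norm (w - w)) (at w)" by (intro tendsto_intros)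
  then show ?thesis by (rule order_tendstoD) (use \<open>w \<noteq> v\<close> in simp)
qed

lemma isCont_K1: "x \<noteq> y \<Longrightarrow> isCont (\<lambda>x. K x y) x"
proof -
  assume "x \<noteq> y"
  have "((\<lambda>z. K z y - K x y) \<longlongrightarrow> 0) (at x)"
  proof (rule Lim_null_comparison[OF _ modulus_tendsto_0[of x "norm (x - y) powr (CARD('n) + \<delta>)"]])
    show "\<forall>\<^sub>F z in at x. cmod (K z y - K x y) \<le> c * (norm (x - z) powr \<delta> / norm (x - y) powr (CARD('n) + \<delta>))"
      using eventually_near[OF \<open>x \<noteq> y\<close>] by eventually_elim (metis smooth1 norm_minus_commute)
  qed
  then show ?thesis by (simp add: isCont_def LIM_zero_cancel)
qed

lemma isCont_K2: "x \<noteq> y \<Longrightarrow> isCont (K x) y"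
proof -
  assume "x \<noteq> y"
  have "((\<lambda>z. K x z - K x y) \<longlongrightarrow> 0) (at y)"
  proof (rule Lim_null_comparison[OF _ modulus_tendsto_0[of y "norm (y - x) powr (CARD('n) + \<delta>)"]])
    show "\<forall>\<^sub>F z in at y. cmod (K x z - K x y) \<le> c * (norm (y - z) powr \<delta> / norm (y - x) powr (CARD('n) + \<delta>))"
      using eventually_near[OF \<open>x \<noteq> y\<close>[symmetric]] by eventually_elim (metis smooth2 norm_minus_commute)
  qed
  then show ?thesis by (simp add: isCont_def LIM_zero_cancel)
qed

text \<open>\<open>K x\<close> is continuous off \<open>x\<close> by the smoothness estimate in the
  second variable; the arbitrary value at the single point \<open>x\<close> is added
  separately.\<close>

lemma K_measurable [measurable]: "K x \<in> borel_measurable lebesgue"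
proof -
  have "continuous_on (- {x}) (K x)"
    by (intro continuous_at_imp_continuous_on ballI isCont_K2) auto
  then have "(\<lambda>y. indicator (- {x}) y *\<^sub>R K x y) \<in> borel_measurable borel"
    by (intro borel_measurable_continuous_on_indicator) auto
  then have "(\<lambda>y. indicator (- {x}) y *\<^sub>R K x y + indicator {x} y *\<^sub>R K x x) \<in> borel_measurable borel"
    by measurable
  also have "(\<lambda>y. indicator (- {x}) y *\<^sub>R K x y + indicator {x} y *\<^sub>R K x x) = K x"
    by (auto simp: indicator_def)
  finally have "K x \<in> borel_measurable lborel" by simp
  then show ?thesis by (rule measurable_completion)
qed

lemma size_far: "0 < r \<Longrightarrow> r \<le> norm (x - y) \<Longrightarrow> cmod (K x y) \<le> c / r ^ CARD('n)"
proof -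
  assume r: "0 < r" "r \<le> norm (x - y)"
  then have "cmod (K x y) \<le> c / norm (x - y) ^ CARD('n)" by (intro size) auto
  also have "\<dots> \<le> c / r ^ CARD('n)" using r c
    by (intro divide_left_mono power_mono mult_pos_pos zero_less_power) linarith+
  finally show ?thesis .
qed

lemma kernel_set_integrable:
  assumes h: "set_integrable lebesgue B h" and A: "A \<in> sets lebesgue" "A \<subseteq> B" "A \<subseteq> {y. r \<le> norm (x - y)}" "0 < r"
  shows "set_integrable lebesgue A (\<lambda>y. K x y * h y)"
proof -
  have hA: "set_integrable lebesgue A h" using h A by (meson set_integrable_subset)
  have "set_integrable lebesgue A (\<lambda>y. (c / r ^ CARD('n)) *\<^sub>R h y)"
    using hA by (rule set_integrable_scaleR_right)
  then show ?thesis
  proof (rule set_integrable_bound)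
    show "set_borel_measurable lebesgue A (\<lambda>y. K x y * h y)"
    proof -
      have "(\<lambda>y. K x y * (indicator A y *\<^sub>R h y)) \<in> borel_measurable lebesgue"
        using hA by (intro borel_measurable_times K_measurable) (auto simp: set_integrable_def)
      then show ?thesis by (simp add: set_borel_measurable_def scaleR_conv_of_real mult_ac)
    qed
    show "AE y in lebesgue. y \<in> A \<longrightarrow> cmod (K x y * h y) \<le> cmod ((c / r ^ CARD('n)) *\<^sub>R h y)"
    proof (intro AE_I2 impI)
      fix y assume "y \<in> A"
      then have "cmod (K x y) \<le> c / r ^ CARD('n)" using A by (intro size_far) auto
      from mult_right_mono[OF this, of "cmod (h y)"]
      show "cmod (K x y * h y) \<le> cmod ((c / r ^ CARD('n)) *\<^sub>R h y)"
        using c A(4) by (simp add: norm_mult)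
    qed
  qed
qed

lemma kernel_integrable:
  assumes "integrable lebesgue h" "A \<in> sets lebesgue" "A \<subseteq> {y. r \<le> norm (x - y)}" "0 < r"
  shows "set_integrable lebesgue A (\<lambda>y. K x y * h y)"
  using assms by (intro kernel_set_integrable[of UNIV h A r x]) (auto simp: set_integrable_def)

lemma kernel_integral_bound:
  assumes h: "(\<integral>\<^sup>+y\<in>A. ennreal (cmod (h y)) \<partial>lebesgue) \<le> ennreal B" "0 \<le> B"
    and A: "A \<subseteq> {y. r \<le> norm (x - y)}" "0 < r"
    and [measurable]: "h \<in> borel_measurable lebesgue" "A \<in> sets lebesgue"
  shows "cmod (LINT y:A|lebesgue. K x y * h y) \<le> c / r ^ CARD('n) * B"
proof (rule norm_set_integral_le)
  have "(\<integral>\<^sup>+y\<in>A. ennreal (cmod (K x y * h y)) \<partial>lebesgue)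
      \<le> (\<integral>\<^sup>+y. ennreal (c / r ^ CARD('n)) * (ennreal (cmod (h y)) * indicator A y) \<partial>lebesgue)"
  proof (rule nn_integral_mono)
    fix y
    show "ennreal (cmod (K x y * h y)) * indicator A y \<le> ennreal (c / r ^ CARD('n)) * (ennreal (cmod (h y)) * indicator A y)"
    proof (cases "y \<in> A")
      case True
      then have "cmod (K x y) \<le> c / r ^ CARD('n)" using A by (intro size_far) auto
      from ennreal_leI[OF mult_right_mono[OF this, of "cmod (h y)"]]
      show ?thesis using True c A(2) by (simp add: norm_mult ennreal_mult'[symmetric])
    qed simp
  qed
  also have "\<dots> = ennreal (c / r ^ CARD('n)) * (\<integral>\<^sup>+y\<in>A. ennreal (cmod (h y)) \<partial>lebesgue)"
    by (intro nn_integral_cmult) measurable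
  also have "\<dots> \<le> ennreal (c / r ^ CARD('n)) * ennreal B" using h by (intro mult_left_mono) auto
  also have "\<dots> = ennreal (c / r ^ CARD('n) * B)" using c A by (subst ennreal_mult'[symmetric]) auto
  finally show "(\<integral>\<^sup>+y\<in>A. ennreal (cmod (K x y * h y)) \<partial>lebesgue) \<le> ennreal (c / r ^ CARD('n) * B)" .
qed (use c A h in auto)

lemma kernel_integral_ball_bound:
  assumes x': "x' \<notin> maximal_level (\<lambda>y. ennreal (cmod (h y))) t" "0 \<le> t"
    and A: "A \<subseteq> {y. r \<le> norm (x - y)}" "A \<subseteq> ball x' \<rho>" "0 < r" "0 < \<rho>"
    and m: "h \<in> borel_measurable lebesgue" "A \<in> sets lebesgue"
  shows "cmod (LINT y:A|lebesgue. K x y * h y) \<le> c * (\<rho> / r) ^ CARD('n) * t"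
proof -
  have "cmod (LINT y:A|lebesgue. K x y * h y) \<le> c / r ^ CARD('n) * (t * \<rho> ^ CARD('n))"
    using A x' m by (intro kernel_integral_bound not_maximal_level_subset) auto
  then show ?thesis using A by (simp add: power_divide field_simps)
qed

text \<open>Smoothness in the first variable replaces the difference of the kernels by the radial
  kernel of \<open>tail_integral\<close>, centred at \<open>x\<close>; the displacement in its
  numerator is enlarged to \<open>r\<close>.\<close>

lemma kernel_smooth_bound:
  assumes x: "x \<notin> maximal_level (\<lambda>y. ennreal (cmod (h y))) t" "0 \<le> t"
    and h: "integrable lebesgue h"
    and A: "A \<in> sets lebesgue" "A \<subseteq> {y. r \<le> norm (x - y)}" "0 < r" and xx': "norm (x - x') < r / 2"
  shows "cmod ((LINT y:A|lebesgue. K x y * h y) - (LINT y:A|lebesgue. K x' y * h y))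
    \<le> c * tail_const TYPE('n) \<delta> * t"
proof -
  have [measurable]: "h \<in> borel_measurable lebesgue" using h by auto
  have "A \<subseteq> {y. r / 2 \<le> norm (x' - y)}"
  proof
    fix y assume "y \<in> A"
    then have "r \<le> norm (x - y)" using A by auto
    also have "\<dots> \<le> norm (x - x') + norm (x' - y)" using norm_triangle_ineq[of "x - x'" "x' - y"] by simp
    finally show "y \<in> {y. r / 2 \<le> norm (x' - y)}" using xx' by simp
  qed
  then have "(LINT y:A|lebesgue. K x y * h y) - (LINT y:A|lebesgue. K x' y * h y)
      = (LINT y:A|lebesgue. K x y * h y - K x' y * h y)"
    using h A kernel_integrable[of h A "r / 2" x'] kernel_integrable[of h A r x]
    by (intro set_integral_diff(2)[symmetric]) auto
  also have "cmod \<dots> \<le> c * tail_const TYPE('n) \<delta> * t"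
  proof (rule norm_set_integral_le)
    have "(\<integral>\<^sup>+y\<in>A. ennreal (cmod (K x y * h y - K x' y * h y)) \<partial>lebesgue)
      \<le> (\<integral>\<^sup>+y. ennreal c * (ennreal (r powr \<delta> / norm (x - y) powr (CARD('n) + \<delta>)) * ennreal (cmod (h y)) * indicator {y. r \<le> norm (x - y)} y) \<partial>lebesgue)"
    proof (rule nn_integral_mono)
      fix y
      show "ennreal (cmod (K x y * h y - K x' y * h y)) * indicator A y
        \<le> ennreal c * (ennreal (r powr \<delta> / norm (x - y) powr (CARD('n) + \<delta>)) * ennreal (cmod (h y)) * indicator {y. r \<le> norm (x - y)} y)"
      proof (cases "y \<in> A")
        case True
        then have y: "r \<le> norm (x - y)" using A by auto
        then have "cmod (K x y - K x' y) \<le> c * (norm (x - x') powr \<delta> / norm (x - y) powr (CARD('n) + \<delta>))"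
          using xx' by (intro smooth1) auto
        also have "\<dots> \<le> c * (r powr \<delta> / norm (x - y) powr (CARD('n) + \<delta>))"
          using xx' A(3) c \<delta> by (intro mult_left_mono divide_right_mono powr_mono2) (auto simp del: less_divide_eq_numeral1)
        finally have "cmod (K x y - K x' y) \<le> c * (r powr \<delta> / norm (x - y) powr (CARD('n) + \<delta>))" .
        from mult_right_mono[OF this, of "cmod (h y)"]
        have "cmod (K x y * h y - K x' y * h y) \<le> c * (r powr \<delta> / norm (x - y) powr (CARD('n) + \<delta>)) * cmod (h y)"
          by (simp add: left_diff_distrib[symmetric] norm_mult)
        then show ?thesis using True y c
          by (auto simp: ennreal_mult'[symmetric] mult.assoc intro!: ennreal_leI)
      qed simp
    qed
    also have "\<dots> = ennreal c * (\<integral>\<^sup>+y\<in>{y. r \<le> norm (x - y)}. ennreal (r powr \<delta> / norm (x - y) powr (CARD('n) + \<delta>)) * ennreal (cmod (h y)) \<partial>lebesgue)"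
    proof (rule nn_integral_cmult)
      have "(\<lambda>y. ennreal (r powr \<delta> / norm (x - y) powr (CARD('n) + \<delta>))) \<in> borel_measurable lborel"
        by measurable
      then have F: "(\<lambda>y. ennreal (r powr \<delta> / norm (x - y) powr (CARD('n) + \<delta>))) \<in> borel_measurable lebesgue"
        by (rule measurable_completion)
      show "(\<lambda>y. ennreal (r powr \<delta> / norm (x - y) powr (CARD('n) + \<delta>)) * ennreal (cmod (h y)) * indicator {y. r \<le> norm (x - y)} y)
          \<in> borel_measurable lebesgue"
        by (intro borel_measurable_times_ennreal borel_measurable_indicator far_sets F) measurable
    qed
    also have "\<dots> \<le> ennreal c * ennreal (tail_const TYPE('n) \<delta> * t)"
    proof (rule mult_left_mono)
      show "(\<integral>\<^sup>+y\<in>{y. r \<le> norm (x - y)}. ennreal (r powr \<delta> / norm (x - y) powr (CARD('n) + \<delta>)) * ennreal (cmod (h y)) \<partial>lebesgue)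
        \<le> ennreal (tail_const TYPE('n) \<delta> * t)"
        by (rule tail_integral[of "\<lambda>y. ennreal (cmod (h y))" x t r \<delta>]) (use x A \<delta> in auto)
    qed simp
    also have "\<dots> = ennreal (c * tail_const TYPE('n) \<delta> * t)"
      using c by (simp add: ennreal_mult' mult.assoc)
    finally show "(\<integral>\<^sup>+y\<in>A. ennreal (cmod (K x y * h y - K x' y * h y)) \<partial>lebesgue) \<le> ennreal (c * tail_const TYPE('n) \<delta> * t)" .
  qed (use c x tail_const_pos[OF \<delta>, where 'n='n] in auto)
  finally show ?thesis .
qed

text \<open>The first summand accounts for the near parts at the two points, each inside a ball of
  radius \<open>3 * s\<close> and at distance at least \<open>s\<close> from the pole; the second
  one for the common far part.\<close>

definition compare_const :: real where
  "compare_const = 2 * c * 3 ^ CARD('n) + c * tail_const TYPE('n) \<delta>"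

text \<open>Both domains of integration contain \<open>D\<close>, where smoothness applies with
  \<open>x'\<close> as centre. What is left of either domain lies within \<open>2 * s\<close> of
  \<open>x'\<close>, so the size of the kernel and the maximal average at \<open>x'\<close>
  suffice.\<close>

lemma trunc_compare:
  assumes x': "x' \<notin> maximal_level (\<lambda>y. ennreal (cmod (h y))) t" "0 \<le> t"
    and h: "integrable lebesgue h" and s: "norm (x - x') < s / 2"
  shows "cmod (trunc s h x - trunc s h x') \<le> compare_const * t"
proof -
  have s0: "0 < s" using s norm_ge_zero[of "x - x'"] by linarith
  define D where "D = {y. 2 * s < norm (x' - y)}"
  have tri: "norm (x - y) \<le> norm (x - x') + norm (x' - y)" "norm (x' - y) \<le> norm (x - x') + norm (x - y)" for y
    using norm_triangle_ineq[of "x - x'" "x' - y"] norm_triangle_ineq[of "x' - x" "x - y"]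
    by (simp_all add: norm_minus_commute)
  have D: "D \<in> sets lebesgue" unfolding D_def by (rule far_sets)
  have Dx: "D \<subseteq> {y. s < norm (x - y)}"
  proof
    fix y assume "y \<in> D"
    then show "y \<in> {y. s < norm (x - y)}" using tri(2)[of y] s s0 by (simp add: D_def)
  qed
  have Dx': "D \<subseteq> {y. s < norm (x' - y)}" using s0 by (auto simp: D_def)
  have split: "trunc s h z = (LINT y:D|lebesgue. K z y * h y) + (LINT y:{y. s < norm (z - y)} - D|lebesgue. K z y * h y)"
    if "D \<subseteq> {y. s < norm (z - y)}" for z
    unfolding trunc_def using that D h s0
    by (intro set_integral_split kernel_integrable[of h _ s]) auto
  have 1: "cmod ((LINT y:D|lebesgue. K x' y * h y) - (LINT y:D|lebesgue. K x y * h y)) \<le> c * tail_const TYPE('n) \<delta> * t"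
    using x' h D s s0 by (intro kernel_smooth_bound[where r="2 * s"]) (auto simp: D_def norm_minus_commute)
  have 2: "cmod (LINT y:{y. s < norm (z - y)} - D|lebesgue. K z y * h y) \<le> c * (3 * s / s) ^ CARD('n) * t" for z
    using x' h D s0 by (intro kernel_integral_ball_bound) (auto simp: D_def dist_norm)
  have "cmod (trunc s h x - trunc s h x')
    \<le> cmod ((LINT y:D|lebesgue. K x y * h y) - (LINT y:D|lebesgue. K x' y * h y))
      + cmod (LINT y:{y. s < norm (x - y)} - D|lebesgue. K x y * h y)
      + cmod (LINT y:{y. s < norm (x' - y)} - D|lebesgue. K x' y * h y)"
    unfolding split[OF Dx] split[OF Dx'] add_diff_add
    by (rule order_trans[OF norm_triangle_ineq]) (use norm_triangle_ineq4 in \<open>auto simp: add.assoc\<close>)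
  also have "\<dots> \<le> c * tail_const TYPE('n) \<delta> * t + c * 3 ^ CARD('n) * t + c * 3 ^ CARD('n) * t"
    using 1 2[of x] 2[of x'] s0 by (intro add_mono) (auto simp: norm_minus_commute)
  also have "\<dots> = compare_const * t" by (simp add: compare_const_def algebra_simps)
  finally show ?thesis .
qed

text \<open>The annulus and the outer truncation both omit the sphere of radius
  \<open>\<nu>\<close>, which is a null set.\<close>

lemma annulus_integral:
  assumes h: "integrable lebesgue h" and \<epsilon>: "0 < \<epsilon>" "\<epsilon> < \<nu>"
  shows "(LINT y:annulus \<epsilon> \<nu> x|lebesgue. K x y * h y) = trunc \<epsilon> h x - trunc \<nu> h x"
proof -
  have "trunc \<epsilon> h x = (LINT y:annulus \<epsilon> \<nu> x|lebesgue. K x y * h y) + (LINT y:{y. \<epsilon> < norm (x - y)} - annulus \<epsilon> \<nu> x|lebesgue. K x y * h y)"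
    unfolding trunc_def using h \<epsilon> by (intro set_integral_split kernel_integrable[of h _ \<epsilon>]) (auto simp: annulus_def)
  also have "(LINT y:{y. \<epsilon> < norm (x - y)} - annulus \<epsilon> \<nu> x|lebesgue. K x y * h y) = trunc \<nu> h x"
    unfolding trunc_def
  proof (rule set_integral_cong_set)
    show "set_borel_measurable lebesgue {y. \<nu> < norm (x - y)} (\<lambda>y. K x y * h y)"
      "set_borel_measurable lebesgue ({y. \<epsilon> < norm (x - y)} - annulus \<epsilon> \<nu> x) (\<lambda>y. K x y * h y)"
      using h unfolding set_borel_measurable_def by (auto intro!: borel_measurable_scaleR borel_measurable_indicator borel_measurable_times)
    show "AE y in lebesgue. (y \<in> {y. \<nu> < norm (x - y)}) = (y \<in> {y. \<epsilon> < norm (x - y)} - annulus \<epsilon> \<nu> x)"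
      using AE_norm_diff_neq[of x \<nu>] by eventually_elim (use \<epsilon> in \<open>auto simp: annulus_def\<close>)
  qed
  finally show ?thesis by simp
qed

end

section \<open>Maximal truncation: one-sided truncations, subadditivity and semicontinuity\<close>

context cz_kernel
begin

lemma maximal_truncation_annulus:
  "maximal_truncation K f x = (SUP (\<epsilon>, \<nu>) \<in> {(\<epsilon>, \<nu>). 0 < \<epsilon> \<and> \<epsilon> < \<nu>}.
     ennreal (cmod (LINT y:annulus \<epsilon> \<nu> x|lebesgue. K x y * f y)))"
  by (simp add: maximal_truncation_def annulus_def)

lemma annulus_le_maximal_truncation:
  "0 < \<epsilon> \<Longrightarrow> \<epsilon> < \<nu> \<Longrightarrow> ennreal (cmod (LINT y:annulus \<epsilon> \<nu> x|lebesgue. K x y * f y)) \<le> maximal_truncation K f x"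
  unfolding maximal_truncation_annulus by (rule SUP_upper2[of "(\<epsilon>, \<nu>)"]) auto

lemma maximal_truncation_leI:
  assumes "\<And>\<epsilon> \<nu>. 0 < \<epsilon> \<Longrightarrow> \<epsilon> < \<nu> \<Longrightarrow> ennreal (cmod (LINT y:annulus \<epsilon> \<nu> x|lebesgue. K x y * f y)) \<le> B"
  shows "maximal_truncation K f x \<le> B"
  unfolding maximal_truncation_annulus using assms by (intro SUP_least) auto

lemma trunc_tendsto_0:
  assumes h: "integrable lebesgue h" and s: "0 < s"
  shows "(\<lambda>j. trunc (s + real j) h x) \<longlonglongrightarrow> 0"
proof -
  have "(\<lambda>j. LINT y|lebesgue. indicator {y. s + real j < norm (x - y)} y *\<^sub>R (K x y * h y)) \<longlonglongrightarrow> (LINT y|lebesgue. (\<lambda>_ :: real^'n. 0 :: complex) y)"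
  proof (rule integral_dominated_convergence[where w = "\<lambda>y. cmod (indicator {y. s < norm (x - y)} y *\<^sub>R (K x y * h y))"])
    have i: "set_integrable lebesgue {y. s < norm (x - y)} (\<lambda>y. K x y * h y)"
      using h s by (intro kernel_integrable[of h _ s]) auto
    then show "integrable lebesgue (\<lambda>y. cmod (indicator {y. s < norm (x - y)} y *\<^sub>R (K x y * h y)))"
      unfolding set_integrable_def by (rule integrable_norm)
    show "(\<lambda>y. indicator {y. s + real j < norm (x - y)} y *\<^sub>R (K x y * h y)) \<in> borel_measurable lebesgue" for j
      using h by (intro borel_measurable_scaleR borel_measurable_indicator borel_measurable_times) auto
    show "AE y in lebesgue. (\<lambda>j. indicator {y. s + real j < norm (x - y)} y *\<^sub>R (K x y * h y)) \<longlonglongrightarrow> 0"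
    proof (rule AE_I2)
      fix y
      obtain N :: nat where N: "norm (x - y) \<le> real N" using real_arch_simple by blast
      have "\<forall>\<^sub>F j in sequentially. 0 = indicator {y. s + real j < norm (x - y)} y *\<^sub>R (K x y * h y)"
        using eventually_ge_at_top[of N] by eventually_elim (use N s in auto)
      then show "(\<lambda>j. indicator {y. s + real j < norm (x - y)} y *\<^sub>R (K x y * h y)) \<longlonglongrightarrow> 0"
        by (rule tendsto_cong[THEN iffD1, OF _ tendsto_const])
    qed
    show "AE y in lebesgue. cmod (indicator {y. s + real j < norm (x - y)} y *\<^sub>R (K x y * h y))
        \<le> cmod (indicator {y. s < norm (x - y)} y *\<^sub>R (K x y * h y))" for j
      by (rule AE_I2) (auto simp: indicator_def)
  qed auto
  then show ?thesis by (simp add: trunc_def set_lebesgue_integral_def)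
qed

text \<open>The supremum ranges over bounded annuli only; letting the outer radius tend to infinity
  recovers the one-sided truncation without losing a factor.\<close>

lemma trunc_le_maximal_truncation:
  assumes h: "integrable lebesgue h" and s: "0 < s"
  shows "ennreal (cmod (trunc s h x)) \<le> maximal_truncation K h x"
proof -
  have "(\<lambda>j. trunc (s + real (Suc j)) h x) \<longlonglongrightarrow> 0"
    using trunc_tendsto_0[OF h s] by (rule LIMSEQ_Suc)
  then have "(\<lambda>j. ennreal (cmod (trunc s h x - trunc (s + real (Suc j)) h x))) \<longlonglongrightarrow> ennreal (cmod (trunc s h x - 0))"
    by (intro tendsto_intros)
  moreover have "ennreal (cmod (trunc s h x - trunc (s + real (Suc j)) h x)) \<le> maximal_truncation K h x" for j
    using annulus_le_maximal_truncation[of s "s + real (Suc j)" x h] annulus_integral[OF h s, of "s + real (Suc j)" x] s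
    by simp
  ultimately show ?thesis by (metis (no_types, lifting) LIMSEQ_le_const2 diff_zero)
qed

text \<open>The converse direction costs a factor 2, one truncation for each radius of the
  annulus.\<close>

lemma maximal_truncation_le_trunc:
  assumes h: "integrable lebesgue h" and "\<And>s. 0 < s \<Longrightarrow> cmod (trunc s h x) \<le> B"
  shows "maximal_truncation K h x \<le> ennreal (2 * B)"
proof (rule maximal_truncation_leI)
  fix \<epsilon> \<nu> :: real assume \<epsilon>: "0 < \<epsilon>" "\<epsilon> < \<nu>"
  have "cmod (trunc \<epsilon> h x - trunc \<nu> h x) \<le> cmod (trunc \<epsilon> h x) + cmod (trunc \<nu> h x)" by (rule norm_triangle_ineq4)
  also have "\<dots> \<le> 2 * B" using assms(2)[of \<epsilon>] assms(2)[of \<nu>] \<epsilon> by simp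
  finally show "ennreal (cmod (LINT y:annulus \<epsilon> \<nu> x|lebesgue. K x y * h y)) \<le> ennreal (2 * B)"
    using \<epsilon> h by (simp add: annulus_integral ennreal_leI)
qed

lemma trunc_add:
  assumes "integrable lebesgue f" "integrable lebesgue g" "0 < s"
  shows "trunc s (\<lambda>y. f y + g y) x = trunc s f x + trunc s g x"
proof -
  have "set_integrable lebesgue {y. s < norm (x - y)} (\<lambda>y. K x y * f y)"
    "set_integrable lebesgue {y. s < norm (x - y)} (\<lambda>y. K x y * g y)"
    using assms by (auto intro!: kernel_integrable[of _ _ s])
  then show ?thesis unfolding trunc_def by (simp add: distrib_left)
qed

lemma maximal_truncation_add:
  assumes "integrable lebesgue f" "integrable lebesgue g"
  shows "maximal_truncation K (\<lambda>y. f y + g y) x \<le> maximal_truncation K f x + maximal_truncation K g x"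
proof (rule maximal_truncation_leI)
  fix \<epsilon> \<nu> :: real assume \<epsilon>: "0 < \<epsilon>" "\<epsilon> < \<nu>"
  have "(LINT y:annulus \<epsilon> \<nu> x|lebesgue. K x y * (f y + g y))
    = (LINT y:annulus \<epsilon> \<nu> x|lebesgue. K x y * f y) + (LINT y:annulus \<epsilon> \<nu> x|lebesgue. K x y * g y)"
    using assms \<epsilon> by (simp add: annulus_integral trunc_add)
  then have "ennreal (cmod (LINT y:annulus \<epsilon> \<nu> x|lebesgue. K x y * (f y + g y)))
    \<le> ennreal (cmod (LINT y:annulus \<epsilon> \<nu> x|lebesgue. K x y * f y)) + ennreal (cmod (LINT y:annulus \<epsilon> \<nu> x|lebesgue. K x y * g y))"
    by (simp add: ennreal_plus[symmetric] norm_triangle_ineq del: ennreal_plus)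
  also have "\<dots> \<le> maximal_truncation K f x + maximal_truncation K g x"
    using \<epsilon> by (intro add_mono annulus_le_maximal_truncation)
  finally show "ennreal (cmod (LINT y:annulus \<epsilon> \<nu> x|lebesgue. K x y * (f y + g y)))
    \<le> maximal_truncation K f x + maximal_truncation K g x" .
qed

text \<open>Dominated convergence along sequences. The indicators converge off the two bounding
  spheres, the kernel is at most \<open>c / \<epsilon> ^ CARD('n)\<close> on the annuli, and for
  nearby centres these stay in one compact ball, where \<open>f\<close> is integrable.\<close>

lemma continuous_annulus_integral:
  assumes f: "locally_integrable f" and \<epsilon>: "0 < \<epsilon>" "\<epsilon> < \<nu>"
  shows "isCont (\<lambda>x. LINT y:annulus \<epsilon> \<nu> x|lebesgue. K x y * f y) x"
  unfolding continuous_at_sequentially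
proof (intro allI impI)
  fix u :: "nat \<Rightarrow> real^'n" assume u: "u \<longlonglongrightarrow> x"
  then have "\<forall>\<^sub>F j in sequentially. dist (u j) x < 1" by (rule tendstoD) simp
  then obtain N where N: "\<And>j. N \<le> j \<Longrightarrow> dist (u j) x < 1" unfolding eventually_sequentially by blast
  define v where "v j = u (j + N)" for j
  have v: "v \<longlonglongrightarrow> x" "\<And>j. dist (v j) x < 1" unfolding v_def using u N by (auto intro: LIMSEQ_ignore_initial_segment)
  define C where "C = cball x (\<nu> + 1)"
  have fC: "set_integrable lebesgue C f" using f by (auto simp: locally_integrable_def C_def)
  have vC: "annulus \<epsilon> \<nu> (v j) \<subseteq> C" for j
  proof
    fix y assume "y \<in> annulus \<epsilon> \<nu> (v j)"
    then show "y \<in> C" using v(2)[of j] dist_triangle[of x y "v j"] by (auto simp: annulus_def C_def dist_norm norm_minus_commute)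
  qed
  have xC: "annulus \<epsilon> \<nu> x \<subseteq> C" by (auto simp: annulus_def C_def dist_norm)
  have "(\<lambda>j. LINT y|lebesgue. indicator (annulus \<epsilon> \<nu> (v j)) y *\<^sub>R (K (v j) y * f y))
      \<longlonglongrightarrow> (LINT y|lebesgue. indicator (annulus \<epsilon> \<nu> x) y *\<^sub>R (K x y * f y))"
  proof (rule integral_dominated_convergence[where w = "\<lambda>y. (c / \<epsilon> ^ CARD('n)) * cmod (indicator C y *\<^sub>R f y)"])
    have "annulus \<epsilon> \<nu> z \<subseteq> {y. \<epsilon> \<le> norm (z - y)}" for z by (auto simp: annulus_def)
    then have "set_integrable lebesgue (annulus \<epsilon> \<nu> z) (\<lambda>y. K z y * f y)" if "annulus \<epsilon> \<nu> z \<subseteq> C" for z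
      using that \<epsilon> by (intro kernel_set_integrable[OF fC far_sets(3), where r=\<epsilon>])
    then have "(\<lambda>y. indicator (annulus \<epsilon> \<nu> z) y *\<^sub>R (K z y * f y)) \<in> borel_measurable lebesgue" if "annulus \<epsilon> \<nu> z \<subseteq> C" for z
      using that unfolding set_integrable_def by (blast intro: borel_measurable_integrable)
    then show "(\<lambda>y. indicator (annulus \<epsilon> \<nu> x) y *\<^sub>R (K x y * f y)) \<in> borel_measurable lebesgue"
      "(\<lambda>y. indicator (annulus \<epsilon> \<nu> (v j)) y *\<^sub>R (K (v j) y * f y)) \<in> borel_measurable lebesgue" for j
      using xC vC by blast+
    show "integrable lebesgue (\<lambda>y. (c / \<epsilon> ^ CARD('n)) * cmod (indicator C y *\<^sub>R f y))"
      using fC unfolding set_integrable_def by (intro integrable_mult_right integrable_norm)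
    show "AE y in lebesgue. cmod (indicator (annulus \<epsilon> \<nu> (v j)) y *\<^sub>R (K (v j) y * f y)) \<le> (c / \<epsilon> ^ CARD('n)) * cmod (indicator C y *\<^sub>R f y)" for j
    proof (rule AE_I2)
      fix y
      show "cmod (indicator (annulus \<epsilon> \<nu> (v j)) y *\<^sub>R (K (v j) y * f y)) \<le> (c / \<epsilon> ^ CARD('n)) * cmod (indicator C y *\<^sub>R f y)"
      proof (cases "y \<in> annulus \<epsilon> \<nu> (v j)")
        case True
        then have "cmod (K (v j) y) \<le> c / \<epsilon> ^ CARD('n)" using \<epsilon> by (intro size_far) (auto simp: annulus_def)
        from mult_right_mono[OF this, of "cmod (f y)"] show ?thesis
          using True vC[of j] by (auto simp: norm_mult)
      qed (use c \<epsilon> in simp)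
    qed
    show "AE y in lebesgue. (\<lambda>j. indicator (annulus \<epsilon> \<nu> (v j)) y *\<^sub>R (K (v j) y * f y))
        \<longlonglongrightarrow> indicator (annulus \<epsilon> \<nu> x) y *\<^sub>R (K x y * f y)"
      using AE_norm_diff_neq[of x \<epsilon>] AE_norm_diff_neq[of x \<nu>]
    proof eventually_elim
      case (elim y)
      have lim: "(\<lambda>j. norm (v j - y)) \<longlonglongrightarrow> norm (x - y)" using v(1) by (intro tendsto_intros)
      have "\<forall>\<^sub>F j in sequentially. indicator (annulus \<epsilon> \<nu> x) y = (indicator (annulus \<epsilon> \<nu> (v j)) y :: real)"
      proof (cases "norm (x - y) < \<epsilon> \<or> \<nu> < norm (x - y)")
        case True
        then have "\<forall>\<^sub>F j in sequentially. norm (v j - y) < \<epsilon> \<or> \<nu> < norm (v j - y)"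
        proof
          assume "norm (x - y) < \<epsilon>"
          from order_tendstoD(2)[OF lim this] show ?thesis by (rule eventually_mono) simp
        next
          assume "\<nu> < norm (x - y)"
          from order_tendstoD(1)[OF lim this] show ?thesis by (rule eventually_mono) simp
        qed
        then show ?thesis by eventually_elim (use True in \<open>auto simp: annulus_def indicator_def\<close>)
      next
        case False
        then have "\<epsilon> < norm (x - y)" "norm (x - y) < \<nu>" using elim by auto
        then have "\<forall>\<^sub>F j in sequentially. \<epsilon> < norm (v j - y) \<and> norm (v j - y) < \<nu>"
          using order_tendstoD[OF lim] by (intro eventually_conj) blast+
        then show ?thesis by eventually_elim (use \<open>\<epsilon> < norm (x - y)\<close> \<open>norm (x - y) < \<nu>\<close> in \<open>auto simp: annulus_def indicator_def\<close>)
      qed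
      then have ind: "(\<lambda>j. indicator (annulus \<epsilon> \<nu> (v j)) y :: real) \<longlonglongrightarrow> indicator (annulus \<epsilon> \<nu> x) y"
        by (rule tendsto_cong[THEN iffD1, OF _ tendsto_const])
      show ?case
      \<comment> \<open>On the diagonal \<open>K\<close> need not be continuous, but there the
        integrand vanishes for all large indices because \<open>\<epsilon>\<close> is
        positive.\<close>
      proof (cases "x = y")
        case True
        then have "indicator (annulus \<epsilon> \<nu> x) y = (0::real)" using \<epsilon> by (simp add: annulus_def)
        moreover have "\<forall>\<^sub>F j in sequentially. 0 = indicator (annulus \<epsilon> \<nu> (v j)) y *\<^sub>R (K (v j) y * f y)"
        proof -
          have "\<forall>\<^sub>F j in sequentially. norm (v j - y) < \<epsilon>"
            using order_tendstoD(2)[OF lim] True \<epsilon> by simp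
          then show ?thesis by eventually_elim (auto simp: annulus_def)
        qed
        then have "(\<lambda>j. indicator (annulus \<epsilon> \<nu> (v j)) y *\<^sub>R (K (v j) y * f y)) \<longlonglongrightarrow> 0"
          by (rule tendsto_cong[THEN iffD1, OF _ tendsto_const])
        ultimately show ?thesis by simp
      next
        case False
        have "(\<lambda>j. K (v j) y) \<longlonglongrightarrow> K x y"
          using isCont_K1[OF False] v(1) by (rule isCont_tendsto_compose)
        then show ?thesis using ind by (intro tendsto_intros)
      qed
    qed
  qed
  then have "(\<lambda>j. LINT y:annulus \<epsilon> \<nu> (u (j + N))|lebesgue. K (u (j + N)) y * f y) \<longlonglongrightarrow> (LINT y:annulus \<epsilon> \<nu> x|lebesgue. K x y * f y)"
    by (simp add: set_lebesgue_integral_def v_def)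
  then have "(\<lambda>j. LINT y:annulus \<epsilon> \<nu> (u j)|lebesgue. K (u j) y * f y) \<longlonglongrightarrow> (LINT y:annulus \<epsilon> \<nu> x|lebesgue. K x y * f y)"
    by (rule LIMSEQ_offset)
  then show "((\<lambda>x. LINT y:annulus \<epsilon> \<nu> x|lebesgue. K x y * f y) \<circ> u) \<longlonglongrightarrow> (LINT y:annulus \<epsilon> \<nu> x|lebesgue. K x y * f y)"
    by (simp add: o_def)
qed

text \<open>A supremum of continuous functions is lower semicontinuous. Openness is used beyond
  measurability: it allows exceptional sets to be exhausted by cells.\<close>

lemma open_maximal_truncation:
  assumes f: "locally_integrable f"
  shows "open {x. a < maximal_truncation K f x}"
proof -
  have "open {x. a < ennreal (cmod (LINT y:annulus \<epsilon> \<nu> x|lebesgue. K x y * f y))}" if "0 < \<epsilon>" "\<epsilon> < \<nu>" for \<epsilon> \<nu>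
  proof (rule open_Collect_less)
    have "continuous_on UNIV (\<lambda>x. LINT y:annulus \<epsilon> \<nu> x|lebesgue. K x y * f y)"
      using continuous_annulus_integral[OF f that] by (intro continuous_at_imp_continuous_on) auto
    then show "continuous_on UNIV (\<lambda>x. ennreal (cmod (LINT y:annulus \<epsilon> \<nu> x|lebesgue. K x y * f y)))"
      by (intro continuous_on_ennreal continuous_on_norm)
  qed (rule continuous_on_const)
  moreover have "{x. a < maximal_truncation K f x} = (\<Union>(\<epsilon>, \<nu>)\<in>{(\<epsilon>, \<nu>). 0 < \<epsilon> \<and> \<epsilon> < \<nu>}.
      {x. a < ennreal (cmod (LINT y:annulus \<epsilon> \<nu> x|lebesgue. K x y * f y))})"
    unfolding maximal_truncation_annulus by (auto simp: less_SUP_iff)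
  ultimately show ?thesis by (auto intro!: open_UN)
qed

lemma maximal_truncation_measurable:
  assumes "locally_integrable f"
  shows "maximal_truncation K f \<in> borel_measurable lebesgue"
proof (rule borel_measurableI_greater)
  fix a
  show "{x \<in> space lebesgue. a < maximal_truncation K f x} \<in> sets lebesgue"
    using open_sets_lebesgue[OF open_maximal_truncation[OF assms, of a]] by simp
qed

end

lemma integrable_imp_locally_integrable: "integrable lebesgue f \<Longrightarrow> locally_integrable f"
  unfolding locally_integrable_def set_integrable_def
  by (intro allI impI integrable_mult_indicator) (simp_all add: borel_sets_lebesgue borel_compact)

section \<open>Cotlar's inequality\<close>

definition cut :: "'a set \<Rightarrow> ('a \<Rightarrow> complex) \<Rightarrow> 'a \<Rightarrow> complex" where
  "cut A f = (\<lambda>y. indicator A y *\<^sub>R f y)"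

lemma cut_measurable [measurable (raw)]:
  assumes [measurable]: "f \<in> borel_measurable M" "A \<in> sets M"
  shows "cut A f \<in> borel_measurable M"
  unfolding cut_def by measurable

lemma norm_cut: "cmod (cut A f y) = cmod (f y) * indicator A y"
  by (simp add: cut_def indicator_def)

lemma integrable_cut: "integrable M f \<Longrightarrow> A \<in> sets M \<Longrightarrow> integrable M (cut A f)"
  unfolding cut_def by (rule integrable_mult_indicator)

lemma set_integral_cut: "(LINT y:A|M. g y * f y) = (LINT y|M. g y * cut A f y)"
  unfolding set_lebesgue_integral_def cut_def by (rule Bochner_Integration.integral_cong) auto

lemma nn_integral_cut: "(\<integral>\<^sup>+y. ennreal (cmod (cut A f y)) \<partial>M) = (\<integral>\<^sup>+y\<in>A. ennreal (cmod (f y)) \<partial>M)"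
  by (rule nn_integral_cong) (simp add: norm_cut indicator_def)

lemma L2_cut:
  fixes f :: "real^'n \<Rightarrow> complex"
  assumes "f \<in> L2_functions" "A \<in> sets lebesgue"
  shows "cut A f \<in> L2_functions"
proof -
  have "integrable lebesgue (\<lambda>x. indicator A x *\<^sub>R (cmod (f x))\<^sup>2)"
    using assms by (intro integrable_mult_indicator) (auto simp: L2_functions_def)
  also have "(\<lambda>x. indicator A x *\<^sub>R (cmod (f x))\<^sup>2) = (\<lambda>x. (cmod (cut A f x))\<^sup>2)"
    by (auto simp: norm_cut indicator_def)
  finally show ?thesis using assms by (auto simp: L2_functions_def intro!: cut_measurable)
qed

lemma L2_nn_integral:
  fixes f :: "real^'n \<Rightarrow> complex"
  shows "f \<in> L2_functions \<Longrightarrow> (\<integral>\<^sup>+x. ennreal ((cmod (f x))\<^sup>2) \<partial>lebesgue) = ennreal ((L2_norm f)\<^sup>2)"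
  by (auto simp: L2_functions_def L2_norm_def nn_integral_eq_integral)

text \<open>The pointwise inequality \<open>|g| \<le> sqrt t + |g|^2 / sqrt t\<close> replaces the
  Cauchy-Schwarz inequality. Its constant term contributes the volume of the unit ball to the
  factor, its quadratic term the 1.\<close>

lemma not_maximal_level_square:
  fixes g :: "real^'n \<Rightarrow> complex"
  assumes x: "x \<notin> maximal_level (\<lambda>y. ennreal ((cmod (g y))\<^sup>2)) t" and t: "0 < t"
    and [measurable]: "g \<in> borel_measurable lebesgue"
  shows "x \<notin> maximal_level (\<lambda>y. ennreal (cmod (g y))) ((unit_ball_vol CARD('n) + 1) * sqrt t)"
proof -
  define \<omega> where "\<omega> = unit_ball_vol CARD('n)"
  have \<omega>: "0 < \<omega>" unfolding \<omega>_def by (rule unit_ball_vol_pos) simp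
  have "(\<integral>\<^sup>+y\<in>ball x r. ennreal (cmod (g y)) \<partial>lebesgue) \<le> ennreal ((\<omega> + 1) * sqrt t * r ^ CARD('n))" if r: "0 < r" for r
  proof -
    have "cmod (g y) \<le> sqrt t + 1 / sqrt t * (cmod (g y))\<^sup>2" for y
    proof -
      have "cmod (g y) * sqrt t \<le> t + (cmod (g y))\<^sup>2"
      proof (cases "cmod (g y) \<le> sqrt t")
        case True
        then have "cmod (g y) * sqrt t \<le> sqrt t * sqrt t" using t by (intro mult_right_mono) auto
        then show ?thesis using t by (simp add: add_increasing2)
      next
        case False
        then have "cmod (g y) * sqrt t \<le> cmod (g y) * cmod (g y)" by (intro mult_left_mono) auto
        then show ?thesis using t by (simp add: power2_eq_square)
      qed
      then have "cmod (g y) \<le> (t + (cmod (g y))\<^sup>2) / sqrt t" using t by (simp add: pos_le_divide_eq)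
      also have "\<dots> = sqrt t + 1 / sqrt t * (cmod (g y))\<^sup>2" using t by (simp add: add_divide_distrib real_div_sqrt)
      finally show ?thesis .
    qed
    then have "(\<integral>\<^sup>+y\<in>ball x r. ennreal (cmod (g y)) \<partial>lebesgue)
      \<le> (\<integral>\<^sup>+y. ennreal (sqrt t) * indicator (ball x r) y + ennreal (1 / sqrt t) * (ennreal ((cmod (g y))\<^sup>2) * indicator (ball x r) y) \<partial>lebesgue)"
      using t by (intro nn_integral_mono)
        (auto simp: indicator_def ennreal_mult'[symmetric] ennreal_plus[symmetric] simp del: ennreal_plus intro!: ennreal_leI)
    also have "\<dots> = ennreal (sqrt t) * emeasure lebesgue (ball x r) + ennreal (1 / sqrt t) * (\<integral>\<^sup>+y\<in>ball x r. ennreal ((cmod (g y))\<^sup>2) \<partial>lebesgue)"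
      by (subst nn_integral_add) (auto simp: nn_integral_cmult nn_integral_cmult_indicator)
    also have "\<dots> \<le> ennreal (sqrt t) * ennreal (\<omega> * r ^ CARD('n)) + ennreal (1 / sqrt t) * ennreal (t * r ^ CARD('n))"
      using r x by (intro add_mono mult_left_mono not_maximal_levelD) (auto simp: emeasure_lebesgue_ball \<omega>_def)
    also have "\<dots> = ennreal (sqrt t * (\<omega> * r ^ CARD('n)) + 1 / sqrt t * (t * r ^ CARD('n)))"
      using r t \<omega> by (subst (1 2) ennreal_mult'[symmetric]) (auto simp: ennreal_plus)
    also have "sqrt t * (\<omega> * r ^ CARD('n)) + 1 / sqrt t * (t * r ^ CARD('n)) = (\<omega> + 1) * sqrt t * r ^ CARD('n)"
      using t by (simp add: algebra_simps real_div_sqrt flip: times_divide_eq_left)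
    finally show ?thesis .
  qed
  then have "\<not> (\<exists>r>0. ennreal ((\<omega> + 1) * sqrt t * r ^ CARD('n)) < (\<integral>\<^sup>+y\<in>ball x r. ennreal (cmod (g y)) \<partial>lebesgue))"
    by (metis not_le)
  then show ?thesis by (simp add: maximal_level_def \<omega>_def)
qed

locale cz_operator = calderon_zygmund_operator T K + cz_kernel K c \<delta>
  for T :: "(real^'n \<Rightarrow> complex) \<Rightarrow> real^'n \<Rightarrow> complex" and K c \<delta> +
  fixes B :: real
  assumes B: "0 \<le> B" "f \<in> L2_functions \<Longrightarrow> L2_norm (T f) \<le> B * L2_norm f"
begin

lemma T_measurable: "f \<in> L2_functions \<Longrightarrow> T f \<in> borel_measurable lebesgue"
  using L2_closed[of f] by (simp add: L2_functions_def)

lemma T_nn_integral: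
  assumes f: "f \<in> L2_functions"
  shows "(\<integral>\<^sup>+x. ennreal ((cmod (T f x))\<^sup>2) \<partial>lebesgue) \<le> ennreal (B\<^sup>2) * (\<integral>\<^sup>+x. ennreal ((cmod (f x))\<^sup>2) \<partial>lebesgue)"
proof -
  have "0 \<le> L2_norm (T f)" by (simp add: L2_norm_def)
  then have "(L2_norm (T f))\<^sup>2 \<le> (B * L2_norm f)\<^sup>2" using B(2)[OF f] by (rule power_mono[rotated])
  then show ?thesis using f L2_closed[OF f] by (simp add: L2_nn_integral ennreal_mult'[symmetric] power_mult_distrib)
qed

text \<open>The 3 is from \<open>(a + b + d)^2 \<le> 3 * (a^2 + b^2 + d^2)\<close>. The terms are
  the smoothness error, the mean of \<open>|T g|^2\<close> and that of \<open>|T g1|^2\<close> for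
  the near part \<open>g1\<close>; the means are taken over a ball of radius \<open>s / 2\<close>,
  and \<open>4 ^ CARD('n)\<close> arises from \<open>2 * s = 4 * (s / 2)\<close>.\<close>

definition cotlar_const :: real where
  "cotlar_const = 3 * ((c * tail_const TYPE('n) \<delta> * (unit_ball_vol CARD('n) + 1))\<^sup>2
     + (1 + B\<^sup>2 * 4 ^ CARD('n)) / unit_ball_vol CARD('n))"

lemma cotlar_const_pos: "0 < cotlar_const"
proof -
  have 1: "0 < unit_ball_vol CARD('n)" by (rule unit_ball_vol_pos) simp
  have 2: "0 < 1 + B\<^sup>2 * 4 ^ CARD('n)" by (rule add_pos_nonneg) simp_all
  show ?thesis unfolding cotlar_const_def
    by (rule mult_pos_pos, simp, rule add_nonneg_pos, simp, rule divide_pos_pos[OF 2 1])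
qed

text \<open>Split \<open>g\<close> at distance \<open>s\<close> from \<open>x\<close>. Near
  \<open>x\<close> the image of the far part is given by the kernel, for which the bounded support
  of \<open>g\<close> is required, and varies little; by linearity it also equals \<open>T g\<close>
  minus the image of the near part.\<close>

lemma cotlar_AE:
  assumes g: "g \<in> L2_functions" "integrable lebesgue g" "bounded {y. g y \<noteq> 0}"
    and x: "x \<notin> maximal_level (\<lambda>y. ennreal (cmod (g y))) t" "0 \<le> t" and s: "0 < s"
  shows "AE z in lebesgue. z \<in> ball x (s / 2) \<longrightarrow>
    cmod (trunc s g x) \<le> c * tail_const TYPE('n) \<delta> * t + cmod (T g z) + cmod (T (cut {y. norm (x - y) \<le> s} g) z)"
proof -
  define A where "A = {y. s < norm (x - y)}"
  have A: "A \<in> sets lebesgue" unfolding A_def by (rule far_sets)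
  have nA: "- A = {y. norm (x - y) \<le> s}" by (auto simp: A_def)
  have L2: "cut A g \<in> L2_functions" "cut (- A) g \<in> L2_functions"
    using L2_cut[OF g(1)] A sets.compl_sets[OF A] by (simp_all add: Compl_eq_Diff_UNIV)
  have "g = (\<lambda>y. 1 * cut A g y + 1 * cut (- A) g y)" by (auto simp: cut_def indicator_def)
  then have lin: "AE z in lebesgue. T g z = T (cut A g) z + T (cut (- A) g) z"
    using L2_linear[OF L2, of 1 1] by simp
  have supp: "closure {y. cut A g y \<noteq> 0} \<subseteq> {y. s \<le> norm (x - y)}"
    by (rule closure_minimal[OF _ closed_far]) (auto simp: cut_def A_def indicator_def)
  have "bounded {y. cut A g y \<noteq> 0}"
    by (rule bounded_subset[OF g(3)]) (auto simp: cut_def)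
  then have "compact (closure {y. cut A g y \<noteq> 0})" by simp
  from kernel_representation[OF L2(1) this]
  have rep: "AE z in lebesgue. z \<notin> closure {y. cut A g y \<noteq> 0} \<longrightarrow> T (cut A g) z = (LINT y|lebesgue. K z y * cut A g y)" .
  show ?thesis
    using lin rep
  proof eventually_elim
    case (elim z)
    show ?case
    proof
      assume z: "z \<in> ball x (s / 2)"
      then have "z \<notin> closure {y. cut A g y \<noteq> 0}" using supp s by (auto simp: dist_norm)
      then have "T (cut A g) z = (LINT y:A|lebesgue. K z y * g y)"
        using elim by (simp add: set_integral_cut)
      moreover have "cmod ((LINT y:A|lebesgue. K x y * g y) - (LINT y:A|lebesgue. K z y * g y)) \<le> c * tail_const TYPE('n) \<delta> * t"
        by (rule kernel_smooth_bound[OF x g(2) A, where r=s]) (use z s in \<open>auto simp: A_def dist_norm\<close>)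
      moreover have "trunc s g x = (LINT y:A|lebesgue. K x y * g y)" by (simp add: trunc_def A_def)
      ultimately have "cmod (trunc s g x - T (cut A g) z) \<le> c * tail_const TYPE('n) \<delta> * t" by simp
      moreover have "cmod (trunc s g x) \<le> cmod (trunc s g x - T (cut A g) z) + cmod (T g z - T (cut (- A) g) z)"
        using norm_triangle_ineq[of "trunc s g x - T (cut A g) z" "T g z - T (cut (- A) g) z"] elim by simp
      moreover have "cmod (T g z - T (cut (- A) g) z) \<le> cmod (T g z) + cmod (T (cut (- A) g) z)"
        by (rule norm_triangle_ineq4)
      ultimately have "cmod (trunc s g x) \<le> c * tail_const TYPE('n) \<delta> * t + (cmod (T g z) + cmod (T (cut (- A) g) z))"
        by linarith
      then show "cmod (trunc s g x) \<le> c * tail_const TYPE('n) \<delta> * t + cmod (T g z) + cmod (T (cut {y. norm (x - y) \<le> s} g) z)"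
        by (simp add: nA)
    qed
  qed
qed

text \<open>The bound of \<open>cotlar_AE\<close> is squared and integrated over the ball of radius
  \<open>s / 2\<close>. The second level set controls the mean of \<open>|T g|^2\<close> there;
  \<open>L2\<close> boundedness and the first level set control the near part.\<close>

lemma cotlar:
  assumes g: "g \<in> L2_functions" "integrable lebesgue g" "bounded {y. g y \<noteq> 0}"
    and x: "x \<notin> maximal_level (\<lambda>y. ennreal ((cmod (g y))\<^sup>2)) t"
      "x \<notin> maximal_level (\<lambda>y. ennreal ((cmod (T g y))\<^sup>2)) t"
    and t: "0 < t" and s: "0 < s"
  shows "(cmod (trunc s g x))\<^sup>2 \<le> cotlar_const * t"
proof -
  define \<omega> where "\<omega> = unit_ball_vol CARD('n)"
  have \<omega>: "0 < \<omega>" unfolding \<omega>_def by (rule unit_ball_vol_pos) simp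
  define C1 where "C1 = c * tail_const TYPE('n) \<delta> * (\<omega> + 1)"
  define g1 where "g1 = cut {y. norm (x - y) \<le> s} g"
  define D where "D = ball x (s / 2)"
  define v where "v = (s / 2) ^ CARD('n)"
  have v: "0 < v" using s by (simp add: v_def)
  have far: "{y. norm (x - y) \<le> s} = cball x s" by (auto simp: dist_norm)
  have g1: "g1 \<in> L2_functions" unfolding g1_def far
    by (rule L2_cut[OF g(1)]) (simp add: borel_sets_lebesgue)
  have [measurable]: "g \<in> borel_measurable lebesgue" "g1 \<in> borel_measurable lebesgue"
    "T g \<in> borel_measurable lebesgue" "T g1 \<in> borel_measurable lebesgue" "D \<in> sets lebesgue"
    using g(1) g1 by (auto simp: L2_functions_def T_measurable D_def ball_sets_lebesgue)
  define \<tau> where "\<tau> = (cmod (trunc s g x))\<^sup>2"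
  have "x \<notin> maximal_level (\<lambda>y. ennreal (cmod (g y))) ((\<omega> + 1) * sqrt t)"
    unfolding \<omega>_def by (rule not_maximal_level_square[OF x(1) t]) measurable
  then have ae: "AE z in lebesgue. z \<in> D \<longrightarrow> cmod (trunc s g x) \<le> C1 * sqrt t + cmod (T g z) + cmod (T g1 z)"
    using cotlar_AE[OF g, of x "(\<omega> + 1) * sqrt t" s] \<omega> t s by (simp add: C1_def g1_def D_def mult.assoc)
  have "ennreal \<tau> * emeasure lebesgue D = (\<integral>\<^sup>+z. ennreal \<tau> * indicator D z \<partial>lebesgue)"
    by (simp add: nn_integral_cmult_indicator)
  also have "\<dots> \<le> (\<integral>\<^sup>+z. (ennreal (3 * C1\<^sup>2 * t) * indicator D z + ennreal 3 * (ennreal ((cmod (T g z))\<^sup>2) * indicator D z))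
        + ennreal 3 * ennreal ((cmod (T g1 z))\<^sup>2) \<partial>lebesgue)"
  proof (rule nn_integral_mono_AE, use ae in eventually_elim)
    case (elim z)
    show ?case
    proof (cases "z \<in> D")
      case True
      let ?a = "C1 * sqrt t" and ?b = "cmod (T g z)" and ?d = "cmod (T g1 z)"
      have "\<tau> \<le> (?a + ?b + ?d)\<^sup>2" unfolding \<tau>_def using elim True by (intro power_mono) auto
      also have "\<dots> \<le> 3 * ?a\<^sup>2 + 3 * ?b\<^sup>2 + 3 * ?d\<^sup>2"
        \<comment> \<open>The difference of the two sides is the sum of the squares of the three
          pairwise differences.\<close>
        using sum_squares_ge_zero[of "?a - ?b" "?b - ?d"] zero_le_power2[of "?a - ?d"]
        by (simp add: power2_eq_square algebra_simps)
      also have "?a\<^sup>2 = C1\<^sup>2 * t" using t by (simp add: power_mult_distrib)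
      finally have "\<tau> \<le> 3 * C1\<^sup>2 * t + 3 * ?b\<^sup>2 + 3 * ?d\<^sup>2" by (simp add: mult.assoc)
      then have "ennreal \<tau> \<le> ennreal (3 * C1\<^sup>2 * t + 3 * ?b\<^sup>2 + 3 * ?d\<^sup>2)" by (rule ennreal_leI)
      also have "\<dots> = ennreal (3 * C1\<^sup>2 * t) + ennreal 3 * ennreal (?b\<^sup>2) + ennreal 3 * ennreal (?d\<^sup>2)"
        using t by (subst ennreal_plus, simp, simp, subst ennreal_plus, simp, simp, simp add: ennreal_mult')
      finally show ?thesis using True by simp
    qed simp
  qed
  also have "\<dots> = ennreal (3 * C1\<^sup>2 * t) * emeasure lebesgue D
      + ennreal 3 * (\<integral>\<^sup>+z\<in>D. ennreal ((cmod (T g z))\<^sup>2) \<partial>lebesgue) + ennreal 3 * (\<integral>\<^sup>+z. ennreal ((cmod (T g1 z))\<^sup>2) \<partial>lebesgue)"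
    by (simp add: nn_integral_add nn_integral_cmult nn_integral_cmult_indicator)
  also have "\<dots> \<le> ennreal (3 * C1\<^sup>2 * t) * ennreal (\<omega> * v) + ennreal 3 * ennreal (t * v) + ennreal 3 * ennreal (B\<^sup>2 * (t * (4 ^ CARD('n) * v)))"
  proof (intro add_mono mult_left_mono)
    show "emeasure lebesgue D \<le> ennreal (\<omega> * v)" using s by (simp add: D_def v_def \<omega>_def emeasure_lebesgue_ball)
    show "(\<integral>\<^sup>+z\<in>D. ennreal ((cmod (T g z))\<^sup>2) \<partial>lebesgue) \<le> ennreal (t * v)"
      unfolding D_def v_def using x(2) s by (intro not_maximal_levelD) auto
    have "(\<integral>\<^sup>+z. ennreal ((cmod (g1 z))\<^sup>2) \<partial>lebesgue) = (\<integral>\<^sup>+z\<in>cball x s. ennreal ((cmod (g z))\<^sup>2) \<partial>lebesgue)"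
      by (rule nn_integral_cong) (auto simp: g1_def far norm_cut indicator_def)
    also have "\<dots> \<le> ennreal (t * (2 * s) ^ CARD('n))"
      using x(1) s by (intro not_maximal_level_subset) (auto simp: dist_norm)
    also have "(2 * s) ^ CARD('n) = (4 * (s / 2)) ^ CARD('n)" by simp
    also have "\<dots> = 4 ^ CARD('n) * v" unfolding v_def by (rule power_mult_distrib)
    finally have "ennreal (B\<^sup>2) * (\<integral>\<^sup>+z. ennreal ((cmod (g1 z))\<^sup>2) \<partial>lebesgue) \<le> ennreal (B\<^sup>2) * ennreal (t * (4 ^ CARD('n) * v))"
      by (rule mult_left_mono) simp
    then show "(\<integral>\<^sup>+z. ennreal ((cmod (T g1 z))\<^sup>2) \<partial>lebesgue) \<le> ennreal (B\<^sup>2 * (t * (4 ^ CARD('n) * v)))"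
      using T_nn_integral[OF g1] by (simp add: ennreal_mult')
  qed auto
  also have "\<dots> = ennreal (3 * C1\<^sup>2 * t * (\<omega> * v) + 3 * (t * v) + 3 * (B\<^sup>2 * (t * (4 ^ CARD('n) * v))))"
    using t v \<omega> by (subst (1 2 3) ennreal_mult'[symmetric]) (auto simp: ennreal_plus)
  also have "3 * C1\<^sup>2 * t * (\<omega> * v) + 3 * (t * v) + 3 * (B\<^sup>2 * (t * (4 ^ CARD('n) * v))) = cotlar_const * t * (\<omega> * v)"
    using \<omega> by (simp add: cotlar_const_def C1_def \<omega>_def[symmetric] field_simps)
  finally have "ennreal \<tau> * emeasure lebesgue D \<le> ennreal (cotlar_const * t * (\<omega> * v))" .
  moreover have "ennreal \<tau> * emeasure lebesgue D = ennreal (\<tau> * (\<omega> * v))"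
    using s \<omega> v by (simp add: D_def v_def \<omega>_def emeasure_lebesgue_ball \<tau>_def ennreal_mult')
  ultimately have "ennreal (\<tau> * (\<omega> * v)) \<le> ennreal (cotlar_const * t * (\<omega> * v))" by simp
  then have "\<tau> * (\<omega> * v) \<le> cotlar_const * t * (\<omega> * v)"
    using \<omega> v t cotlar_const_pos by (subst (asm) ennreal_le_iff) auto
  then show ?thesis using \<omega> v by (simp add: \<tau>_def)
qed

text \<open>The factor \<open>4 * cotlar_const\<close> relates the height for the squares to
  \<open>l^2\<close>, \<open>5 ^ CARD('n) * unit_ball_vol CARD('n)\<close> is the weak type constant
  of the maximal function, and \<open>1 + B\<^sup>2\<close> covers \<open>|g|^2\<close> and
  \<open>|T g|^2\<close>.\<close>

definition weak_type_22_const :: real where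
  "weak_type_22_const = 4 * cotlar_const * (5 ^ CARD('n) * unit_ball_vol CARD('n) * (1 + B\<^sup>2))"

lemma weak_type_22_const_pos: "0 < weak_type_22_const"
proof -
  have 1: "0 < unit_ball_vol CARD('n)" by (rule unit_ball_vol_pos) simp
  have 2: "0 < 1 + B\<^sup>2" by (rule add_pos_nonneg) simp_all
  show ?thesis unfolding weak_type_22_const_def
    by (intro mult_pos_pos cotlar_const_pos 1 2) simp_all
qed

lemma weak_type_22:
  assumes g: "g \<in> L2_functions" "integrable lebesgue g" "bounded {y. g y \<noteq> 0}" and l: "0 < l"
  shows "ennreal (l\<^sup>2) * emeasure lebesgue {x. ennreal l < maximal_truncation K g x}
    \<le> ennreal weak_type_22_const * (\<integral>\<^sup>+x. ennreal ((cmod (g x))\<^sup>2) \<partial>lebesgue)"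
proof -
  \<comment> \<open>Chosen so that Cotlar's inequality bounds the truncations by
    \<open>l / 2\<close>; \<open>maximal_truncation_le_trunc\<close> then doubles this to
    \<open>l\<close>.\<close>
  define t where "t = l\<^sup>2 / (4 * cotlar_const)"
  have t: "0 < t" using l cotlar_const_pos by (simp add: t_def)
  define L where "L = maximal_level (\<lambda>y. ennreal ((cmod (g y))\<^sup>2)) t"
  define L' where "L' = maximal_level (\<lambda>y. ennreal ((cmod (T g y))\<^sup>2)) t"
  define I where "I = (\<integral>\<^sup>+x. ennreal ((cmod (g x))\<^sup>2) \<partial>lebesgue)"
  define w where "w = 5 ^ CARD('n) * unit_ball_vol CARD('n)"
  have w: "0 < w" unfolding w_def by (intro mult_pos_pos unit_ball_vol_pos) auto
  have [measurable]: "g \<in> borel_measurable lebesgue" "T g \<in> borel_measurable lebesgue"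
    using g(1) by (auto simp: L2_functions_def T_measurable)
  have sub: "{x. ennreal l < maximal_truncation K g x} \<subseteq> L \<union> L'"
  proof (rule ccontr)
    assume "\<not> {x. ennreal l < maximal_truncation K g x} \<subseteq> L \<union> L'"
    then obtain x where x: "ennreal l < maximal_truncation K g x" "x \<notin> L" "x \<notin> L'" by blast
    have "cmod (trunc s g x) \<le> l / 2" if "0 < s" for s
    proof -
      have "(cmod (trunc s g x))\<^sup>2 \<le> (l / 2)\<^sup>2"
        using cotlar[OF g, of x t s] x t that cotlar_const_pos by (simp add: L_def L'_def t_def power_divide)
      then show ?thesis by (rule power2_le_imp_le) (use l in simp)
    qed
    from maximal_truncation_le_trunc[OF g(2) this] have "maximal_truncation K g x \<le> ennreal l" by simp
    then show False using x(1) by simp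
  qed
  have "ennreal t * emeasure lebesgue {x. ennreal l < maximal_truncation K g x} \<le> ennreal t * (emeasure lebesgue L + emeasure lebesgue L')"
  proof (rule mult_left_mono)
    have LL: "L \<in> sets lebesgue" "L' \<in> sets lebesgue" unfolding L_def L'_def by (intro open_sets_lebesgue open_maximal_level)+
    have "emeasure lebesgue {x. ennreal l < maximal_truncation K g x} \<le> emeasure lebesgue (L \<union> L')"
      using sub LL by (intro emeasure_mono) auto
    also have "\<dots> \<le> emeasure lebesgue L + emeasure lebesgue L'" using LL by (rule emeasure_subadditive)
    finally show "emeasure lebesgue {x. ennreal l < maximal_truncation K g x} \<le> emeasure lebesgue L + emeasure lebesgue L'" .
  qed simp
  also have "\<dots> = ennreal t * emeasure lebesgue L + ennreal t * emeasure lebesgue L'" by (simp add: distrib_left)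
  also have "\<dots> \<le> ennreal w * I + ennreal w * (\<integral>\<^sup>+x. ennreal ((cmod (T g x))\<^sup>2) \<partial>lebesgue)"
    unfolding L_def L'_def I_def w_def using t by (intro add_mono emeasure_maximal_level) auto
  also have "\<dots> \<le> ennreal w * I + ennreal w * (ennreal (B\<^sup>2) * I)"
    unfolding I_def by (intro add_mono mult_left_mono T_nn_integral g) auto
  also have "\<dots> = ennreal (w * (1 + B\<^sup>2)) * I"
    using w by (simp add: ennreal_mult' distrib_right distrib_left mult.assoc)
  finally have "ennreal (4 * cotlar_const) * (ennreal t * emeasure lebesgue {x. ennreal l < maximal_truncation K g x})
    \<le> ennreal (4 * cotlar_const) * (ennreal (w * (1 + B\<^sup>2)) * I)" by (rule mult_left_mono) simp
  moreover have "ennreal (4 * cotlar_const) * (ennreal t * X) = ennreal (l\<^sup>2) * X" for X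
  proof -
    have "4 * cotlar_const * t = l\<^sup>2" using cotlar_const_pos by (simp add: t_def)
    then show ?thesis using cotlar_const_pos by (simp add: mult.assoc[symmetric] ennreal_mult'[symmetric])
  qed
  moreover have "ennreal (4 * cotlar_const) * (ennreal (w * (1 + B\<^sup>2)) * I) = ennreal weak_type_22_const * I"
    using cotlar_const_pos unfolding mult.assoc[symmetric]
    by (subst ennreal_mult'[symmetric]) (auto simp: weak_type_22_const_def w_def)
  ultimately show ?thesis by (simp add: I_def)
qed

end

section \<open>Calderon--Zygmund decomposition\<close>

lemma norm_set_integral_Union_le:
  fixes F :: "'a \<Rightarrow> complex"
  assumes W: "countable W" "disjoint W" "\<And>Q. Q \<in> W \<Longrightarrow> Q \<in> sets M" and F: "set_integrable M (\<Union>W) F"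
  shows "ennreal (cmod (LINT y:\<Union>W|M. F y)) \<le> (\<integral>\<^sup>+Q. ennreal (cmod (LINT y:Q|M. F y)) \<partial>count_space W)"
proof (cases "finite W")
  case True
  have "(LINT y:\<Union>((\<lambda>Q. Q) ` W)|M. F y) = (\<Sum>Q\<in>W. LINT y:Q|M. F y)"
    using True W set_integrable_subset[OF F W(3) Union_upper]
    by (intro set_integral_finite_Union) (auto simp: disjoint_family_on_def disjoint_def)
  then have "ennreal (cmod (LINT y:\<Union>W|M. F y)) \<le> ennreal (\<Sum>Q\<in>W. cmod (LINT y:Q|M. F y))"
    by (simp add: ennreal_leI norm_sum)
  then show ?thesis using True by (simp add: nn_integral_count_space_finite)
next
  case False
  define A where "A = from_nat_into W"
  have A: "bij_betw A UNIV W" unfolding A_def by (rule bij_betw_from_nat_into[OF W(1) False])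
  then have AW: "A i \<in> W" for i by (auto simp: bij_betw_def)
  have U: "\<Union>W = (\<Union>i. A i)" using A by (auto simp: bij_betw_def)
  define a where "a i = (LINT y:A i|M. F y)" for i
  have eq: "(LINT y:\<Union>W|M. F y) = (\<Sum>i. a i)" unfolding U a_def
  proof (rule lebesgue_integral_countable_add)
    show "A i \<in> sets M" for i using AW W by blast
    show "A i \<inter> A j = {}" if "i \<noteq> j" for i j
      using AW[of i] AW[of j] A that W(2) by (metis bij_betw_def disjointD injD)
    show "set_integrable M (\<Union>i. A i) F" using F U by simp
  qed
  have "(\<integral>\<^sup>+Q. ennreal (cmod (LINT y:Q|M. F y)) \<partial>count_space W) = (\<Sum>i. ennreal (cmod (a i)))"
    unfolding a_def by (subst nn_integral_bij_count_space[OF A, symmetric]) (rule nn_integral_count_space_nat)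
  moreover have "ennreal (cmod (\<Sum>i. a i)) \<le> (\<Sum>i. ennreal (cmod (a i)))"
  proof (cases "(\<Sum>i. ennreal (cmod (a i))) = top")
    case False
    then have s: "summable (\<lambda>i. cmod (a i))" by (intro summable_suminf_not_top) auto
    then have "ennreal (cmod (\<Sum>i. a i)) \<le> ennreal (\<Sum>i. cmod (a i))" by (intro ennreal_leI summable_norm)
    also have "\<dots> = (\<Sum>i. ennreal (cmod (a i)))" using s by (intro suminf_ennreal2[symmetric]) auto
    finally show ?thesis .
  qed simp
  ultimately show ?thesis by (simp add: eq)
qed

lemma nn_integral_count_space_measurable:
  assumes "countable W" "\<And>Q. Q \<in> W \<Longrightarrow> f Q \<in> borel_measurable M"
  shows "(\<lambda>x. \<integral>\<^sup>+Q. f Q x \<partial>count_space W) \<in> borel_measurable M"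
proof (cases "finite W")
  case True
  then show ?thesis using assms by (simp add: nn_integral_count_space_finite)
next
  case False
  then have A: "bij_betw (from_nat_into W) UNIV W" using assms(1) by (intro bij_betw_from_nat_into)
  have "(\<lambda>x. \<integral>\<^sup>+Q. f Q x \<partial>count_space W) = (\<lambda>x. \<Sum>i. f (from_nat_into W i) x)"
    by (subst nn_integral_bij_count_space[OF A, symmetric]) (simp add: nn_integral_count_space_nat)
  moreover have "f (from_nat_into W i) \<in> borel_measurable M" for i
    using A assms(2) by (auto simp: bij_betw_def)
  ultimately show ?thesis by simp
qed

lemma emeasure_superlevel_le:
  assumes [measurable]: "u \<in> borel_measurable M" "A \<in> sets M" and t: "0 < t"
  shows "ennreal t * emeasure M {x \<in> A. ennreal t < u x} \<le> (\<integral>\<^sup>+x\<in>A. u x \<partial>M)"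
proof -
  have [measurable]: "{x \<in> A. ennreal t < u x} \<in> sets M"
  proof -
    have "{x \<in> A. ennreal t < u x} = A \<inter> {x \<in> space M. ennreal t < u x}" using sets.sets_into_space[OF assms(2)] by auto
    then show ?thesis by simp
  qed
  have "ennreal t * emeasure M {x \<in> A. ennreal t < u x} = (\<integral>\<^sup>+x. ennreal t * indicator {x \<in> A. ennreal t < u x} x \<partial>M)"
    by (simp add: nn_integral_cmult_indicator)
  also have "\<dots> \<le> (\<integral>\<^sup>+x\<in>A. u x \<partial>M)" by (intro nn_integral_mono) (auto simp: indicator_def)
  finally show ?thesis .
qed

text \<open>A ball that witnesses membership has bounded radius and meets the support of
  \<open>g\<close>. This gives the good part of the decomposition the bounded support that
  \<open>weak_type_22\<close> demands.\<close>

lemma bounded_maximal_level: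
  fixes g :: "real^'n \<Rightarrow> ennreal" and t :: real
  assumes "bounded {y. g y \<noteq> 0}" "(\<integral>\<^sup>+y. g y \<partial>lebesgue) < \<infinity>" "0 < t"
  shows "bounded (maximal_level g t)"
proof -
  obtain I where I: "(\<integral>\<^sup>+y. g y \<partial>lebesgue) = ennreal I" "0 \<le> I" using assms(2) by (cases "\<integral>\<^sup>+y. g y \<partial>lebesgue") auto
  obtain R where R: "\<And>y. g y \<noteq> 0 \<Longrightarrow> norm y \<le> R" using assms(1) by (auto simp: bounded_iff)
  have "norm x \<le> R + max 1 (I / t)" if x: "x \<in> maximal_level g t" for x
  proof -
    obtain r where r: "0 < r" "ennreal (t * r ^ CARD('n)) < (\<integral>\<^sup>+y\<in>ball x r. g y \<partial>lebesgue)"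
      using x by (auto simp: maximal_level_def)
    have "(\<integral>\<^sup>+y\<in>ball x r. g y \<partial>lebesgue) \<le> ennreal I"
      unfolding I(1)[symmetric] by (intro nn_integral_mono) (auto simp: indicator_def)
    with r(2) have "ennreal (t * r ^ CARD('n)) < ennreal I" by (rule less_le_trans)
    then have lt: "t * r ^ CARD('n) < I" using r(1) assms(3) by (subst (asm) ennreal_less_iff) auto
    have "r \<le> max 1 (I / t)"
    proof (cases "r \<le> 1")
      case False
      then have "r \<le> r ^ CARD('n)" by (intro self_le_power) auto
      then have "t * r \<le> t * r ^ CARD('n)" using assms(3) by simp
      with lt have "t * r \<le> I" by linarith
      then have "r \<le> I / t" using assms(3) by (simp add: pos_le_divide_eq mult.commute)
      then show ?thesis by simp
    qed simp
    moreover have "\<exists>y\<in>ball x r. g y \<noteq> 0"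
    proof (rule ccontr)
      assume "\<not> (\<exists>y\<in>ball x r. g y \<noteq> 0)"
      then have "(\<integral>\<^sup>+y\<in>ball x r. g y \<partial>lebesgue) = (\<integral>\<^sup>+y. 0 \<partial>(lebesgue :: (real^'n) measure))"
        by (intro nn_integral_cong) (auto simp: indicator_def)
      then show False using r(2) by simp
    qed
    then obtain y where "norm (x - y) < r" "g y \<noteq> 0" by (auto simp: dist_norm)
    ultimately show ?thesis using R[of y] norm_triangle_ineq[of "x - y" y] by simp
  qed
  then show ?thesis by (auto simp: bounded_iff)
qed

context cz_operator
begin

text \<open>A common bound for \<open>(2 * CARD('n)) ^ CARD('n)\<close>, from the averages over the
  cells, and \<open>2 * CARD('n) ^ CARD('n)\<close>, valid almost everywhere outside them.\<close>

definition good_bound :: real where "good_bound = 2 * (2 * CARD('n)) ^ CARD('n)"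

text \<open>The volume of a ball of radius \<open>4 * CARD('n) * side Q\<close> relative to
  \<open>Q\<close>, times the weak type constant of the maximal function.\<close>

definition star_const :: real where
  "star_const = unit_ball_vol CARD('n) * (4 * CARD('n)) ^ CARD('n) * (5 ^ CARD('n) * unit_ball_vol CARD('n))"

text \<open>The 2 stems from the mass of the bad part, at most twice that of \<open>h\<close> on
  each cell; the rest is \<open>c\<close> times the bound of
  \<open>tail_integral_const\<close>.\<close>

definition bad_const :: real where "bad_const = 2 * c * tail_const TYPE('n) \<delta> * unit_ball_vol CARD('n)"

text \<open>Height \<open>t\<close> for the good part plus
  \<open>2 * (t + 2 * c * 2 ^ CARD('n) * t)\<close> for the bad part, where the outer 2 is the loss
  between one-sided truncations and annuli.\<close>

definition level_const :: real where "level_const = 3 + 4 * c * 2 ^ CARD('n)"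

definition weak_type_11_const :: real where "weak_type_11_const = weak_type_22_const * good_bound + star_const + bad_const"

end

section \<open>Good and bad part at height \<open>t\<close>\<close>

locale cz_decomposition = cz_operator T K c \<delta> B
  for T :: "(real^'n \<Rightarrow> complex) \<Rightarrow> real^'n \<Rightarrow> complex" and K c \<delta> B +
  fixes h :: "real^'n \<Rightarrow> complex" and t :: real
  assumes h: "integrable lebesgue h" "bounded {y. h y \<noteq> 0}" and t: "0 < t"
begin

definition mass :: real where "mass = (LINT y|lebesgue. cmod (h y))"

definition E where "E = maximal_level (\<lambda>y. ennreal (cmod (h y))) t"

definition W where "W = maximal_cells {} E"

definition avg :: "(real^'n) set \<Rightarrow> complex" where
  "avg Q = (LINT y:Q|lebesgue. h y) / of_real (measure lebesgue Q)"

definition good :: "real^'n \<Rightarrow> complex" where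
  "good y = (if y \<in> E then avg (THE Q. Q \<in> W \<and> y \<in> Q) else h y)"

definition bad :: "real^'n \<Rightarrow> complex" where "bad y = h y - good y"

lemma mass: "0 \<le> mass" "(\<integral>\<^sup>+y. ennreal (cmod (h y)) \<partial>lebesgue) = ennreal mass"
  using h(1) by (auto simp: mass_def nn_integral_eq_integral)

lemma h_measurable [measurable]: "h \<in> borel_measurable lebesgue"
  using h(1) by auto

lemma E_sets [measurable]: "E \<in> sets lebesgue"
  unfolding E_def by (intro open_sets_lebesgue open_maximal_level)

lemma emeasure_E: "ennreal t * emeasure lebesgue E \<le> ennreal (5 ^ CARD('n) * unit_ball_vol CARD('n) * mass)"
proof -
  have "ennreal t * emeasure lebesgue E \<le> ennreal (5 ^ CARD('n) * unit_ball_vol CARD('n)) * ennreal mass"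
    unfolding E_def mass(2)[symmetric] using t by (intro emeasure_maximal_level) auto
  then show ?thesis using mass(1) by (simp add: ennreal_mult'')
qed

lemma emeasure_E_finite: "emeasure lebesgue E < \<infinity>"
proof -
  have "ennreal t * emeasure lebesgue E < \<infinity>" using emeasure_E by (simp add: order_le_less_trans)
  then show ?thesis using t by (auto simp: ennreal_mult_less_top)
qed

lemma Union_W: "\<Union>W = E"
  unfolding W_def
proof (rule Union_maximal_cells)
  show "\<exists>k. cell {} k x \<subseteq> E" if "x \<in> E" for x
    using small_cell[OF _ that] open_maximal_level unfolding E_def by blast
qed (use emeasure_E_finite in auto)

lemma W_facts: "countable W" "disjoint W" "Q \<in> W \<Longrightarrow> cube Q" "Q \<in> W \<Longrightarrow> Q \<in> sets lebesgue"
proof -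
  show "countable W" "disjoint W" by (simp_all add: W_def countable_maximal_cells disjoint_maximal_cells)
  show c: "cube Q" if "Q \<in> W" using that maximal_cells_grid cube_grid unfolding W_def by blast
  show "Q \<in> sets lebesgue" if "Q \<in> W" using c[OF that] by simp
qed

lemma W_family: "disjoint_family_on (\<lambda>Q. Q) W"
  using W_facts(2) by (auto simp: disjoint_family_on_def disjoint_def)

lemma nn_integral_E:
  "f \<in> borel_measurable lebesgue \<Longrightarrow> (\<integral>\<^sup>+y\<in>E. f y \<partial>lebesgue) = (\<integral>\<^sup>+Q. (\<integral>\<^sup>+y\<in>Q. f y \<partial>lebesgue) \<partial>count_space W)"
  using nn_integral_UN_countable[OF W_facts(1) W_facts(4) W_family] by (simp add: Union_W)

lemma emeasure_E_eq: "emeasure lebesgue E = (\<integral>\<^sup>+Q. emeasure lebesgue Q \<partial>count_space W)"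
  using emeasure_UN_countable[OF W_facts(4) W_facts(1) W_family] by (simp add: Union_W)

text \<open>The parent of \<open>Q\<close> contains a point outside \<open>E\<close>, and the ball
  about it with radius \<open>CARD('n)\<close> times the side of the parent contains
  \<open>Q\<close>.\<close>

lemma W_integral:
  assumes "Q \<in> W"
  shows "(\<integral>\<^sup>+y\<in>Q. ennreal (cmod (h y)) \<partial>lebesgue) \<le> ennreal ((2 * CARD('n)) ^ CARD('n) * t * side Q ^ CARD('n))"
proof -
  obtain R where R: "R \<in> shifted_grid {}" "Q \<subseteq> R" "side R = 2 * side Q" "\<not> R \<subseteq> E"
    using maximal_cells_parent assms unfolding W_def by metis
  then obtain z where z: "z \<in> R" "z \<notin> E" by blast
  have "Q \<subseteq> ball z (CARD('n) * side R)"
    using cube_dist_less[OF cube_grid[OF R(1)] z(1)] R(2) by (auto simp: dist_norm)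
  then have "(\<integral>\<^sup>+y\<in>Q. ennreal (cmod (h y)) \<partial>lebesgue) \<le> ennreal (t * (CARD('n) * side R) ^ CARD('n))"
    using z(2) cube_side_pos[OF cube_grid[OF R(1)]] unfolding E_def by (intro not_maximal_level_subset) auto
  also have "t * (CARD('n) * side R) ^ CARD('n) = (2 * CARD('n)) ^ CARD('n) * t * side Q ^ CARD('n)"
    by (simp add: R(3) power_mult_distrib mult_ac)
  finally show ?thesis .
qed

lemma avg_bounds:
  assumes "Q \<in> W"
  shows "ennreal (cmod (avg Q) * side Q ^ CARD('n)) \<le> (\<integral>\<^sup>+y\<in>Q. ennreal (cmod (h y)) \<partial>lebesgue)"
    "cmod (avg Q) \<le> (2 * CARD('n)) ^ CARD('n) * t"
proof -
  have p: "0 < side Q ^ CARD('n)" using cube_side_pos[OF W_facts(3)[OF assms]] by simp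
  have "cmod (avg Q) * side Q ^ CARD('n) = cmod (LINT y:Q|lebesgue. h y)"
    using p cube_side_pos[OF W_facts(3)[OF assms]]
    by (simp add: avg_def measure_cube[OF W_facts(3)[OF assms]] norm_divide norm_power)
  also have "ennreal \<dots> \<le> (\<integral>\<^sup>+y. ennreal (cmod (indicator Q y *\<^sub>R h y)) \<partial>lebesgue)"
    unfolding set_lebesgue_integral_def
    using integrable_cut[OF h(1) W_facts(4)[OF assms]] unfolding cut_def by (rule integral_norm_bound_ennreal)
  also have "\<dots> = (\<integral>\<^sup>+y\<in>Q. ennreal (cmod (h y)) \<partial>lebesgue)"
    by (rule nn_integral_cong) (auto simp: indicator_def)
  finally show 1: "ennreal (cmod (avg Q) * side Q ^ CARD('n)) \<le> (\<integral>\<^sup>+y\<in>Q. ennreal (cmod (h y)) \<partial>lebesgue)" .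
  have "cmod (avg Q) * side Q ^ CARD('n) \<le> (2 * CARD('n)) ^ CARD('n) * t * side Q ^ CARD('n)"
    using order_trans[OF 1 W_integral[OF assms]] t p by (subst (asm) ennreal_le_iff) auto
  then show "cmod (avg Q) \<le> (2 * CARD('n)) ^ CARD('n) * t" using p by (simp add: mult_le_cancel_right)
qed

lemma good_eq: "Q \<in> W \<Longrightarrow> y \<in> Q \<Longrightarrow> good y = avg Q"
proof -
  assume Q: "Q \<in> W" "y \<in> Q"
  have "(THE Q. Q \<in> W \<and> y \<in> Q) = Q"
    using Q W_facts(2) by (intro the_equality) (auto simp: disjoint_def)
  then show ?thesis using Q Union_W by (auto simp: good_def)
qed

lemma good_outside: "y \<notin> E \<Longrightarrow> good y = h y"
  by (simp add: good_def)

lemma bad_outside: "y \<notin> E \<Longrightarrow> bad y = 0"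
  by (simp add: bad_def good_def)

lemma good_measurable [measurable]: "good \<in> borel_measurable lebesgue"
proof (rule measurable_piecewise_restrict[of "insert (- E) W"])
  show "countable (insert (- E) W)" using W_facts by simp
  show "space lebesgue \<subseteq> \<Union>(insert (- E) W)" using Union_W by auto
  show "\<Omega> \<inter> space lebesgue \<in> sets lebesgue" if "\<Omega> \<in> insert (- E) W" for \<Omega>
    using that W_facts(4) sets.compl_sets[OF E_sets] by (auto simp: Compl_eq_Diff_UNIV)
  show "good \<in> borel_measurable (restrict_space lebesgue \<Omega>)" if "\<Omega> \<in> insert (- E) W" for \<Omega>
  proof (cases "\<Omega> = - E")
    case True
    have "h \<in> borel_measurable (restrict_space lebesgue \<Omega>)" by (rule measurable_restrict_space1) simp
    then show ?thesis by (rule measurable_cong[THEN iffD1, rotated]) (auto simp: True good_outside space_restrict_space)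
  next
    case False
    then have "\<Omega> \<in> W" using that by simp
    have "(\<lambda>_. avg \<Omega>) \<in> borel_measurable (restrict_space lebesgue \<Omega>)" by simp
    then show ?thesis by (rule measurable_cong[THEN iffD1, rotated]) (auto simp: good_eq[OF \<open>\<Omega> \<in> W\<close>] space_restrict_space)
  qed
qed

lemma good_bound_pos: "0 < good_bound" by (simp add: good_bound_def)

text \<open>On \<open>E\<close> this is the bound on the averages; off \<open>E\<close>,
  \<open>AE_le_outside_maximal_level\<close> takes the place of Lebesgue differentiation.\<close>

lemma good_AE_le: "AE y in lebesgue. cmod (good y) \<le> good_bound * t"
proof -
  have "AE y in lebesgue. y \<notin> maximal_level (\<lambda>y. ennreal (cmod (h y))) t \<longrightarrow> ennreal (cmod (h y)) \<le> ennreal (2 * CARD('n) ^ CARD('n) * t)"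
    using mass t by (intro AE_le_outside_maximal_level) auto
  then show ?thesis
  proof eventually_elim
    case (elim y)
    show ?case
    proof (cases "y \<in> E")
      case True
      then obtain Q where Q: "Q \<in> W" "y \<in> Q" using Union_W by blast
      have "cmod (good y) \<le> (2 * CARD('n)) ^ CARD('n) * t" using avg_bounds(2)[OF Q(1)] good_eq[OF Q] by simp
      also have "\<dots> \<le> good_bound * t" using t by (simp add: good_bound_def)
      finally show ?thesis .
    next
      case False
      then have "ennreal (cmod (h y)) \<le> ennreal (2 * CARD('n) ^ CARD('n) * t)" using elim by (simp add: E_def)
      then have "cmod (h y) \<le> 2 * CARD('n) ^ CARD('n) * t" using t by (subst (asm) ennreal_le_iff) auto
      also have "\<dots> \<le> good_bound * t"
        using t by (auto simp: good_bound_def intro!: mult_right_mono power_mono)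
      finally show ?thesis using False by (simp add: good_outside)
    qed
  qed
qed

lemma nn_integral_E_Compl:
  assumes [measurable]: "f \<in> borel_measurable lebesgue"
  shows "(\<integral>\<^sup>+y. f y \<partial>lebesgue) = (\<integral>\<^sup>+y\<in>E. f y \<partial>lebesgue) + (\<integral>\<^sup>+y\<in>- E. f y \<partial>lebesgue)"
proof -
  have [measurable]: "- E \<in> sets lebesgue" using sets.compl_sets[OF E_sets] by (simp add: Compl_eq_Diff_UNIV)
  have "(\<integral>\<^sup>+y. f y \<partial>lebesgue) = (\<integral>\<^sup>+y. f y * indicator E y + f y * indicator (- E) y \<partial>lebesgue)"
    by (rule nn_integral_cong) (auto simp: indicator_def)
  also have "\<dots> = (\<integral>\<^sup>+y\<in>E. f y \<partial>lebesgue) + (\<integral>\<^sup>+y\<in>- E. f y \<partial>lebesgue)"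
    by (rule nn_integral_add) measurable
  finally show ?thesis .
qed

lemma good_W_integral:
  assumes "Q \<in> W"
  shows "(\<integral>\<^sup>+y\<in>Q. ennreal (cmod (good y)) \<partial>lebesgue) \<le> (\<integral>\<^sup>+y\<in>Q. ennreal (cmod (h y)) \<partial>lebesgue)"
proof -
  have "(\<integral>\<^sup>+y\<in>Q. ennreal (cmod (good y)) \<partial>lebesgue) = (\<integral>\<^sup>+y. ennreal (cmod (avg Q)) * indicator Q y \<partial>lebesgue)"
    using good_eq[OF assms] by (intro nn_integral_cong) (auto simp: indicator_def)
  also have "\<dots> = ennreal (cmod (avg Q) * side Q ^ CARD('n))"
    using W_facts(3,4)[OF assms] by (simp add: nn_integral_cmult_indicator emeasure_cube ennreal_mult')
  finally show ?thesis using avg_bounds(1)[OF assms] by simp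
qed

lemma good_nn_integral: "(\<integral>\<^sup>+y. ennreal (cmod (good y)) \<partial>lebesgue) \<le> ennreal mass"
proof -
  have "(\<integral>\<^sup>+y\<in>E. ennreal (cmod (good y)) \<partial>lebesgue) \<le> (\<integral>\<^sup>+y\<in>E. ennreal (cmod (h y)) \<partial>lebesgue)"
    by (subst (1 2) nn_integral_E) (auto intro!: nn_integral_mono good_W_integral)
  moreover have "(\<integral>\<^sup>+y\<in>- E. ennreal (cmod (good y)) \<partial>lebesgue) = (\<integral>\<^sup>+y\<in>- E. ennreal (cmod (h y)) \<partial>lebesgue)"
    by (rule nn_integral_cong) (auto simp: indicator_def good_outside)
  ultimately show ?thesis
    unfolding mass(2)[symmetric] by (subst (1 2) nn_integral_E_Compl) (auto intro: add_mono)
qed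

lemma good_integrable: "integrable lebesgue good"
  using good_nn_integral by (intro integrableI_bounded) (auto simp: order_le_less_trans)

lemma good_support: "bounded {y. good y \<noteq> 0}"
proof (rule bounded_subset)
  have "{y. ennreal (cmod (h y)) \<noteq> 0} = {y. h y \<noteq> 0}" by auto
  then have "bounded E" unfolding E_def using h(2) mass t by (intro bounded_maximal_level) auto
  then show "bounded ({y. h y \<noteq> 0} \<union> E)" using h(2) by simp
qed (auto simp: good_def)

lemma good_square: "(\<integral>\<^sup>+y. ennreal ((cmod (good y))\<^sup>2) \<partial>lebesgue) \<le> ennreal (good_bound * t * mass)"
proof -
  have "(\<integral>\<^sup>+y. ennreal ((cmod (good y))\<^sup>2) \<partial>lebesgue) \<le> (\<integral>\<^sup>+y. ennreal (good_bound * t) * ennreal (cmod (good y)) \<partial>lebesgue)"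
  proof (rule nn_integral_mono_AE, use good_AE_le in eventually_elim)
    case (elim y)
    have "(cmod (good y))\<^sup>2 \<le> good_bound * t * cmod (good y)"
      unfolding power2_eq_square using elim by (rule mult_right_mono) simp
    then show ?case using good_bound_pos t by (simp add: ennreal_mult'[symmetric] ennreal_leI)
  qed
  also have "\<dots> = ennreal (good_bound * t) * (\<integral>\<^sup>+y. ennreal (cmod (good y)) \<partial>lebesgue)"
    by (rule nn_integral_cmult) measurable
  also have "\<dots> \<le> ennreal (good_bound * t) * ennreal mass"
    by (rule mult_left_mono[OF good_nn_integral]) simp
  finally show ?thesis using mass(1) by (simp add: ennreal_mult'')
qed

lemma good_L2: "good \<in> L2_functions"
proof -
  have "integrable lebesgue (\<lambda>y. (cmod (good y))\<^sup>2)"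
    using good_square by (intro integrableI_bounded) (auto simp: order_le_less_trans)
  then show ?thesis by (simp add: L2_functions_def)
qed

text \<open>Since \<open>|good|^2\<close> is at most \<open>good_bound * t * |good|\<close> almost
  everywhere, the weak type (2,2) estimate carries a surplus factor \<open>t\<close>, which is
  divided out.\<close>

lemma good_weak: "ennreal t * emeasure lebesgue {x. ennreal t < maximal_truncation K good x}
  \<le> ennreal (weak_type_22_const * good_bound * mass)"
proof -
  have "ennreal (t\<^sup>2) * emeasure lebesgue {x. ennreal t < maximal_truncation K good x}
      \<le> ennreal weak_type_22_const * (\<integral>\<^sup>+x. ennreal ((cmod (good x))\<^sup>2) \<partial>lebesgue)"
    by (rule weak_type_22[OF good_L2 good_integrable good_support t])
  also have "\<dots> \<le> ennreal weak_type_22_const * ennreal (good_bound * t * mass)"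
    by (rule mult_left_mono[OF good_square]) simp
  also have "\<dots> = ennreal t * ennreal (weak_type_22_const * good_bound * mass)"
    using weak_type_22_const_pos t by (simp add: ennreal_mult'[symmetric] mult_ac)
  finally have "ennreal (1 / t) * (ennreal (t\<^sup>2) * emeasure lebesgue {x. ennreal t < maximal_truncation K good x})
      \<le> ennreal (1 / t) * (ennreal t * ennreal (weak_type_22_const * good_bound * mass))"
    by (rule mult_left_mono) simp
  then show ?thesis using t by (simp add: mult.assoc[symmetric] ennreal_mult'[symmetric] power2_eq_square)
qed

lemma bad_measurable [measurable]: "bad \<in> borel_measurable lebesgue"
  unfolding bad_def by measurable

lemma bad_integrable: "integrable lebesgue bad"
  unfolding bad_def using h(1) good_integrable by (rule Bochner_Integration.integrable_diff)

lemma bad_W_nn_integral: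
  assumes "Q \<in> W"
  shows "(\<integral>\<^sup>+y\<in>Q. ennreal (cmod (bad y)) \<partial>lebesgue) \<le> 2 * (\<integral>\<^sup>+y\<in>Q. ennreal (cmod (h y)) \<partial>lebesgue)"
proof -
  have [measurable]: "Q \<in> sets lebesgue" using W_facts(4)[OF assms] .
  have "(\<integral>\<^sup>+y\<in>Q. ennreal (cmod (bad y)) \<partial>lebesgue)
    \<le> (\<integral>\<^sup>+y. ennreal (cmod (h y)) * indicator Q y + ennreal (cmod (good y)) * indicator Q y \<partial>lebesgue)"
    by (intro nn_integral_mono) (auto simp: bad_def indicator_def ennreal_plus[symmetric] norm_triangle_ineq4 simp del: ennreal_plus)
  also have "\<dots> = (\<integral>\<^sup>+y\<in>Q. ennreal (cmod (h y)) \<partial>lebesgue) + (\<integral>\<^sup>+y\<in>Q. ennreal (cmod (good y)) \<partial>lebesgue)"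
    by (rule nn_integral_add) measurable
  also have "\<dots> \<le> (\<integral>\<^sup>+y\<in>Q. ennreal (cmod (h y)) \<partial>lebesgue) + (\<integral>\<^sup>+y\<in>Q. ennreal (cmod (h y)) \<partial>lebesgue)"
    by (rule add_left_mono[OF good_W_integral[OF assms]])
  finally show ?thesis by (simp add: mult_2)
qed

lemma bad_mean_zero:
  assumes "Q \<in> W"
  shows "(LINT y:Q|lebesgue. bad y) = 0"
proof -
  have m: "Q \<in> sets lebesgue" "measure lebesgue Q \<noteq> 0" "Q \<in> lmeasurable"
    using W_facts(3,4)[OF assms] cube_side_pos[of Q] by (auto simp: measure_cube cube_lmeasurable)
  have "(LINT y:Q|lebesgue. bad y) = (LINT y:Q|lebesgue. h y - avg Q)"
    using good_eq[OF assms] m(1) by (intro set_lebesgue_integral_cong) (auto simp: bad_def)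
  also have "\<dots> = (LINT y:Q|lebesgue. h y) - (LINT y:Q|lebesgue. avg Q)"
  proof (rule set_integral_diff)
    show "set_integrable lebesgue Q h" using integrable_cut[OF h(1) m(1)] by (simp add: set_integrable_def cut_def)
    show "set_integrable lebesgue Q (\<lambda>_. avg Q)"
      using m(3) by (simp add: set_integrable_def fmeasurable_def)
  qed
  also have "(LINT y:Q|lebesgue. avg Q) = measure lebesgue Q *\<^sub>R avg Q"
    unfolding set_lebesgue_integral_def using m
    by (subst integral_scaleR_left) (auto simp: fmeasurable_def)
  also have "\<dots> = (LINT y:Q|lebesgue. h y)"
    using m(2) by (simp add: avg_def scaleR_conv_of_real)
  finally show ?thesis by simp
qed

text \<open>For \<open>x\<close> outside \<open>Estar\<close> a cell \<open>Q\<close> is small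
  compared with its distance from \<open>x\<close>: points of \<open>Q\<close> are closer to its
  corner than a quarter of the distance from the corner to \<open>x\<close>, so
  \<open>smooth2\<close> applies.\<close>

definition Estar where "Estar = (\<Union>Q\<in>W. ball (corner Q) (4 * CARD('n) * side Q))"

lemma Estar_sets [measurable]: "Estar \<in> sets lebesgue"
  unfolding Estar_def by (intro open_sets_lebesgue open_UN) auto

lemma E_subset_Estar: "E \<subseteq> Estar"
proof
  fix y assume "y \<in> E"
  then obtain Q where Q: "Q \<in> W" "y \<in> Q" using Union_W by blast
  have cQ: "cube Q" using W_facts(3)[OF Q(1)] .
  have "norm (corner Q - y) < CARD('n) * side Q" using cube_dist_less[OF cQ corner_in_cube[OF cQ] Q(2)] .
  also have "\<dots> \<le> 4 * CARD('n) * side Q" using cube_side_pos[OF cQ] by simp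
  finally show "y \<in> Estar" unfolding Estar_def using Q by (intro UN_I[of Q]) (auto simp: dist_norm)
qed

lemma emeasure_Estar: "ennreal t * emeasure lebesgue Estar \<le> ennreal (star_const * mass)"
proof -
  define w where "w = unit_ball_vol CARD('n) * (4 * CARD('n)) ^ CARD('n)"
  have "0 < unit_ball_vol CARD('n)" by (rule unit_ball_vol_pos) simp
  then have w: "0 \<le> w" by (simp add: w_def)
  have "emeasure lebesgue Estar \<le> (\<integral>\<^sup>+Q. emeasure lebesgue (ball (corner Q) (4 * CARD('n) * side Q)) \<partial>count_space W)"
    unfolding Estar_def using W_facts(1) by (intro emeasure_UN_count_space_le) auto
  also have "\<dots> = (\<integral>\<^sup>+Q. ennreal w * emeasure lebesgue Q \<partial>count_space W)"
  proof (rule nn_integral_cong)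
    fix Q assume "Q \<in> space (count_space W)"
    then have cQ: "cube Q" using W_facts(3) by simp
    then show "emeasure lebesgue (ball (corner Q) (4 * CARD('n) * side Q)) = ennreal w * emeasure lebesgue Q"
      using w cube_side_pos[OF cQ]
      by (simp add: emeasure_cube emeasure_lebesgue_ball ennreal_mult'[symmetric] w_def power_mult_distrib mult_ac)
  qed
  also have "\<dots> = ennreal w * emeasure lebesgue E" by (simp add: nn_integral_cmult emeasure_E_eq)
  finally have "ennreal t * emeasure lebesgue Estar \<le> ennreal t * (ennreal w * emeasure lebesgue E)" by (rule mult_left_mono) simp
  also have "\<dots> = ennreal w * (ennreal t * emeasure lebesgue E)" by (simp add: mult_ac)
  also have "\<dots> \<le> ennreal w * ennreal (5 ^ CARD('n) * unit_ball_vol CARD('n) * mass)"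
    by (rule mult_left_mono[OF emeasure_E]) simp
  also have "\<dots> = ennreal (star_const * mass)"
    using w by (subst ennreal_mult'[symmetric]) (simp_all add: star_const_def w_def mult_ac)
  finally show ?thesis .
qed

end

lemma norm_set_integral_nn:
  fixes F :: "'a \<Rightarrow> complex"
  shows "ennreal (cmod (LINT y:A|M. F y)) \<le> (\<integral>\<^sup>+y\<in>A. ennreal (cmod (F y)) \<partial>M)"
proof (cases "\<integral>\<^sup>+y\<in>A. ennreal (cmod (F y)) \<partial>M")
  case (real r)
  then have "cmod (LINT y:A|M. F y) \<le> r" by (intro norm_set_integral_le) auto
  then show ?thesis using real by (simp add: ennreal_leI)
qed simp

section \<open>The bad part outside the enlarged cells, and weak type (1,1)\<close>

context cz_decomposition
begin

text \<open>The bound that mean zero and smoothness yield for the contribution of one cell. It does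
  not mention the truncation radius, so it serves all truncations at once.\<close>

definition \<phi> :: "(real^'n) set \<Rightarrow> real^'n \<Rightarrow> ennreal" where
  "\<phi> Q x = ennreal (c * ((CARD('n) * side Q) powr \<delta> / norm (corner Q - x) powr (CARD('n) + \<delta>)))
     * (\<integral>\<^sup>+y\<in>Q. ennreal (cmod (bad y)) \<partial>lebesgue)"

definition \<Phi> :: "real^'n \<Rightarrow> ennreal" where "\<Phi> x = (\<integral>\<^sup>+Q. \<phi> Q x \<partial>count_space W)"

lemma \<phi>_measurable [measurable]: "\<phi> Q \<in> borel_measurable lebesgue"
proof -
  have "\<phi> Q \<in> borel_measurable lborel" unfolding \<phi>_def by measurable
  then show ?thesis by (rule measurable_completion)
qed

lemma \<Phi>_measurable [measurable]: "\<Phi> \<in> borel_measurable lebesgue"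
  unfolding \<Phi>_def by (rule nn_integral_count_space_measurable) (use W_facts in auto)

lemma not_EstarD: "x \<notin> Estar \<Longrightarrow> Q \<in> W \<Longrightarrow> 4 * CARD('n) * side Q \<le> norm (corner Q - x)"
  by (auto simp: Estar_def dist_norm not_less)

text \<open>If the truncation spares all of \<open>Q\<close>, then \<open>K x (corner Q)\<close> may
  be subtracted because \<open>bad\<close> has mean zero on \<open>Q\<close>. Otherwise
  \<open>Q\<close> has a point within \<open>s\<close> of \<open>x\<close>; as \<open>x\<close> is
  outside \<open>Estar\<close>, three diameters' worth \<open>3 * CARD('n) * side Q\<close> stays
  below \<open>s\<close>, so \<open>Q\<close> lies in \<open>ball x (2 * s)\<close> and the size of
  the kernel is enough.\<close>

lemma bad_cube_integral:
  assumes Q: "Q \<in> W" and x: "x \<notin> Estar" and s: "0 < s"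
  shows "ennreal (cmod (LINT y:Q|lebesgue. indicator {y. s < norm (x - y)} y *\<^sub>R (K x y * bad y)))
    \<le> \<phi> Q x + ennreal (c / s ^ CARD('n)) * ((\<integral>\<^sup>+y\<in>Q. ennreal (cmod (bad y)) \<partial>lebesgue) * (if Q \<subseteq> ball x (2 * s) then 1 else 0))"
proof -
  define F where "F y = indicator {y. s < norm (x - y)} y *\<^sub>R (K x y * bad y)" for y
  have cQ: "cube Q" and [measurable]: "Q \<in> sets lebesgue" using W_facts(3,4)[OF Q] .
  have cd: "norm (corner Q - y) < CARD('n) * side Q" if "y \<in> Q" for y
    by (rule cube_dist_less[OF cQ corner_in_cube[OF cQ] that])
  have far: "4 * CARD('n) * side Q \<le> norm (corner Q - x)" by (rule not_EstarD[OF x Q])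
  have n1: "0 < CARD('n) * side Q" using cube_side_pos[OF cQ] by simp
  show ?thesis
  proof (cases "Q \<subseteq> {y. s < norm (x - y)}")
    case True
    have int: "set_integrable lebesgue Q (\<lambda>y. K x y * bad y)"
      using True s by (intro kernel_integrable[OF bad_integrable, of Q s]) auto
    have int': "set_integrable lebesgue Q (\<lambda>y. K x (corner Q) * bad y)"
      using integrable_cut[OF bad_integrable, of Q] by (intro set_integrable_mult_right) (auto simp: set_integrable_def cut_def)
    have "(LINT y:Q|lebesgue. F y) = (LINT y:Q|lebesgue. K x y * bad y)"
      by (intro set_lebesgue_integral_cong) (use True in \<open>auto simp: F_def\<close>)
    also have "\<dots> = (LINT y:Q|lebesgue. K x y * bad y) - (LINT y:Q|lebesgue. K x (corner Q) * bad y)"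
      using bad_mean_zero[OF Q] by simp
    also have "\<dots> = (LINT y:Q|lebesgue. K x y * bad y - K x (corner Q) * bad y)"
      using int int' by simp
    finally have "ennreal (cmod (LINT y:Q|lebesgue. F y)) \<le> (\<integral>\<^sup>+y\<in>Q. ennreal (cmod (K x y * bad y - K x (corner Q) * bad y)) \<partial>lebesgue)"
      using norm_set_integral_nn by metis
    also have "\<dots> \<le> (\<integral>\<^sup>+y. ennreal (c * ((CARD('n) * side Q) powr \<delta> / norm (corner Q - x) powr (CARD('n) + \<delta>)))
        * (ennreal (cmod (bad y)) * indicator Q y) \<partial>lebesgue)"
    proof (rule nn_integral_mono)
      fix y
      show "ennreal (cmod (K x y * bad y - K x (corner Q) * bad y)) * indicator Q y
        \<le> ennreal (c * ((CARD('n) * side Q) powr \<delta> / norm (corner Q - x) powr (CARD('n) + \<delta>))) * (ennreal (cmod (bad y)) * indicator Q y)"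
      proof (cases "y \<in> Q")
        case True
        have "cmod (K x (corner Q) - K x y) \<le> c * (norm (corner Q - y) powr \<delta> / norm (corner Q - x) powr (CARD('n) + \<delta>))"
          using cd[OF True] far n1 by (intro smooth2) linarith
        also have "\<dots> \<le> c * ((CARD('n) * side Q) powr \<delta> / norm (corner Q - x) powr (CARD('n) + \<delta>))"
          using cd[OF True] c \<delta> by (intro mult_left_mono divide_right_mono powr_mono2) auto
        finally have le: "cmod (K x y - K x (corner Q)) \<le> c * ((CARD('n) * side Q) powr \<delta> / norm (corner Q - x) powr (CARD('n) + \<delta>))"
          by (simp add: norm_minus_commute)
        from mult_right_mono[OF this, of "cmod (bad y)"]
        have "cmod (K x y * bad y - K x (corner Q) * bad y)
            \<le> c * ((CARD('n) * side Q) powr \<delta> / norm (corner Q - x) powr (CARD('n) + \<delta>)) * cmod (bad y)"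
          by (simp add: left_diff_distrib[symmetric] norm_mult)
        then show ?thesis using True c by (auto simp: ennreal_mult'[symmetric] intro!: ennreal_leI)
      qed simp
    qed
    also have "\<dots> = \<phi> Q x" unfolding \<phi>_def by (rule nn_integral_cmult) measurable
    finally show ?thesis by (simp add: F_def add_increasing2)
  next
    case False
    then obtain z where "z \<in> Q" "\<not> s < norm (x - z)" by blast
    then have z: "z \<in> Q" "norm (x - z) \<le> s" by simp_all
    have "Q \<subseteq> ball x (2 * s)"
    proof
      fix y assume y: "y \<in> Q"
      have "norm (corner Q - x) \<le> norm (corner Q - z) + norm (x - z)"
        using norm_triangle_ineq[of "corner Q - z" "z - x"] by (simp add: norm_minus_commute)
      moreover have "norm (x - y) \<le> norm (x - z) + norm (z - y)"
        using norm_triangle_ineq[of "x - z" "z - y"] by simp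
      moreover have "norm (z - y) < CARD('n) * side Q" by (rule cube_dist_less[OF cQ z(1) y])
      ultimately have "norm (x - y) < 2 * s" using cd[OF z(1)] far z(2) n1 by linarith
      then show "y \<in> ball x (2 * s)" by (simp add: dist_norm)
    qed
    moreover have "ennreal (cmod (LINT y:Q|lebesgue. F y)) \<le> ennreal (c / s ^ CARD('n)) * (\<integral>\<^sup>+y\<in>Q. ennreal (cmod (bad y)) \<partial>lebesgue)"
    proof -
      have "ennreal (cmod (LINT y:Q|lebesgue. F y)) \<le> (\<integral>\<^sup>+y\<in>Q. ennreal (cmod (F y)) \<partial>lebesgue)" by (rule norm_set_integral_nn)
      also have "\<dots> \<le> (\<integral>\<^sup>+y. ennreal (c / s ^ CARD('n)) * (ennreal (cmod (bad y)) * indicator Q y) \<partial>lebesgue)"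
      proof (rule nn_integral_mono)
        fix y
        have "cmod (F y) \<le> c / s ^ CARD('n) * cmod (bad y)"
        proof (cases "s < norm (x - y)")
          case True
          then have "cmod (K x y) \<le> c / s ^ CARD('n)" using s by (intro size_far) auto
          from mult_right_mono[OF this, of "cmod (bad y)"] True show ?thesis by (simp add: F_def norm_mult)
        qed (use c s in \<open>simp add: F_def\<close>)
        then show "ennreal (cmod (F y)) * indicator Q y \<le> ennreal (c / s ^ CARD('n)) * (ennreal (cmod (bad y)) * indicator Q y)"
          using c s by (auto simp: indicator_def ennreal_mult'[symmetric] intro!: ennreal_leI)
      qed
      also have "\<dots> = ennreal (c / s ^ CARD('n)) * (\<integral>\<^sup>+y\<in>Q. ennreal (cmod (bad y)) \<partial>lebesgue)"
        by (rule nn_integral_cmult) measurable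
      finally show ?thesis .
    qed
    ultimately show ?thesis by (simp add: F_def add_increasing)
  qed
qed

text \<open>The second kind of cells in \<open>bad_cube_integral\<close> are disjoint subsets of
  \<open>ball x (2 * s)\<close>, so their total mass is controlled by the maximal average at
  \<open>x\<close>, a point outside \<open>E\<close>.\<close>

lemma trunc_bad:
  assumes x: "x \<notin> Estar" and s: "0 < s"
  shows "ennreal (cmod (trunc s bad x)) \<le> \<Phi> x + ennreal (2 * c * 2 ^ CARD('n) * t)"
proof -
  define F where "F y = indicator {y. s < norm (x - y)} y *\<^sub>R (K x y * bad y)" for y
  define N where "N Q = (\<integral>\<^sup>+y\<in>Q. ennreal (cmod (bad y)) \<partial>lebesgue) * (if Q \<subseteq> ball x (2 * s) then 1 else 0)" for Q
  have "set_integrable lebesgue {y. s < norm (x - y)} (\<lambda>y. K x y * bad y)"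
    using s by (intro kernel_integrable[OF bad_integrable, of _ s]) auto
  then have iF: "integrable lebesgue F" by (simp add: set_integrable_def F_def[abs_def])
  have sF: "set_integrable lebesgue (\<Union>W) F"
    unfolding set_integrable_def Union_W by (rule integrable_mult_indicator[OF E_sets iF])
  have "trunc s bad x = (LINT y:\<Union>W|lebesgue. F y)"
    unfolding trunc_def set_lebesgue_integral_def Union_W
    by (rule Bochner_Integration.integral_cong) (auto simp: F_def indicator_def bad_outside)
  then have "ennreal (cmod (trunc s bad x)) \<le> (\<integral>\<^sup>+Q. ennreal (cmod (LINT y:Q|lebesgue. F y)) \<partial>count_space W)"
    using norm_set_integral_Union_le[OF W_facts(1,2,4) sF] by simp
  also have "\<dots> \<le> (\<integral>\<^sup>+Q. \<phi> Q x + ennreal (c / s ^ CARD('n)) * N Q \<partial>count_space W)"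
    unfolding F_def N_def using x s by (intro nn_integral_mono bad_cube_integral) auto
  also have "\<dots> = \<Phi> x + ennreal (c / s ^ CARD('n)) * (\<integral>\<^sup>+Q. N Q \<partial>count_space W)"
    by (simp add: nn_integral_add nn_integral_cmult \<Phi>_def)
  also have "(\<integral>\<^sup>+Q. N Q \<partial>count_space W) \<le> (\<integral>\<^sup>+Q. 2 * (\<integral>\<^sup>+y\<in>Q. (ennreal (cmod (h y)) * indicator (ball x (2 * s)) y) \<partial>lebesgue) \<partial>count_space W)"
  proof (rule nn_integral_mono)
    fix Q assume "Q \<in> space (count_space W)"
    then have Q: "Q \<in> W" by simp
    show "N Q \<le> 2 * (\<integral>\<^sup>+y\<in>Q. (ennreal (cmod (h y)) * indicator (ball x (2 * s)) y) \<partial>lebesgue)"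
    proof (cases "Q \<subseteq> ball x (2 * s)")
      case True
      then have "(\<integral>\<^sup>+y\<in>Q. ennreal (cmod (h y)) \<partial>lebesgue) = (\<integral>\<^sup>+y\<in>Q. (ennreal (cmod (h y)) * indicator (ball x (2 * s)) y) \<partial>lebesgue)"
        by (intro nn_integral_cong) (auto simp: indicator_def)
      then show ?thesis using bad_W_nn_integral[OF Q] True by (simp add: N_def)
    qed (simp add: N_def)
  qed
  also have "\<dots> = 2 * (\<integral>\<^sup>+Q. (\<integral>\<^sup>+y\<in>Q. (ennreal (cmod (h y)) * indicator (ball x (2 * s)) y) \<partial>lebesgue) \<partial>count_space W)"
    by (rule nn_integral_cmult) simp
  also have "\<dots> = 2 * (\<integral>\<^sup>+y\<in>E. (ennreal (cmod (h y)) * indicator (ball x (2 * s)) y) \<partial>lebesgue)"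
    by (subst nn_integral_E) auto
  also have "\<dots> \<le> 2 * (\<integral>\<^sup>+y\<in>ball x (2 * s). ennreal (cmod (h y)) \<partial>lebesgue)"
    by (intro mult_left_mono nn_integral_mono) (auto simp: indicator_def)
  also have "\<dots> \<le> 2 * ennreal (t * (2 * s) ^ CARD('n))"
    using x E_subset_Estar s unfolding E_def by (intro mult_left_mono not_maximal_levelD) auto
  finally have "ennreal (cmod (trunc s bad x)) \<le> \<Phi> x + ennreal (c / s ^ CARD('n)) * (2 * ennreal (t * (2 * s) ^ CARD('n)))"
    by (simp add: add_left_mono mult_left_mono)
  also have "ennreal (c / s ^ CARD('n)) * (2 * ennreal (t * (2 * s) ^ CARD('n))) = ennreal (c / s ^ CARD('n) * (2 * (t * (2 * s) ^ CARD('n))))"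
    using c s t by (simp only: ennreal_mult' ennreal_numeral[symmetric] zero_le_numeral divide_nonneg_nonneg less_imp_le zero_le_power)
  also have "c / s ^ CARD('n) * (2 * (t * (2 * s) ^ CARD('n))) = 2 * c * 2 ^ CARD('n) * t"
    using s by (simp add: power_mult_distrib field_simps)
  finally show ?thesis .
qed

lemma nn_integral_\<Phi>: "(\<integral>\<^sup>+x\<in>- Estar. \<Phi> x \<partial>lebesgue) \<le> ennreal (bad_const * mass)"
proof -
  define d where "d = c * tail_const TYPE('n) \<delta> * unit_ball_vol CARD('n)"
  have d: "0 \<le> d" using c tail_const_pos[OF \<delta>, where 'n='n] unit_ball_vol_pos[of "CARD('n)"]
    unfolding d_def by (intro mult_nonneg_nonneg) auto
  have Ec [measurable]: "- Estar \<in> sets lebesgue" using sets.compl_sets[OF Estar_sets] by (simp add: Compl_eq_Diff_UNIV)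
  have "(\<integral>\<^sup>+x\<in>- Estar. \<Phi> x \<partial>lebesgue) = (\<integral>\<^sup>+x. (\<integral>\<^sup>+Q. \<phi> Q x * indicator (- Estar) x \<partial>count_space W) \<partial>lebesgue)"
    unfolding \<Phi>_def by (intro nn_integral_cong nn_integral_multc[symmetric]) simp
  also have "\<dots> = (\<integral>\<^sup>+Q. (\<integral>\<^sup>+x. \<phi> Q x * indicator (- Estar) x \<partial>lebesgue) \<partial>count_space W)"
    by (rule nn_integral_count_space_nn_integral[OF W_facts(1)]) measurable
  also have "\<dots> \<le> (\<integral>\<^sup>+Q. ennreal d * (2 * (\<integral>\<^sup>+y\<in>Q. ennreal (cmod (h y)) \<partial>lebesgue)) \<partial>count_space W)"
  proof (rule nn_integral_mono)
    fix Q assume "Q \<in> space (count_space W)"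
    then have Q: "Q \<in> W" by simp
    \<comment> \<open>The complement of \<open>Estar\<close> lies outside the ball of this radius
      about the corner, so \<open>tail_integral_const\<close> applies once
      \<open>CARD('n) * side Q\<close> in the numerator has been enlarged to
      \<open>r\<close>.\<close>
    define r where "r = 4 * CARD('n) * side Q"
    have r: "0 < r" using cube_side_pos[OF W_facts(3)[OF Q]] by (simp add: r_def)
    define N where "N = (\<integral>\<^sup>+y\<in>Q. ennreal (cmod (bad y)) \<partial>lebesgue)"
    have "(\<integral>\<^sup>+x. \<phi> Q x * indicator (- Estar) x \<partial>lebesgue)
      \<le> (\<integral>\<^sup>+x. ennreal c * N * (ennreal (r powr \<delta> / norm (corner Q - x) powr (CARD('n) + \<delta>)) * indicator {x. r \<le> norm (corner Q - x)} x) \<partial>lebesgue)"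
    proof (rule nn_integral_mono)
      fix x
      show "\<phi> Q x * indicator (- Estar) x
        \<le> ennreal c * N * (ennreal (r powr \<delta> / norm (corner Q - x) powr (CARD('n) + \<delta>)) * indicator {x. r \<le> norm (corner Q - x)} x)"
      proof (cases "x \<in> Estar")
        case False
        then have rx: "r \<le> norm (corner Q - x)" using not_EstarD[OF False Q] by (simp add: r_def)
        have "(CARD('n) * side Q) powr \<delta> / norm (corner Q - x) powr (CARD('n) + \<delta>) \<le> r powr \<delta> / norm (corner Q - x) powr (CARD('n) + \<delta>)"
          using cube_side_pos[OF W_facts(3)[OF Q]] \<delta> by (intro divide_right_mono powr_mono2) (auto simp: r_def)
        then have "\<phi> Q x \<le> ennreal (c * (r powr \<delta> / norm (corner Q - x) powr (CARD('n) + \<delta>))) * N"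
          unfolding \<phi>_def N_def using c by (intro mult_right_mono ennreal_leI mult_left_mono) auto
        also have "\<dots> = ennreal c * ennreal (r powr \<delta> / norm (corner Q - x) powr (CARD('n) + \<delta>)) * N"
          using c by (simp only: ennreal_mult' less_imp_le)
        finally show ?thesis using rx False by (simp add: mult_ac)
      qed simp
    qed
    also have "\<dots> = ennreal c * N * (\<integral>\<^sup>+x\<in>{x. r \<le> norm (corner Q - x)}. ennreal (r powr \<delta> / norm (corner Q - x) powr (CARD('n) + \<delta>)) \<partial>lebesgue)"
    proof (rule nn_integral_cmult)
      have "(\<lambda>x. ennreal (r powr \<delta> / norm (corner Q - x) powr (CARD('n) + \<delta>))) \<in> borel_measurable lborel" by measurable
      then have F: "(\<lambda>x. ennreal (r powr \<delta> / norm (corner Q - x) powr (CARD('n) + \<delta>))) \<in> borel_measurable lebesgue" by (rule measurable_completion)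
      show "(\<lambda>x. ennreal (r powr \<delta> / norm (corner Q - x) powr (CARD('n) + \<delta>)) * indicator {x. r \<le> norm (corner Q - x)} x) \<in> borel_measurable lebesgue"
        by (intro borel_measurable_times_ennreal borel_measurable_indicator far_sets F)
    qed
    also have "\<dots> \<le> ennreal c * N * ennreal (tail_const TYPE('n) \<delta> * unit_ball_vol CARD('n))"
      by (rule mult_left_mono[OF tail_integral_const[OF r \<delta>]]) simp
    also have "\<dots> = ennreal d * N"
      using c by (simp add: d_def ennreal_mult' mult_ac)
    also have "\<dots> \<le> ennreal d * (2 * (\<integral>\<^sup>+y\<in>Q. ennreal (cmod (h y)) \<partial>lebesgue))"
      unfolding N_def by (rule mult_left_mono[OF bad_W_nn_integral[OF Q]]) simp
    finally show "(\<integral>\<^sup>+x. \<phi> Q x * indicator (- Estar) x \<partial>lebesgue) \<le> ennreal d * (2 * (\<integral>\<^sup>+y\<in>Q. ennreal (cmod (h y)) \<partial>lebesgue))" .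
  qed
  also have "\<dots> = ennreal d * (2 * (\<integral>\<^sup>+y\<in>E. ennreal (cmod (h y)) \<partial>lebesgue))"
    by (simp add: nn_integral_cmult nn_integral_E)
  also have "\<dots> \<le> ennreal d * (2 * ennreal mass)"
    unfolding mass(2)[symmetric] by (intro mult_left_mono nn_integral_mono) (auto simp: indicator_def)
  also have "\<dots> = ennreal (d * (2 * mass))"
    using d by (simp add: ennreal_mult')
  finally show ?thesis by (simp add: bad_const_def d_def mult_ac)
qed

lemma weak_type_11: "ennreal t * emeasure lebesgue {x. ennreal (level_const * t) < maximal_truncation K h x}
  \<le> ennreal (weak_type_11_const * mass)"
proof -
  define G where "G = {x. ennreal t < maximal_truncation K good x}"
  define P where "P = {x \<in> - Estar. ennreal t < \<Phi> x}"
  have [measurable]: "G \<in> sets lebesgue" unfolding G_def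
    by (intro open_sets_lebesgue open_maximal_truncation integrable_imp_locally_integrable good_integrable)
  have Ec [measurable]: "- Estar \<in> sets lebesgue" using sets.compl_sets[OF Estar_sets] by (simp add: Compl_eq_Diff_UNIV)
  have [measurable]: "P \<in> sets lebesgue"
  proof -
    have "P = - Estar \<inter> {x \<in> space lebesgue. ennreal t < \<Phi> x}" by (auto simp: P_def)
    then show ?thesis using Ec by simp
  qed
  have sub: "{x. ennreal (level_const * t) < maximal_truncation K h x} \<subseteq> (G \<union> Estar) \<union> P"
  proof (rule ccontr)
    assume "\<not> {x. ennreal (level_const * t) < maximal_truncation K h x} \<subseteq> (G \<union> Estar) \<union> P"
    then obtain x where x: "ennreal (level_const * t) < maximal_truncation K h x" "x \<notin> G" "x \<notin> Estar" "x \<notin> P" by blast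
    have "h = (\<lambda>y. good y + bad y)" by (simp add: bad_def)
    then have "maximal_truncation K h x \<le> maximal_truncation K good x + maximal_truncation K bad x"
      using maximal_truncation_add[OF good_integrable bad_integrable, of x] by simp
    moreover have "maximal_truncation K good x \<le> ennreal t" using x(2) by (simp add: G_def not_less)
    moreover have "maximal_truncation K bad x \<le> ennreal (2 * (t + 2 * c * 2 ^ CARD('n) * t))"
    proof (rule maximal_truncation_le_trunc[OF bad_integrable])
      fix s :: real assume "0 < s"
      have "\<Phi> x \<le> ennreal t" using x by (auto simp: P_def not_less)
      with trunc_bad[OF x(3) \<open>0 < s\<close>] have "ennreal (cmod (trunc s bad x)) \<le> ennreal t + ennreal (2 * c * 2 ^ CARD('n) * t)"
        by (meson add_right_mono order_trans)
      also have "\<dots> = ennreal (t + 2 * c * 2 ^ CARD('n) * t)" using t c by (subst ennreal_plus) auto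
      finally show "cmod (trunc s bad x) \<le> t + 2 * c * 2 ^ CARD('n) * t" using t c by (subst (asm) ennreal_le_iff) auto
    qed
    ultimately have "maximal_truncation K h x \<le> ennreal t + ennreal (2 * (t + 2 * c * 2 ^ CARD('n) * t))"
      by (meson add_mono order_trans)
    also have "\<dots> = ennreal (level_const * t)"
      using t c by (subst ennreal_plus[symmetric]) (auto simp: level_const_def algebra_simps)
    finally show False using x(1) by simp
  qed
  have "emeasure lebesgue {x. ennreal (level_const * t) < maximal_truncation K h x} \<le> emeasure lebesgue ((G \<union> Estar) \<union> P)"
    by (rule emeasure_mono[OF sub]) measurable
  also have "\<dots> \<le> (emeasure lebesgue G + emeasure lebesgue Estar) + emeasure lebesgue P"
    by (rule order_trans[OF emeasure_subadditive add_right_mono[OF emeasure_subadditive]]) measurable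
  finally have "ennreal t * emeasure lebesgue {x. ennreal (level_const * t) < maximal_truncation K h x}
      \<le> ennreal t * ((emeasure lebesgue G + emeasure lebesgue Estar) + emeasure lebesgue P)" by (rule mult_left_mono) simp
  also have "\<dots> = (ennreal t * emeasure lebesgue G + ennreal t * emeasure lebesgue Estar) + ennreal t * emeasure lebesgue P"
    by (simp add: distrib_left)
  also have "\<dots> \<le> (ennreal (weak_type_22_const * good_bound * mass) + ennreal (star_const * mass)) + ennreal (bad_const * mass)"
  proof (intro add_mono)
    show "ennreal t * emeasure lebesgue G \<le> ennreal (weak_type_22_const * good_bound * mass)" unfolding G_def by (rule good_weak)
    show "ennreal t * emeasure lebesgue Estar \<le> ennreal (star_const * mass)" by (rule emeasure_Estar)
    have "ennreal t * emeasure lebesgue P \<le> (\<integral>\<^sup>+x\<in>- Estar. \<Phi> x \<partial>lebesgue)"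
      unfolding P_def by (rule emeasure_superlevel_le[OF _ _ t]) measurable
    then show "ennreal t * emeasure lebesgue P \<le> ennreal (bad_const * mass)" using nn_integral_\<Phi> by (rule order_trans)
  qed
  also have "\<dots> = ennreal (weak_type_11_const * mass)"
  proof -
    have \<omega>: "0 < unit_ball_vol CARD('n)" by (rule unit_ball_vol_pos) simp
    have "0 \<le> star_const" "0 \<le> bad_const" using \<omega> c tail_const_pos[OF \<delta>, where 'n='n]
      by (simp_all add: star_const_def bad_const_def)
    moreover have "ennreal a + ennreal b + ennreal d = ennreal (a + b + d)" if "0 \<le> a" "0 \<le> b" "0 \<le> d" for a b d
      using that by simp
    ultimately show ?thesis using mass(1) weak_type_22_const_pos good_bound_pos by (simp add: weak_type_11_const_def distrib_right)
  qed
  finally show ?thesis .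
qed

end

text \<open>Outside the locale of the decomposition the constants can be fixed before
  \<open>h\<close> and \<open>t\<close>.\<close>

lemma (in cz_operator) weak_type_11_exists:
  obtains M A where "0 < M" "0 < A" "\<And>h t. integrable lebesgue h \<Longrightarrow> bounded {y. h y \<noteq> 0} \<Longrightarrow> 0 < t \<Longrightarrow>
    ennreal t * emeasure lebesgue {x. ennreal (M * t) < maximal_truncation K h x}
      \<le> ennreal (A * (LINT y|lebesgue. cmod (h y)))"
proof
  show "0 < level_const" using c by (simp add: level_const_def add_pos_nonneg)
  show "0 < max 1 weak_type_11_const" by simp
  fix h :: "real^'n \<Rightarrow> complex" and t :: real
  assume h: "integrable lebesgue h" "bounded {y. h y \<noteq> 0}" "0 < t"
  interpret cz_decomposition T K c \<delta> B h t using h by unfold_locales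
  have "weak_type_11_const * mass \<le> max 1 weak_type_11_const * mass" using mass(1) by (intro mult_right_mono) auto
  then show "ennreal t * emeasure lebesgue {x. ennreal (level_const * t) < maximal_truncation K h x}
      \<le> ennreal (max 1 weak_type_11_const * (LINT y|lebesgue. cmod (h y)))"
    unfolding mass_def[symmetric] using weak_type_11 ennreal_leI order_trans by blast
qed

section \<open>Stopping cubes\<close>

definition triple_avg :: "(real^'n \<Rightarrow> complex) \<Rightarrow> (real^'n) set \<Rightarrow> real" where
  "triple_avg f Q = (LINT y|lebesgue. cmod (cut (tripled Q) f y)) / (3 * side Q) ^ CARD('n)"

lemma triple_avg_nonneg: "cube Q \<Longrightarrow> 0 \<le> triple_avg f Q"
  by (simp add: triple_avg_def cube_side_pos less_imp_le)

lemma cube_bounded: "cube (Q :: (real^'n) set) \<Longrightarrow> bounded Q"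
proof -
  assume "cube Q"
  then have "Q \<subseteq> ball (corner Q) (CARD('n) * side Q)"
    using cube_dist_less[OF _ corner_in_cube] by (auto simp: dist_norm)
  then show ?thesis by (rule bounded_subset[OF bounded_ball])
qed

lemma locally_integrable_cut_cube:
  fixes f :: "real^'n \<Rightarrow> complex"
  assumes "locally_integrable f" "cube Q"
  shows "integrable lebesgue (cut Q f)" "bounded {y. cut Q f y \<noteq> 0}"
proof -
  have "set_integrable lebesgue (closure Q) f"
    using assms cube_bounded[OF assms(2)] by (simp add: locally_integrable_def)
  then have "set_integrable lebesgue Q f"
    by (rule set_integrable_subset) (use assms(2) closure_subset in auto)
  then show "integrable lebesgue (cut Q f)" by (simp add: set_integrable_def cut_def)
  show "bounded {y. cut Q f y \<noteq> 0}"
    by (rule bounded_subset[OF cube_bounded[OF assms(2)]]) (auto simp: cut_def indicator_def split: if_splits)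
qed

context cz_operator
begin

text \<open>For radii from \<open>r\<close> on, removing \<open>tripled P\<close> changes nothing,
  and \<open>trunc_compare\<close> carries the bound from \<open>x'\<close> to \<open>x\<close>. A
  smaller radius adds only points at distance between \<open>side P\<close> and \<open>r\<close>
  from \<open>x\<close>, where the size of the kernel and the maximal average at \<open>x'\<close>
  suffice.\<close>

lemma cell_parent_compare:
  fixes P :: "(real^'n) set"
  assumes h: "integrable lebesgue h" and P: "cube P" and R: "cube R" "P \<subseteq> R" "side R = 2 * side P"
    and x: "x \<in> P" and x': "x' \<in> R" "x' \<notin> maximal_level (\<lambda>y. ennreal (cmod (h y))) t"
      "maximal_truncation K h x' \<le> ennreal t" and t: "0 \<le> t"
  shows "maximal_truncation K (cut (- tripled P) h) x
    \<le> ennreal (2 * ((1 + compare_const + c * (10 * CARD('n)) ^ CARD('n)) * t))"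
proof -
  \<comment> \<open>Large enough for both demands: more than twice the distance from
    \<open>x\<close> to \<open>x'\<close>, which is below \<open>2 * CARD('n) * side P\<close>, and
    at least \<open>3 * CARD('n) * side P\<close>, which covers \<open>tripled P\<close>.\<close>
  define r where "r = 5 * CARD('n) * side P"
  have sP: "0 < side P" by (rule cube_side_pos[OF P])
  have r: "0 < r" using sP by (simp add: r_def)
  have [measurable]: "tripled P \<in> sets lebesgue" using cube_tripled[OF P] by simp
  then have T': "- tripled P \<in> sets lebesgue" using sets.compl_sets[of "tripled P" lebesgue] by (simp add: Compl_eq_Diff_UNIV)
  have "norm (x - x') < CARD('n) * side R" using x R x' by (intro cube_dist_less) auto
  then have "norm (x - x') < 2 * (CARD('n) * side P)" by (simp add: R(3) mult_ac)
  moreover have "r = 5 * (CARD('n) * side P)" "0 < CARD('n) * side P" using sP by (simp_all add: r_def)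
  ultimately have xx': "norm (x - x') < r / 2" by linarith
  have near: "norm (x - y) < r" if "y \<in> tripled P" for y
  proof -
    have "norm (x - y) < 3 * CARD('n) * side P" by (rule tripled_dist_less[OF P x that])
    also have "\<dots> \<le> r" using sP by (simp add: r_def)
    finally show ?thesis .
  qed
  have h': "integrable lebesgue (cut (- tripled P) h)" by (rule integrable_cut[OF h T'])
  have big: "cmod (trunc s (cut (- tripled P) h) x) \<le> (1 + compare_const) * t" if s: "r \<le> s" for s
  proof -
    have "trunc s (cut (- tripled P) h) x = trunc s h x"
      unfolding trunc_def set_lebesgue_integral_def
      by (rule Bochner_Integration.integral_cong) (use near s in \<open>force simp: cut_def indicator_def\<close>)+
    moreover have "cmod (trunc s h x - trunc s h x') \<le> compare_const * t"
      by (rule trunc_compare[OF x'(2) t h]) (use xx' s in simp)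
    moreover have "cmod (trunc s h x') \<le> t"
    proof -
      have "ennreal (cmod (trunc s h x')) \<le> ennreal t"
        using trunc_le_maximal_truncation[OF h, of s x'] x'(3) r s by (meson less_le_trans order_trans)
      then show ?thesis using t by (subst (asm) ennreal_le_iff) auto
    qed
    moreover have "cmod (trunc s h x) \<le> cmod (trunc s h x - trunc s h x') + cmod (trunc s h x')"
      using norm_triangle_ineq[of "trunc s h x - trunc s h x'" "trunc s h x'"] by simp
    ultimately show ?thesis by (simp add: distrib_right)
  qed
  show ?thesis
  proof (rule maximal_truncation_le_trunc[OF h'])
    fix s :: real assume s: "0 < s"
    have c0: "0 \<le> c * (10 * CARD('n)) ^ CARD('n) * t" using c t by simp
    show "cmod (trunc s (cut (- tripled P) h) x) \<le> (1 + compare_const + c * (10 * CARD('n)) ^ CARD('n)) * t"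
    proof (cases "r \<le> s")
      case True
      then show ?thesis using big[OF True] c0 by (simp add: distrib_right)
    next
      case False
      define D where "D = {y. s < norm (x - y)} - {y. r < norm (x - y)}"
      have D [measurable]: "D \<in> sets lebesgue" unfolding D_def by (intro sets.Diff far_sets)
      have "trunc s (cut (- tripled P) h) x = trunc r (cut (- tripled P) h) x + (LINT y:D|lebesgue. K x y * cut (- tripled P) h y)"
        unfolding trunc_def D_def using False s
        by (intro set_integral_split kernel_integrable[OF h', of _ s] far_sets) auto
      moreover have "(LINT y:D|lebesgue. K x y * cut (- tripled P) h y) = (LINT y:D - tripled P|lebesgue. K x y * h y)"
        unfolding set_lebesgue_integral_def
        by (rule Bochner_Integration.integral_cong) (auto simp: cut_def indicator_def)
      moreover have "cmod (LINT y:D - tripled P|lebesgue. K x y * h y) \<le> c * (2 * r / side P) ^ CARD('n) * t"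
      proof (rule kernel_integral_ball_bound[OF x'(2) t])
        show "D - tripled P \<subseteq> {y. side P \<le> norm (x - y)}" using not_tripled_dist_ge[OF P x] by auto
        show "D - tripled P \<subseteq> ball x' (2 * r)"
        proof
          fix y assume "y \<in> D - tripled P"
          then have "norm (x - y) \<le> r" by (simp add: D_def)
          then show "y \<in> ball x' (2 * r)"
            using xx' r norm_triangle_ineq[of "x' - x" "x - y"] by (simp add: dist_norm norm_minus_commute)
        qed
      qed (use sP r h in auto)
      moreover have "2 * r / side P = 10 * CARD('n)" using sP by (simp add: r_def)
      moreover have "cmod (trunc r (cut (- tripled P) h) x) \<le> (1 + compare_const) * t" by (rule big) simp
      ultimately show ?thesis
        using norm_triangle_ineq[of "trunc r (cut (- tripled P) h) x" "LINT y:D|lebesgue. K x y * cut (- tripled P) h y"]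
        by (simp add: distrib_right)
    qed
  qed
qed

text \<open>The degenerate case of average 0, where the weak type estimates, stated for positive
  heights, give nothing: both sets in \<open>exceptional\<close> are then empty.\<close>

lemma maximal_truncation_zero:
  assumes "(LINT y|lebesgue. cmod (h y)) = 0" "integrable lebesgue h"
  shows "maximal_truncation K h x = 0" "x \<notin> maximal_level (\<lambda>y. ennreal (cmod (h y))) 0"
proof -
  have ae: "AE y in lebesgue. h y = 0"
    using assms integral_nonneg_eq_0_iff_AE[of lebesgue "\<lambda>y. cmod (h y)"] by auto
  have "(LINT y:A|lebesgue. K x y * h y) = 0" for A
    unfolding set_lebesgue_integral_def by (rule integral_eq_zero_AE) (use ae in eventually_elim, simp)
  then show "maximal_truncation K h x = 0"
    by (intro le_zero_eq[THEN iffD1] maximal_truncation_leI) simp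
  have "(\<integral>\<^sup>+y\<in>A. ennreal (cmod (h y)) \<partial>lebesgue) = (\<integral>\<^sup>+y. 0 \<partial>(lebesgue :: (real^'n) measure))" for A
    by (rule nn_integral_cong_AE) (use ae in eventually_elim, simp)
  then show "x \<notin> maximal_level (\<lambda>y. ennreal (cmod (h y))) 0" by (simp add: maximal_level_def)
qed

definition exceptional :: "real \<Rightarrow> (real^'n \<Rightarrow> complex) \<Rightarrow> (real^'n) set \<Rightarrow> (real^'n) set" where
  "exceptional L f Q = {x. ennreal (L * triple_avg f Q) < maximal_truncation K (cut (tripled Q) f) x}
     \<union> maximal_level (\<lambda>y. ennreal (cmod (cut (tripled Q) f y))) (L * triple_avg f Q)"

lemma open_exceptional:
  assumes "locally_integrable f" "cube Q"
  shows "open (exceptional L f Q)"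
  unfolding exceptional_def using locally_integrable_cut_cube[OF assms(1) cube_tripled[OF assms(2)]]
  by (intro open_Un open_maximal_level open_maximal_truncation integrable_imp_locally_integrable)

lemma exceptional_exists:
  obtains L where "0 < L" "\<And>f Q. locally_integrable f \<Longrightarrow> cube Q \<Longrightarrow>
    measure lebesgue (exceptional L f Q \<inter> Q) \<le> 1/2 * measure lebesgue Q"
proof -
  obtain M A where MA: "0 < M" "0 < A" "\<And>h t. integrable lebesgue h \<Longrightarrow> bounded {y. h y \<noteq> 0} \<Longrightarrow> 0 < t \<Longrightarrow>
    ennreal t * emeasure lebesgue {x. ennreal (M * t) < maximal_truncation K h x}
      \<le> ennreal (A * (LINT y|lebesgue. cmod (h y)))"
    by (rule weak_type_11_exists) blast
  define w where "w = 5 ^ CARD('n) * unit_ball_vol CARD('n)"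
  have w: "0 < w" unfolding w_def by (intro mult_pos_pos unit_ball_vol_pos) auto
  \<comment> \<open>The two weak type bounds give measure at most
    \<open>(A * M + w) * m / l\<close>, and \<open>l * (3 * side Q) ^ CARD('n) = L * m\<close>; this
    \<open>L\<close> makes the quotient half the volume of \<open>Q\<close>.\<close>
  define L where "L = 2 * 3 ^ CARD('n) * (A * M + w)"
  have L: "0 < L" using MA w by (simp add: L_def add_pos_pos)
  have "measure lebesgue (exceptional L f Q \<inter> Q) \<le> 1/2 * measure lebesgue Q" if f: "locally_integrable f" and Q: "cube Q" for f Q
  proof -
    define h where "h = cut (tripled Q) f"
    have h: "integrable lebesgue h" "bounded {y. h y \<noteq> 0}"
      using locally_integrable_cut_cube[OF f cube_tripled[OF Q]] by (auto simp: h_def)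
    define m where "m = (LINT y|lebesgue. cmod (h y))"
    have m: "0 \<le> m" "(\<integral>\<^sup>+y. ennreal (cmod (h y)) \<partial>lebesgue) = ennreal m"
      using h(1) by (auto simp: m_def nn_integral_eq_integral)
    define l where "l = L * triple_avg f Q"
    have sQ: "0 < side Q" by (rule cube_side_pos[OF Q])
    have lm: "l * (3 * side Q) ^ CARD('n) = L * m" using sQ by (simp add: l_def triple_avg_def m_def h_def)
    define G where "G = {x. ennreal l < maximal_truncation K h x}"
    define H where "H = maximal_level (\<lambda>y. ennreal (cmod (h y))) l"
    have ex: "exceptional L f Q = G \<union> H" by (simp add: exceptional_def G_def H_def h_def l_def)
    show ?thesis
    proof (cases "m = 0")
      case True
      then have "l = 0" using lm sQ by simp
      then have "G \<union> H = {}" using maximal_truncation_zero[of h] True h by (auto simp: G_def H_def m_def)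
      then show ?thesis by (simp add: ex)
    next
      case False
      then have "0 < l * (3 * side Q) ^ CARD('n)" unfolding lm using L m(1) by simp
      moreover have "0 < (3 * side Q) ^ CARD('n)" using sQ by simp
      ultimately have l: "0 < l" by (rule zero_less_mult_pos2)
      have "open G" "open H" unfolding G_def H_def
        by (intro open_maximal_level open_maximal_truncation integrable_imp_locally_integrable h(1))+
      then have sets: "G \<in> sets lebesgue" "H \<in> sets lebesgue" by (simp_all add: open_sets_lebesgue)
      have "ennreal (l / M) * emeasure lebesgue G \<le> ennreal (A * m)"
        using MA(3)[OF h, of "l / M"] l MA(1) by (simp add: G_def m_def)
      then have "ennreal M * (ennreal (l / M) * emeasure lebesgue G) \<le> ennreal M * ennreal (A * m)" by (rule mult_left_mono) simp
      moreover have "ennreal M * ennreal (l / M) = ennreal l" using MA(1) by (subst ennreal_mult'[symmetric]) auto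
      moreover have "ennreal M * ennreal (A * m) = ennreal (A * M * m)"
        using MA(1) by (subst ennreal_mult'[symmetric]) (auto simp: mult_ac)
      ultimately have gG: "ennreal l * emeasure lebesgue G \<le> ennreal (A * M * m)"
        by (simp only: mult.assoc[symmetric])
      have gH: "ennreal l * emeasure lebesgue H \<le> ennreal (w * m)"
        using emeasure_maximal_level[of "\<lambda>y. ennreal (cmod (h y))" l] l h w m by (simp add: H_def w_def ennreal_mult')
      have "ennreal l * emeasure lebesgue (G \<union> H) \<le> ennreal l * (emeasure lebesgue G + emeasure lebesgue H)"
        using sets by (intro mult_left_mono emeasure_subadditive) auto
      also have "\<dots> \<le> ennreal (A * M * m) + ennreal (w * m)" unfolding distrib_left by (rule add_mono[OF gG gH])
      also have "\<dots> = ennreal (l * (side Q ^ CARD('n) / 2))"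
      proof -
        have "l * 3 ^ CARD('n) * side Q ^ CARD('n) = 2 * 3 ^ CARD('n) * (A * M + w) * m"
          using lm by (simp add: power_mult_distrib L_def mult_ac)
        then have "3 ^ CARD('n) * (l * side Q ^ CARD('n)) = 3 ^ CARD('n) * (2 * (A * M * m + w * m))"
          by (simp add: algebra_simps)
        then have e: "l * (side Q ^ CARD('n) / 2) = A * M * m + w * m" by simp
        show ?thesis unfolding e using MA(1,2) w m(1) by (subst ennreal_plus) auto
      qed
      finally have *: "ennreal l * emeasure lebesgue (G \<union> H) \<le> ennreal (l * (side Q ^ CARD('n) / 2))" .
      have fin: "emeasure lebesgue (G \<union> H) \<noteq> \<infinity>"
      proof
        assume "emeasure lebesgue (G \<union> H) = \<infinity>"
        then have "ennreal l * emeasure lebesgue (G \<union> H) = \<infinity>" using l by (simp add: ennreal_mult_eq_top_iff)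
        then show False using * by (simp add: top_unique)
      qed
      then have "emeasure lebesgue (G \<union> H) = ennreal (measure lebesgue (G \<union> H))" by (simp add: emeasure_eq_ennreal_measure)
      then have "ennreal (l * measure lebesgue (G \<union> H)) \<le> ennreal (l * (side Q ^ CARD('n) / 2))"
        using * l by (simp add: ennreal_mult')
      then have "l * measure lebesgue (G \<union> H) \<le> l * (side Q ^ CARD('n) / 2)" using l sQ by (subst (asm) ennreal_le_iff) auto
      then have "measure lebesgue (G \<union> H) \<le> side Q ^ CARD('n) / 2" using l by simp
      moreover have "measure lebesgue ((G \<union> H) \<inter> Q) \<le> measure lebesgue (G \<union> H)"
        using sets fin Q by (intro measure_mono_fmeasurable fmeasurableI) (auto simp: less_top)
      ultimately show ?thesis by (simp add: ex measure_cube[OF Q])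
    qed
  qed
  with L show ?thesis by (rule that)
qed

end

section \<open>Iteration below a fixed cell\<close>

locale stopping = cz_operator T K c \<delta> B
  for T :: "(real^'n \<Rightarrow> complex) \<Rightarrow> real^'n \<Rightarrow> complex" and K c \<delta> B +
  fixes L :: real and f :: "real^'n \<Rightarrow> complex" and A :: "'n set" and Q0 :: "(real^'n) set"
  assumes L: "0 < L" and half: "cube Q \<Longrightarrow> measure lebesgue (exceptional L f Q \<inter> Q) \<le> 1/2 * measure lebesgue Q"
    and f: "locally_integrable f" and Q0: "Q0 \<in> shifted_grid A"
begin

definition children :: "(real^'n) set \<Rightarrow> (real^'n) set set" where
  "children Q = maximal_cells A (exceptional L f Q \<inter> Q)"

fun stop :: "nat \<Rightarrow> (real^'n) set set" where
  "stop 0 = {Q0}"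
| "stop (Suc k) = (\<Union>Q\<in>stop k. children Q)"

lemma children_grid: "P \<in> children Q \<Longrightarrow> P \<in> shifted_grid A"
  using maximal_cells_grid by (auto simp: children_def)

lemma stop_grid: "Q \<in> stop k \<Longrightarrow> Q \<in> shifted_grid A"
  by (cases k) (auto simp: Q0 children_grid)

lemma stop_cube: "Q \<in> stop k \<Longrightarrow> cube Q"
  using stop_grid cube_grid by blast

lemma children_subset: "P \<in> children Q \<Longrightarrow> P \<subseteq> exceptional L f Q \<inter> Q"
  by (auto simp: children_def maximal_cells_def)

lemma exceptional_Int_sets: "cube Q \<Longrightarrow> exceptional L f Q \<inter> Q \<in> sets lebesgue"
  using open_sets_lebesgue[OF open_exceptional[OF f]] by (intro sets.Int) auto

lemma Union_children:
  assumes "Q \<in> shifted_grid A"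
  shows "\<Union>(children Q) = exceptional L f Q \<inter> Q"
  unfolding children_def
proof (rule Union_maximal_cells)
  have cQ: "cube Q" by (rule cube_grid[OF assms])
  show "exceptional L f Q \<inter> Q \<in> sets lebesgue" by (rule exceptional_Int_sets[OF cQ])
  have "emeasure lebesgue (exceptional L f Q \<inter> Q) \<le> emeasure lebesgue Q" using cQ by (intro emeasure_mono) auto
  then show "emeasure lebesgue (exceptional L f Q \<inter> Q) < \<infinity>" by (simp add: emeasure_cube[OF cQ] order_le_less_trans)
  fix x assume x: "x \<in> exceptional L f Q \<inter> Q"
  obtain k where k: "\<forall>l\<le>k. cell A l x \<subseteq> exceptional L f Q"
    using small_cell[OF open_exceptional[OF f cQ], of x] x by blast
  from x have "x \<in> Q" by simp
  then obtain q where q: "Q = cell A q x" by (rule gridE[OF assms])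
  \<comment> \<open>The exceptional set is open but \<open>Q\<close> is only half-open, so
    \<open>Q\<close> is respected by not exceeding its own level \<open>q\<close>.\<close>
  have "cell A (min k q) x \<subseteq> exceptional L f Q \<inter> Q" using k cell_mono[of "min k q" q A x] q by auto
  then show "\<exists>k. cell A k x \<subseteq> exceptional L f Q \<inter> Q" by blast
qed

text \<open>A child is not \<open>Q\<close> itself, since it lies in a set filling at most half of
  \<open>Q\<close>. Hence its parent is still inside \<open>Q\<close>, and leaving the trace of the
  exceptional set on \<open>Q\<close> means leaving the exceptional set itself.\<close>

lemma children_parent:
  assumes "Q \<in> shifted_grid A" "P \<in> children Q"
  obtains R x' where "cube R" "P \<subseteq> R" "side R = 2 * side P" "x' \<in> R" "x' \<notin> exceptional L f Q"
proof -
  have cQ: "cube Q" and P: "P \<in> shifted_grid A" using assms children_grid cube_grid by blast+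
  obtain R where R: "R \<in> shifted_grid A" "P \<subseteq> R" "side R = 2 * side P" "\<not> R \<subseteq> exceptional L f Q \<inter> Q"
    using assms(2) unfolding children_def by (rule maximal_cells_parent)
  have "P \<noteq> Q"
  proof
    assume "P = Q"
    then have "exceptional L f Q \<inter> Q = Q" using children_subset[OF assms(2)] by blast
    then have "measure lebesgue Q \<le> 1/2 * measure lebesgue Q" using half[OF cQ] by simp
    then show False using cube_side_pos[OF cQ] by (simp add: measure_cube[OF cQ])
  qed
  then have "2 * side P \<le> side Q" using children_subset[OF assms(2)] P assms(1) by (intro grid_psubset_side[of P A Q]) auto
  moreover have "R \<inter> Q \<noteq> {}" using children_subset[OF assms(2)] R(2) corner_in_cube[OF cube_grid[OF P]] by blast
  ultimately have "R \<subseteq> Q" using R assms(1) by (intro grid_nested[of R A Q]) auto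
  with R(4) obtain x' where "x' \<in> R" "x' \<notin> exceptional L f Q" by blast
  then show ?thesis using that R cube_grid by blast
qed

text \<open>The constant of \<open>cell_parent_compare\<close> at height
  \<open>L * triple_avg f Q\<close>.\<close>

definition step_const :: real where
  "step_const = 2 * (1 + compare_const + c * (10 * CARD('n)) ^ CARD('n)) * L"

lemma step_const: "L \<le> step_const"
proof -
  have "0 \<le> compare_const" using c tail_const_pos[OF \<delta>, where 'n='n] by (simp add: compare_const_def)
  then have "1 \<le> 2 * (1 + compare_const + c * (10 * CARD('n)) ^ CARD('n))" using c by (simp add: add_nonneg_nonneg distrib_left)
  then show ?thesis using L mult_right_mono[of 1 _ L] by (simp add: step_const_def)
qed

text \<open>As \<open>tripled P\<close> lies in \<open>tripled Q\<close>, the function cut to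
  \<open>tripled Q\<close> is its part off \<open>tripled P\<close>, estimated through the good
  point in the parent of \<open>P\<close>, plus the function cut to
  \<open>tripled P\<close>.\<close>

lemma children_compare:
  assumes Q: "Q \<in> shifted_grid A" and P: "P \<in> children Q" and x: "x \<in> P"
  shows "maximal_truncation K (cut (tripled Q) f) x
    \<le> ennreal (step_const * triple_avg f Q) + maximal_truncation K (cut (tripled P) f) x"
proof -
  have cQ: "cube Q" and cP: "cube P" using Q P children_grid cube_grid by blast+
  define h where "h = cut (tripled Q) f"
  have h: "integrable lebesgue h" unfolding h_def by (rule locally_integrable_cut_cube[OF f cube_tripled[OF cQ]])
  obtain R x' where R: "cube R" "P \<subseteq> R" "side R = 2 * side P" "x' \<in> R" "x' \<notin> exceptional L f Q"
    by (rule children_parent[OF Q P])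
  have sub: "tripled P \<subseteq> tripled Q" using children_subset[OF P] by (intro tripled_mono cP cQ) auto
  have t: "0 \<le> L * triple_avg f Q" using L triple_avg_nonneg[OF cQ] by simp
  have far: "maximal_truncation K (cut (- tripled P) h) x
    \<le> ennreal (2 * ((1 + compare_const + c * (10 * CARD('n)) ^ CARD('n)) * (L * triple_avg f Q)))"
    using R(5) by (intro cell_parent_compare[OF h cP R(1,2,3) x R(4) _ _ t]) (auto simp: exceptional_def h_def not_less)
  have split: "h = (\<lambda>y. cut (- tripled P) h y + cut (tripled P) f y)"
    using sub by (auto simp: h_def cut_def indicator_def fun_eq_iff)
  have "tripled P \<in> sets lebesgue" using cube_tripled[OF cP] by simp
  then have "- tripled P \<in> sets lebesgue" using sets.compl_sets[of "tripled P" lebesgue] by (simp add: Compl_eq_Diff_UNIV)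
  from maximal_truncation_add[OF integrable_cut[OF h this] locally_integrable_cut_cube(1)[OF f cube_tripled[OF cP]], of x]
  have "maximal_truncation K h x \<le> maximal_truncation K (cut (- tripled P) h) x + maximal_truncation K (cut (tripled P) f) x"
    unfolding split[symmetric] .
  also have "\<dots> \<le> ennreal (2 * ((1 + compare_const + c * (10 * CARD('n)) ^ CARD('n)) * (L * triple_avg f Q)))
      + maximal_truncation K (cut (tripled P) f) x" by (rule add_right_mono[OF far])
  finally show ?thesis unfolding h_def step_const_def by (simp only: mult.assoc)
qed

lemma disjoint_stop: "disjoint (stop k)"
proof (induction k)
  case (Suc k)
  show ?case
  proof (rule disjointI)
    fix P P' assume "P \<in> stop (Suc k)" "P' \<in> stop (Suc k)" "P \<noteq> P'"
    then obtain Q Q' where Q: "Q \<in> stop k" "P \<in> children Q" "Q' \<in> stop k" "P' \<in> children Q'" by auto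
    show "P \<inter> P' = {}"
    proof (cases "Q = Q'")
      case True
      then show ?thesis using Q \<open>P \<noteq> P'\<close> disjoint_maximal_cells unfolding children_def disjoint_def by blast
    next
      case False
      then have "Q \<inter> Q' = {}" using Suc Q by (auto simp: disjoint_def)
      then show ?thesis using children_subset Q by blast
    qed
  qed
qed simp

lemma stop_Suc_Int:
  assumes "Q \<in> stop k"
  shows "\<Union>(stop (Suc k)) \<inter> Q = exceptional L f Q \<inter> Q"
proof -
  have "\<Union>(stop (Suc k)) \<inter> Q = \<Union>(children Q)"
  proof
    show "\<Union>(stop (Suc k)) \<inter> Q \<subseteq> \<Union>(children Q)"
    proof
      fix y assume "y \<in> \<Union>(stop (Suc k)) \<inter> Q"
      then obtain Q' P where Q': "Q' \<in> stop k" "P \<in> children Q'" "y \<in> P" "y \<in> Q" by auto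
      then have "y \<in> Q'" using children_subset by blast
      then have "Q' = Q" using Q' assms disjoint_stop[of k] by (auto simp: disjoint_def)
      then show "y \<in> \<Union>(children Q)" using Q' by blast
    qed
    show "\<Union>(children Q) \<subseteq> \<Union>(stop (Suc k)) \<inter> Q" using assms children_subset by fastforce
  qed
  then show ?thesis using Union_children[OF stop_grid[OF assms]] by simp
qed

lemma sparse_stop: "sparse_family (shifted_grid A) stop"
  unfolding sparse_family_def
proof (intro conjI allI ballI)
  show "stop k \<subseteq> shifted_grid A" for k using stop_grid by blast
  show "disjoint (stop k)" for k by (rule disjoint_stop)
  show "\<Union>(stop (Suc k)) \<subseteq> \<Union>(stop k)" for k using children_subset by fastforce
  show "measure lebesgue (\<Union>(stop (Suc k)) \<inter> Q) \<le> 1/2 * measure lebesgue Q" if "Q \<in> stop k" for k Q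
    using half[OF stop_cube[OF that]] stop_Suc_Int[OF that] by simp
qed

text \<open>By disjointness the supremum runs over at most one cube. It avoids choosing that cube
  and is 0 if there is none.\<close>

definition level_avg :: "nat \<Rightarrow> real^'n \<Rightarrow> ennreal" where
  "level_avg k x = (SUP Q\<in>{Q\<in>stop k. x \<in> Q}. ennreal (triple_avg f Q))"

lemma level_avg_ge: "Q \<in> stop k \<Longrightarrow> x \<in> Q \<Longrightarrow> ennreal (triple_avg f Q) \<le> level_avg k x"
  unfolding level_avg_def by (rule SUP_upper) simp

lemma stop_pointwise:
  "Q \<in> stop k \<Longrightarrow> x \<in> Q \<Longrightarrow> maximal_truncation K (cut (tripled Q0) f) x
    \<le> ennreal step_const * (\<Sum>j<k. level_avg j x) + maximal_truncation K (cut (tripled Q) f) x"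
proof (induction k arbitrary: Q)
  case (Suc k)
  then obtain Q' where Q': "Q' \<in> stop k" "Q \<in> children Q'" by auto
  have sc: "0 \<le> step_const" using step_const L by simp
  have x: "x \<in> Q'" using children_subset[OF Q'(2)] Suc.prems by blast
  have "maximal_truncation K (cut (tripled Q') f) x \<le> ennreal (step_const * triple_avg f Q') + maximal_truncation K (cut (tripled Q) f) x"
    by (rule children_compare[OF stop_grid[OF Q'(1)] Q'(2) Suc.prems(2)])
  also have "ennreal (step_const * triple_avg f Q') = ennreal step_const * ennreal (triple_avg f Q')" using sc by (rule ennreal_mult')
  also have "\<dots> + maximal_truncation K (cut (tripled Q) f) x \<le> ennreal step_const * level_avg k x + maximal_truncation K (cut (tripled Q) f) x"
    by (intro add_right_mono mult_left_mono level_avg_ge Q' x) simp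
  finally have "ennreal step_const * (\<Sum>j<k. level_avg j x) + maximal_truncation K (cut (tripled Q') f) x
    \<le> ennreal step_const * (\<Sum>j<k. level_avg j x) + (ennreal step_const * level_avg k x + maximal_truncation K (cut (tripled Q) f) x)"
    by (rule add_left_mono)
  with Suc.IH[OF Q'(1) x] show ?case by (simp add: distrib_left add.assoc order_trans)
qed simp

text \<open>At the last level that covers \<open>x\<close>, the point is outside the exceptional set
  of its cube, so the remaining truncation is bounded directly; \<open>L \<le> step_const\<close>
  absorbs it as one more term of the sum.\<close>

lemma stop_pointwise_final:
  assumes "x \<in> Q0" "x \<notin> \<Union>(stop m)"
  shows "\<exists>k. maximal_truncation K (cut (tripled Q0) f) x \<le> ennreal step_const * (\<Sum>j<k. level_avg j x)"
proof -
  have "\<exists>k. x \<in> \<Union>(stop k) \<and> x \<notin> \<Union>(stop (Suc k))"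
    using assms by (induction m) auto
  then obtain k Q where Q: "Q \<in> stop k" "x \<in> Q" "x \<notin> \<Union>(stop (Suc k))" by blast
  have sc: "0 \<le> step_const" using step_const L by simp
  have "x \<notin> exceptional L f Q" using stop_Suc_Int[OF Q(1)] Q by blast
  then have "maximal_truncation K (cut (tripled Q) f) x \<le> ennreal (L * triple_avg f Q)" by (auto simp: exceptional_def not_less)
  also have "\<dots> \<le> ennreal (step_const * triple_avg f Q)"
    using step_const triple_avg_nonneg[OF stop_cube[OF Q(1)]] by (intro ennreal_leI mult_right_mono) auto
  also have "\<dots> = ennreal step_const * ennreal (triple_avg f Q)" using sc by (rule ennreal_mult')
  also have "\<dots> \<le> ennreal step_const * level_avg k x" by (intro mult_left_mono level_avg_ge Q) simp
  finally have "ennreal step_const * (\<Sum>j<k. level_avg j x) + maximal_truncation K (cut (tripled Q) f) x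
    \<le> ennreal step_const * (\<Sum>j<Suc k. level_avg j x)" by (simp add: distrib_left add_left_mono)
  with stop_pointwise[OF Q(1,2)] show ?thesis by (meson order_trans)
qed

lemma countable_stop: "countable (stop k)"
  by (rule countable_subset[OF _ countable_grid[of A]]) (use stop_grid in blast)

lemma Union_stop_sets: "\<Union>(stop k) \<in> sets lebesgue"
  using countable_stop stop_cube by (intro sets.countable_Union) auto

lemma emeasure_Union_stop: "emeasure lebesgue (\<Union>(stop k)) = (\<integral>\<^sup>+Q. emeasure lebesgue Q \<partial>count_space (stop k))"
  using emeasure_UN_countable[of "stop k" "\<lambda>Q. Q" lebesgue] countable_stop stop_cube disjoint_stop[of k]
  by (simp add: disjoint_family_on_def disjoint_def)

lemma emeasure_stop: "emeasure lebesgue (\<Union>(stop k)) \<le> ennreal ((1/2) ^ k) * emeasure lebesgue Q0"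
proof (induction k)
  case (Suc k)
  have "\<Union>(stop (Suc k)) = (\<Union>Q\<in>stop k. \<Union>(stop (Suc k)) \<inter> Q)" using children_subset by fastforce
  then have "emeasure lebesgue (\<Union>(stop (Suc k))) \<le> (\<integral>\<^sup>+Q. emeasure lebesgue (\<Union>(stop (Suc k)) \<inter> Q) \<partial>count_space (stop k))"
    using emeasure_UN_count_space_le[of "stop k" "\<lambda>Q. \<Union>(stop (Suc k)) \<inter> Q" lebesgue] countable_stop Union_stop_sets stop_cube
    by (metis cube_lebesgue sets.Int)
  also have "\<dots> \<le> (\<integral>\<^sup>+Q. ennreal (1/2) * emeasure lebesgue Q \<partial>count_space (stop k))"
  proof (rule nn_integral_mono)
    fix Q assume "Q \<in> space (count_space (stop k))"
    then have Q: "Q \<in> stop k" by simp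
    have cQ: "cube Q" by (rule stop_cube[OF Q])
    have "exceptional L f Q \<inter> Q \<in> lmeasurable"
      by (rule fmeasurableI2[OF cube_lmeasurable[OF cQ]]) (use exceptional_Int_sets[OF cQ] in auto)
    then have "emeasure lebesgue (exceptional L f Q \<inter> Q) = ennreal (measure lebesgue (exceptional L f Q \<inter> Q))"
      by (rule emeasure_eq_measure2)
    also have "\<dots> \<le> ennreal (1/2 * measure lebesgue Q)" by (rule ennreal_leI[OF half[OF cQ]])
    also have "\<dots> = ennreal (1/2) * emeasure lebesgue Q"
      by (subst ennreal_mult') (simp_all add: emeasure_eq_measure2[OF cube_lmeasurable[OF cQ]])
    finally show "emeasure lebesgue (\<Union>(stop (Suc k)) \<inter> Q) \<le> ennreal (1/2) * emeasure lebesgue Q" by (simp only: stop_Suc_Int[OF Q])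
  qed
  also have "\<dots> = ennreal (1/2) * emeasure lebesgue (\<Union>(stop k))" by (simp add: nn_integral_cmult emeasure_Union_stop)
  also have "\<dots> \<le> ennreal (1/2) * (ennreal ((1/2) ^ k) * emeasure lebesgue Q0)" by (rule mult_left_mono[OF Suc]) simp
  also have "\<dots> = ennreal ((1/2) ^ Suc k) * emeasure lebesgue Q0"
    by (simp only: mult.assoc[symmetric] power_Suc ennreal_mult'[of "1/2", symmetric] zero_le_divide_1_iff zero_le_numeral)
  finally show ?case .
qed simp

lemma AE_not_all_stop: "AE x in lebesgue. \<exists>m. x \<notin> \<Union>(stop m)"
proof (rule AE_I')
  define N where "N = (\<Inter>m. \<Union>(stop m))"
  have N: "N \<in> sets lebesgue" unfolding N_def using Union_stop_sets by (intro sets.countable_INT') auto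
  have cQ: "cube Q0" by (rule cube_grid[OF Q0])
  have "(\<lambda>k. ennreal ((1/2) ^ k * side Q0 ^ CARD('n))) \<longlonglongrightarrow> ennreal (0 * side Q0 ^ CARD('n))"
    by (intro tendsto_intros LIMSEQ_power_zero) simp
  moreover have "emeasure lebesgue N \<le> ennreal ((1/2) ^ k * side Q0 ^ CARD('n))" for k
  proof -
    have "emeasure lebesgue N \<le> emeasure lebesgue (\<Union>(stop k))"
      by (rule emeasure_mono[OF _ Union_stop_sets]) (auto simp: N_def)
    also have "\<dots> \<le> ennreal ((1/2) ^ k) * emeasure lebesgue Q0" by (rule emeasure_stop)
    finally show ?thesis by (simp add: emeasure_cube[OF cQ] ennreal_mult')
  qed
  ultimately have "emeasure lebesgue N \<le> ennreal (0 * side Q0 ^ CARD('n))" by (intro LIMSEQ_le_const) auto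
  then have "N \<in> null_sets lebesgue" using N by auto
  then show "(\<Inter>m. \<Union>(stop m)) \<in> null_sets lebesgue" by (simp add: N_def)
qed auto

end

section \<open>Carleson packing in the shifted grids\<close>

text \<open>The sum over an unordered index set is a supremum of finite partial sums. There are
  countably many of them, which yields measurability below.\<close>

lemma sparse_operator_eq_SUP:
  "sparse_operator S g x = (SUP Y\<in>{Y. finite Y \<and> Y \<subseteq> Sigma UNIV S}. \<Sum>(k, Q)\<in>Y. average Q g * indicator Q x)"
  unfolding sparse_operator_def by (rule nonneg_infsum_complete) simp

lemma sum_le_sparse_operator:
  "finite Y \<Longrightarrow> Y \<subseteq> Sigma UNIV S \<Longrightarrow> (\<Sum>(k, Q)\<in>Y. average Q g * indicator Q x) \<le> sparse_operator S g x"
  unfolding sparse_operator_eq_SUP by (rule SUP_upper) simp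

lemma sparse_operator_measurable:
  fixes S :: "nat \<Rightarrow> (real^'n) set set"
  assumes "\<And>k. S k \<subseteq> shifted_grid A"
  shows "sparse_operator S g \<in> borel_measurable lebesgue"
proof -
  have "countable (S k)" for k using countable_grid assms by (rule countable_subset[rotated])
  then have "countable (Sigma UNIV S)" by (intro countable_SIGMA) auto
  then have "countable {Y. finite Y \<and> Y \<subseteq> Sigma UNIV S}" by (rule countable_Collect_finite_subset)
  moreover have "(\<lambda>x. \<Sum>(k, Q)\<in>Y. average Q g * indicator Q x) \<in> borel_measurable lebesgue"
    if "Y \<in> {Y. finite Y \<and> Y \<subseteq> Sigma UNIV S}" for Y
  proof (intro borel_measurable_sum)
    fix p assume "p \<in> Y"
    then have "snd p \<in> sets lebesgue" using that assms cube_grid by (force intro: cube_lebesgue)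
    then show "(\<lambda>x. case p of (k, Q) \<Rightarrow> average Q g * indicator Q x) \<in> borel_measurable lebesgue"
      by (cases p) simp
  qed
  ultimately have "(\<lambda>x. SUP Y\<in>{Y. finite Y \<and> Y \<subseteq> Sigma UNIV S}. \<Sum>(k, Q)\<in>Y. average Q g * indicator Q x) \<in> borel_measurable lebesgue"
    by (intro borel_measurable_SUP) auto
  then show ?thesis by (simp add: sparse_operator_eq_SUP[abs_def])
qed

section \<open>Lifting a sparse family below one top cube to the shifted grids\<close>

locale sparse_lift =
  fixes B :: "'n::finite set" and S :: "nat \<Rightarrow> (real^'n) set set" and Q0 :: "(real^'n) set"
  assumes sparse: "sparse_family (shifted_grid B) S" and S0: "S 0 = {Q0}"
begin

lemma S_grid: "Q \<in> S k \<Longrightarrow> Q \<in> shifted_grid B"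
  using sparse by (auto simp: sparse_family_def)

lemma S_cube: "Q \<in> S k \<Longrightarrow> cube Q"
  using S_grid cube_grid by blast

lemma disjoint_S: "disjoint (S k)"
  using sparse unfolding sparse_family_def by (elim conjE allE)

lemma S_disjoint: "Q \<in> S k \<Longrightarrow> Q' \<in> S k \<Longrightarrow> Q \<inter> Q' \<noteq> {} \<Longrightarrow> Q = Q'"
  using disjointD[OF disjoint_S, of Q k Q'] by argo

lemma Union_S_antimono: "k \<le> l \<Longrightarrow> \<Union>(S l) \<subseteq> \<Union>(S k)"
  by (rule lift_Suc_antimono_le[of "\<lambda>k. \<Union>(S k)"])
    (use sparse in \<open>unfold sparse_family_def, elim conjE allE\<close>)

lemma S_half: "Q \<in> S k \<Longrightarrow> measure lebesgue (\<Union>(S (Suc k)) \<inter> Q) \<le> 1/2 * measure lebesgue Q"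
  using sparse unfolding sparse_family_def by (elim conjE) (erule allE, erule bspec)

lemma S_side_le: "Q \<in> S k \<Longrightarrow> side Q \<le> side Q0"
proof -
  assume Q: "Q \<in> S k"
  then have "Q \<subseteq> Q0" using Union_S_antimono[of 0 k] by (auto simp: S0)
  then show ?thesis using S_cube[OF Q] S_cube[of Q0 0] by (intro cube_subset_side) (auto simp: S0)
qed

lemma Union_S_sets: "\<Union>(S k) \<in> sets lebesgue"
proof (rule sets.countable_Union)
  show "countable (S k)" by (rule countable_subset[OF _ countable_grid[of B]]) (use S_grid in blast)
qed (use S_cube in auto)

text \<open>The major subset of a sparse cube: cores are pairwise disjoint across all levels and
  fill at least half of their cubes.\<close>

definition core :: "nat \<Rightarrow> (real^'n) set \<Rightarrow> (real^'n) set" where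
  "core k Q = Q - \<Union>(S (Suc k))"

lemma core_sets: "Q \<in> S k \<Longrightarrow> core k Q \<in> sets lebesgue"
  unfolding core_def using S_cube Union_S_sets by auto

lemma emeasure_core:
  assumes "Q \<in> S k"
  shows "emeasure lebesgue Q \<le> 2 * emeasure lebesgue (core k Q)"
proof -
  have Q: "Q \<in> lmeasurable" using S_cube[OF assms] by (rule cube_lmeasurable)
  have I: "\<Union>(S (Suc k)) \<inter> Q \<in> lmeasurable"
    by (rule fmeasurableI2[OF Q]) (use Union_S_sets Q in auto)
  have C: "core k Q \<in> lmeasurable"
    by (rule fmeasurableI2[OF Q]) (use core_sets[OF assms] in \<open>auto simp: core_def\<close>)
  have "core k Q = Q - (\<Union>(S (Suc k)) \<inter> Q)" by (auto simp: core_def)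
  then have "measure lebesgue (core k Q) = measure lebesgue Q - measure lebesgue (\<Union>(S (Suc k)) \<inter> Q)"
    using Q I by (simp add: measurable_measure_Diff)
  then have "measure lebesgue Q \<le> 2 * measure lebesgue (core k Q)" using S_half[OF assms] by simp
  then have "ennreal (measure lebesgue Q) \<le> ennreal (2 * measure lebesgue (core k Q))" by (rule ennreal_leI)
  then show ?thesis by (simp add: emeasure_eq_measure2[OF Q] emeasure_eq_measure2[OF C] ennreal_mult')
qed

lemma core_nonempty: "Q \<in> S k \<Longrightarrow> core k Q \<noteq> {}"
proof
  assume Q: "Q \<in> S k" and "core k Q = {}"
  then have "emeasure lebesgue Q = 0" using emeasure_core[OF Q] by simp
  then show False using cube_side_pos[OF S_cube[OF Q]] by (simp add: emeasure_cube[OF S_cube[OF Q]])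
qed

lemma core_disjoint:
  assumes "Q \<in> S k" "Q' \<in> S k'" "core k Q \<inter> core k' Q' \<noteq> {}"
  shows "k = k' \<and> Q = Q'"
proof -
  obtain y where y: "y \<in> core k Q" "y \<in> core k' Q'" using assms by blast
  have "\<not> i < j" if "y \<in> core i P" "P' \<in> S j" "y \<in> core j P'" for i j P P'
  proof
    assume "i < j"
    then have "\<Union>(S j) \<subseteq> \<Union>(S (Suc i))" by (intro Union_S_antimono) simp
    moreover have "y \<in> \<Union>(S j)" using that(2,3) by (auto simp: core_def)
    ultimately show False using that(1) by (auto simp: core_def)
  qed
  then have "k = k'" using y assms(1,2) by (meson linorder_neqE_nat)
  then show ?thesis using y assms S_disjoint[of Q k Q'] by (auto simp: core_def)
qed

lemma S_level_unique: "Q \<in> S k \<Longrightarrow> Q \<in> S k' \<Longrightarrow> k = k'"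
proof -
  have "\<not> k < k'" if "Q \<in> S k" "Q \<in> S k'" for k k'
  proof
    assume "k < k'"
    then have "Q \<subseteq> \<Union>(S (Suc k))" using Union_S_antimono[of "Suc k" k'] that by auto
    then show False using core_nonempty[OF that(1)] by (auto simp: core_def)
  qed
  then show "Q \<in> S k \<Longrightarrow> Q \<in> S k' \<Longrightarrow> k = k'" by (meson linorder_neqE_nat)
qed

text \<open>A set rather than a family indexed by stopping cubes: one cell may serve many of them.
  At a fixed point nothing is lost by this, as the injectivity in \<open>sum_levels_le\<close>
  shows.\<close>

definition lifts :: "'n set \<Rightarrow> (real^'n) set set" where
  "lifts A = {R \<in> shifted_grid A. \<exists>k. \<exists>Q\<in>S k. tripled Q \<subseteq> R \<and> side R = 16 * side Q}"

definition ancestors :: "'n set \<Rightarrow> (real^'n) set \<Rightarrow> (real^'n) set set" where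
  "ancestors A R = {R' \<in> lifts A. R \<subset> R'}"

definition depth :: "'n set \<Rightarrow> (real^'n) set \<Rightarrow> nat" where
  "depth A R = card (ancestors A R)"

lemma lifts_grid: "R \<in> lifts A \<Longrightarrow> R \<in> shifted_grid A"
  by (simp add: lifts_def)

lemma lifts_cube: "R \<in> lifts A \<Longrightarrow> cube R"
  using lifts_grid cube_grid by blast

text \<open>Ancestors are cells about a common point, one for each level at most, and the single top
  cube caps their side at \<open>16 * side Q0\<close>.\<close>

lemma finite_ancestors:
  assumes R: "R \<in> shifted_grid A"
  shows "finite (ancestors A R)"
proof -
  obtain q z where q: "R = cell A q z" using R by (auto simp: shifted_grid_def)
  have "Q0 \<in> shifted_grid B" using S_grid[of Q0 0] by (simp add: S0)
  then obtain k0 z0 where k0: "Q0 = cell B k0 z0" by (auto simp: shifted_grid_def)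
  have "ancestors A R \<subseteq> (\<lambda>l. cell A l z) ` {q..k0 + 4}"
  proof
    fix R' assume "R' \<in> ancestors A R"
    then have R': "R' \<in> lifts A" "R \<subset> R'" by (auto simp: ancestors_def)
    have "z \<in> R'" using R'(2) q mem_cell_self by blast
    then obtain l where l: "R' = cell A l z" by (rule gridE[OF lifts_grid[OF R'(1)]])
    have "side R \<le> side R'" using R' R by (intro cube_subset_side cube_grid lifts_cube) auto
    then have "q \<le> l" by (simp add: q l powi_le_iff)
    moreover have "side R' \<le> 16 * side Q0"
      using R'(1) S_side_le by (auto simp: lifts_def)
    then have "(2::real) powi l \<le> 2 powi (k0 + 4)" by (simp add: l k0 power_int_add)
    then have "l \<le> k0 + 4" by (simp only: powi_le_iff)
    ultimately show "R' \<in> (\<lambda>l. cell A l z) ` {q..k0 + 4}" using l by auto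
  qed
  then show ?thesis by (rule finite_subset) simp
qed

lemma lifts_nested:
  assumes "R \<in> lifts A" "R' \<in> lifts A" "R \<inter> R' \<noteq> {}"
  shows "R \<subset> R' \<or> R' \<subset> R \<or> R = R'"
  using assms grid_cases[OF lifts_grid[OF assms(1)] lifts_grid[OF assms(2)]] by blast

lemma depth_less:
  assumes "R \<in> lifts A" "R' \<in> lifts A" "R \<subset> R'"
  shows "depth A R' < depth A R"
  unfolding depth_def using assms
  by (intro psubset_card_mono finite_ancestors lifts_grid) (auto simp: ancestors_def)

lemma depth_disjoint:
  assumes "R \<in> lifts A" "R' \<in> lifts A" "depth A R = depth A R'" "R \<inter> R' \<noteq> {}"
  shows "R = R'"
  using lifts_nested[OF assms(1,2,4)] depth_less[OF assms(1,2)] depth_less[OF assms(2,1)] assms(3) by auto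

lemma depth_Suc:
  assumes R: "R \<in> lifts A" "depth A R = Suc m"
  shows "\<exists>R'\<in>lifts A. R \<subset> R' \<and> depth A R' = m"
proof -
  have fin: "finite (ancestors A R)" by (rule finite_ancestors[OF lifts_grid[OF R(1)]])
  have "ancestors A R \<noteq> {}" using R(2) by (auto simp: depth_def)
  \<comment> \<open>The ancestors form a chain, so one of least side is contained in all others and
    is the immediate predecessor.\<close>
  with fin obtain s where s: "s \<in> side ` ancestors A R" "\<not> (\<exists>u\<in>side ` ancestors A R. u < s)"
    using ex_min_if_finite[of "side ` ancestors A R"] by auto
  then obtain R' where R': "R' \<in> ancestors A R" "side R' = s" by auto
  have R'l: "R' \<in> lifts A" "R \<subset> R'" using R'(1) by (auto simp: ancestors_def)
  have "ancestors A R = insert R' (ancestors A R')"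
  proof
    show "ancestors A R \<subseteq> insert R' (ancestors A R')"
    proof
      fix R'' assume R'': "R'' \<in> ancestors A R"
      then have l: "R'' \<in> lifts A" "R \<subset> R''" by (auto simp: ancestors_def)
      have "R' \<inter> R'' \<noteq> {}" using l R'l corner_in_cube[OF lifts_cube[OF R(1)]] by blast
      then have "R' \<subseteq> R''" using R'(2) s(2) R''
        by (intro grid_nested[OF lifts_grid[OF R'l(1)] lifts_grid[OF l(1)]]) (auto simp: not_less)
      then show "R'' \<in> insert R' (ancestors A R')" using l by (auto simp: ancestors_def)
    qed
    show "insert R' (ancestors A R') \<subseteq> ancestors A R" using R'l by (auto simp: ancestors_def)
  qed
  then have "depth A R = Suc (depth A R')"
    unfolding depth_def using finite_ancestors[OF lifts_grid[OF R'l(1)]] by (simp add: ancestors_def)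
  then show ?thesis using R'l R(2) by auto
qed

lemma depth_ancestor:
  "R \<in> lifts A \<Longrightarrow> m \<le> depth A R \<Longrightarrow> \<exists>R'\<in>lifts A. R \<subseteq> R' \<and> depth A R' = m"
proof (induction "depth A R - m" arbitrary: R)
  case (Suc d)
  then have "depth A R = Suc (depth A R - 1)" by simp
  then obtain R1 where R1: "R1 \<in> lifts A" "R \<subset> R1" "depth A R1 = depth A R - 1" using depth_Suc[OF Suc.prems(1)] by blast
  have "d = depth A R1 - m" "m \<le> depth A R1" using Suc.hyps(2) R1(3) by linarith+
  from Suc.hyps(1)[OF this(1) R1(1) this(2)] R1(2) show ?case by blast
qed auto

lemma countable_lifts: "countable (lifts A)"
  by (rule countable_subset[OF _ countable_grid[of A]]) (use lifts_grid in blast)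

text \<open>Carleson packing: the cores of the cubes inducing different elements of \<open>lifts A\<close> are disjoint.\<close>

lemma carleson:
  assumes R: "cube R"
  shows "(\<integral>\<^sup>+R'. emeasure lebesgue R' \<partial>count_space {R' \<in> lifts A. R' \<subseteq> R}) \<le> ennreal (2 * 16 ^ CARD('n)) * emeasure lebesgue R"
proof -
  define W where "W = {R' \<in> lifts A. R' \<subseteq> R}"
  have cW: "countable W" unfolding W_def by (rule countable_subset[OF _ countable_lifts]) auto
  have "\<exists>p. snd p \<in> S (fst p) \<and> tripled (snd p) \<subseteq> R' \<and> side R' = 16 * side (snd p)" if "R' \<in> lifts A" for R'
    using that by (auto simp: lifts_def)
  then obtain p where p: "\<And>R'. R' \<in> lifts A \<Longrightarrow> snd (p R') \<in> S (fst (p R'))"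
    "\<And>R'. R' \<in> lifts A \<Longrightarrow> tripled (snd (p R')) \<subseteq> R'"
    "\<And>R'. R' \<in> lifts A \<Longrightarrow> side R' = 16 * side (snd (p R'))" by metis
  define D where "D R' = core (fst (p R')) (snd (p R'))" for R'
  have sub: "D R' \<subseteq> R'" if "R' \<in> lifts A" for R'
    using p(2)[OF that] subset_tripled[OF S_cube[OF p(1)[OF that]]] by (auto simp: D_def core_def)
  have disj: "disjoint_family_on D W"
    unfolding disjoint_family_on_def
  proof (intro ballI impI)
    fix R1 R2 assume R12: "R1 \<in> W" "R2 \<in> W" "R1 \<noteq> R2"
    then have l: "R1 \<in> lifts A" "R2 \<in> lifts A" by (auto simp: W_def)
    show "D R1 \<inter> D R2 = {}"
    proof (rule ccontr)
      \<comment> \<open>Cores that meet belong to the same stopping cube, so the two cells have the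
        same side, 16 times that of the cube. Cells of one grid with equal sides that meet are
        equal.\<close>
      assume ne: "D R1 \<inter> D R2 \<noteq> {}"
      then have "snd (p R1) = snd (p R2)"
        using core_disjoint[OF p(1)[OF l(1)] p(1)[OF l(2)]] unfolding D_def by blast
      then have "side R1 = side R2" using p(3) l by metis
      moreover have "R1 \<inter> R2 \<noteq> {}" using ne sub l by blast
      ultimately show False using R12(3) grid_eqI[OF lifts_grid[OF l(1)] lifts_grid[OF l(2)]] by blast
    qed
  qed
  have sD: "D R' \<in> sets lebesgue" if "R' \<in> W" for R'
    unfolding D_def by (rule core_sets) (use that p(1) in \<open>auto simp: W_def\<close>)
  have "(\<integral>\<^sup>+R'. emeasure lebesgue R' \<partial>count_space W) \<le> (\<integral>\<^sup>+R'. ennreal (2 * 16 ^ CARD('n)) * emeasure lebesgue (D R') \<partial>count_space W)"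
  proof (rule nn_integral_mono)
    fix R' assume "R' \<in> space (count_space W)"
    then have l: "R' \<in> lifts A" by (simp add: W_def)
    define Q where "Q = snd (p R')"
    have Q: "Q \<in> S (fst (p R'))" "side R' = 16 * side Q" using p[OF l] by (auto simp: Q_def)
    have "emeasure lebesgue R' = ennreal (16 ^ CARD('n)) * emeasure lebesgue Q"
      using Q(2) cube_side_pos[OF S_cube[OF Q(1)]]
      by (simp only: emeasure_cube[OF lifts_cube[OF l]] emeasure_cube[OF S_cube[OF Q(1)]] power_mult_distrib)
         (simp add: ennreal_mult')
    also have "\<dots> \<le> ennreal (16 ^ CARD('n)) * (2 * emeasure lebesgue (D R'))"
      using emeasure_core[OF Q(1)] by (intro mult_left_mono) (auto simp: D_def Q_def)
    also have "\<dots> = ennreal (2 * 16 ^ CARD('n)) * emeasure lebesgue (D R')"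
      by (simp add: ennreal_mult' mult_ac)
    finally show "emeasure lebesgue R' \<le> ennreal (2 * 16 ^ CARD('n)) * emeasure lebesgue (D R')" .
  qed
  also have "\<dots> = ennreal (2 * 16 ^ CARD('n)) * emeasure lebesgue (\<Union>(D ` W))"
    by (subst nn_integral_cmult) (simp_all add: emeasure_UN_countable[OF sD cW disj])
  also have "\<dots> \<le> ennreal (2 * 16 ^ CARD('n)) * emeasure lebesgue R"
    using sub R by (intro mult_left_mono emeasure_mono) (auto simp: W_def)
  finally show ?thesis by (simp add: W_def)
qed

definition layer :: "'n set \<Rightarrow> nat \<Rightarrow> (real^'n) set set" where
  "layer A i = {R \<in> lifts A. depth A R = i}"

lemma Union_layer_sets: "\<Union>(layer A i) \<in> sets lebesgue"
proof (rule sets.countable_Union)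
  show "countable (layer A i)" by (rule countable_subset[OF _ countable_lifts[of A]]) (auto simp: layer_def)
qed (use lifts_cube in \<open>auto simp: layer_def\<close>)

text \<open>Every point of \<open>R\<close> that is covered \<open>m\<close> generations further down lies in \<open>m\<close> lifted cubes inside \<open>R\<close>.\<close>

lemma deep_layer_measure:
  assumes R: "R \<in> lifts A" and m: "0 < m"
  shows "of_nat m * emeasure lebesgue (\<Union>(layer A (depth A R + m)) \<inter> R) \<le> ennreal (2 * 16 ^ CARD('n)) * emeasure lebesgue R"
proof -
  define W where "W = {R' \<in> lifts A. R' \<subseteq> R}"
  define V where "V = \<Union>(layer A (depth A R + m)) \<inter> R"
  have cW: "countable W" unfolding W_def by (rule countable_subset[OF _ countable_lifts]) auto
  have V: "V \<in> sets lebesgue" unfolding V_def using Union_layer_sets lifts_cube[OF R] by auto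
  have point: "of_nat m * indicator V y \<le> (\<integral>\<^sup>+R'. indicator R' y \<partial>count_space W)" for y :: "real^'n"
  proof (cases "y \<in> V")
    case True
    then obtain P where P: "P \<in> lifts A" "depth A P = depth A R + m" "y \<in> P" "y \<in> R" by (auto simp: V_def layer_def)
    have "P \<subset> R"
      using lifts_nested[OF P(1) R] depth_less[OF R P(1)] P m by auto
    \<comment> \<open>The cells of the chain from \<open>P\<close>, included, up to
      \<open>R\<close>, excluded. There are \<open>depth A P - depth A R - 1\<close> cells strictly
      between and one more for \<open>P\<close>, which makes \<open>m\<close>.\<close>
    define X where "X = insert P (ancestors A P - insert R (ancestors A R))"
    have fP: "finite (ancestors A P)" and fR: "finite (ancestors A R)"
      using finite_ancestors lifts_grid P(1) R by blast+
    have sub: "insert R (ancestors A R) \<subseteq> ancestors A P" using \<open>P \<subset> R\<close> R by (auto simp: ancestors_def)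
    have "card (insert R (ancestors A R)) = Suc (depth A R)" using fR by (simp add: depth_def ancestors_def)
    then have "card (ancestors A P - insert R (ancestors A R)) = depth A P - Suc (depth A R)"
      using fR sub by (subst card_Diff_subset) (auto simp: depth_def)
    moreover have "P \<notin> ancestors A P" by (simp add: ancestors_def)
    ultimately have "card X = m" using fP P(2) m by (simp add: X_def)
    have XW: "X \<subseteq> W" and yX: "\<And>R'. R' \<in> X \<Longrightarrow> y \<in> R'"
    proof -
      show "y \<in> R'" if "R' \<in> X" for R' using that P(3) by (auto simp: X_def ancestors_def)
      show "X \<subseteq> W"
      proof
        fix R' assume X: "R' \<in> X"
        show "R' \<in> W"
        proof (cases "R' = P")
          case True then show ?thesis using P \<open>P \<subset> R\<close> by (auto simp: W_def)
        next
          case False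
          then have R': "R' \<in> lifts A" "P \<subset> R'" "R' \<noteq> R" "\<not> R \<subset> R'" using X by (auto simp: X_def ancestors_def)
          have "R' \<inter> R \<noteq> {}" using R'(2) P(3,4) by blast
          then show ?thesis using lifts_nested[OF R'(1) R] R' by (auto simp: W_def)
        qed
      qed
    qed
    have "finite X" using fP by (simp add: X_def)
    have "of_nat m = (\<Sum>R'\<in>X. indicator R' y :: ennreal)" using \<open>card X = m\<close> yX by simp
    also have "\<dots> = (\<integral>\<^sup>+R'. indicator R' y \<partial>count_space X)"
      using \<open>finite X\<close> by (simp add: nn_integral_count_space_finite)
    also have "\<dots> = (\<integral>\<^sup>+R'. indicator R' y * indicator X R' \<partial>count_space W)"
      using XW by (subst nn_integral_count_space_indicator[of X]) (auto simp: nn_integral_count_space_indicator intro!: nn_integral_cong split: split_indicator)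
    also have "\<dots> \<le> (\<integral>\<^sup>+R'. indicator R' y \<partial>count_space W)"
      by (intro nn_integral_mono) (auto simp: indicator_def)
    finally show ?thesis using True by simp
  qed simp
  have "of_nat m * emeasure lebesgue V = (\<integral>\<^sup>+y. of_nat m * indicator V y \<partial>lebesgue)"
    using V by (simp add: nn_integral_cmult_indicator)
  also have "\<dots> \<le> (\<integral>\<^sup>+y. (\<integral>\<^sup>+R'. indicator R' y \<partial>count_space W) \<partial>lebesgue)" by (rule nn_integral_mono[OF point])
  also have "\<dots> = (\<integral>\<^sup>+R'. (\<integral>\<^sup>+y. indicator R' y \<partial>lebesgue) \<partial>count_space W)"
    by (intro nn_integral_count_space_nn_integral[OF cW] borel_measurable_indicator)
      (auto simp: W_def intro: cube_lebesgue lifts_cube)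
  also have "\<dots> = (\<integral>\<^sup>+R'. emeasure lebesgue R' \<partial>count_space W)"
    by (intro nn_integral_cong nn_integral_indicator) (auto simp: W_def intro: cube_lebesgue lifts_cube)
  also have "\<dots> \<le> ennreal (2 * 16 ^ CARD('n)) * emeasure lebesgue R"
    unfolding W_def by (rule carleson[OF lifts_cube[OF R]])
  finally show ?thesis by (simp add: V_def)
qed

text \<open>Twice the Carleson constant \<open>2 * 16 ^ CARD('n)\<close>, so that
  \<open>deep_layer_measure\<close> leaves at most half of each cell covered after
  \<open>step\<close> generations.\<close>

definition step :: nat where "step = 4 * 16 ^ CARD('n)"

text \<open>For each residue \<open>r\<close> of the depth modulo \<open>step\<close> one family;
  together they exhaust \<open>lifts A\<close>.\<close>

definition thinned :: "'n set \<Rightarrow> nat \<Rightarrow> nat \<Rightarrow> (real^'n) set set" where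
  "thinned A r k = layer A (k * step + r)"

lemma sparse_thinned: "sparse_family (shifted_grid A) (thinned A r)"
  unfolding sparse_family_def
proof (intro conjI allI ballI)
  show "thinned A r k \<subseteq> shifted_grid A" for k using lifts_grid by (auto simp: thinned_def layer_def)
  show "disjoint (thinned A r k)" for k
  proof (rule disjointI, rule ccontr)
    fix R R' assume "R \<in> thinned A r k" "R' \<in> thinned A r k" "R \<noteq> R'" "R \<inter> R' \<noteq> {}"
    then show False using depth_disjoint[of R A R'] by (simp add: thinned_def layer_def)
  qed
  show "\<Union>(thinned A r (Suc k)) \<subseteq> \<Union>(thinned A r k)" for k
  proof
    fix y assume "y \<in> \<Union>(thinned A r (Suc k))"
    then obtain R where R: "R \<in> lifts A" "depth A R = Suc k * step + r" "y \<in> R" by (auto simp: thinned_def layer_def)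
    then obtain R' where "R' \<in> lifts A" "R \<subseteq> R'" "depth A R' = k * step + r" using depth_ancestor[OF R(1), of "k * step + r"] by auto
    then show "y \<in> \<Union>(thinned A r k)" using R(3) by (auto simp: thinned_def layer_def)
  qed
  fix k R assume "R \<in> thinned A r k"
  then have R: "R \<in> lifts A" "depth A R = k * step + r" by (auto simp: thinned_def layer_def)
  define V where "V = \<Union>(thinned A r (Suc k)) \<inter> R"
  have V: "V = \<Union>(layer A (depth A R + step)) \<inter> R" by (simp add: V_def thinned_def R(2) add_ac)
  have "0 < step" by (simp add: step_def)
  from deep_layer_measure[OF R(1) this]
  have le: "of_nat step * emeasure lebesgue V \<le> ennreal (2 * 16 ^ CARD('n)) * emeasure lebesgue R" by (simp add: V)
  have Rm: "R \<in> lmeasurable" by (rule cube_lmeasurable[OF lifts_cube[OF R(1)]])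
  have Vm: "V \<in> lmeasurable" by (rule fmeasurableI2[OF Rm]) (use Union_layer_sets Rm in \<open>auto simp: V\<close>)
  have "ennreal (real step * measure lebesgue V) \<le> ennreal (2 * 16 ^ CARD('n) * measure lebesgue R)"
    using le by (simp add: emeasure_eq_measure2[OF Rm] emeasure_eq_measure2[OF Vm] ennreal_mult' ennreal_of_nat_eq_real_of_nat)
  then have "real step * measure lebesgue V \<le> 2 * 16 ^ CARD('n) * measure lebesgue R" by (subst (asm) ennreal_le_iff) auto
  then have "16 ^ CARD('n) * (4 * measure lebesgue V) \<le> 16 ^ CARD('n) * (2 * measure lebesgue R)" by (simp add: step_def mult_ac)
  then have "4 * measure lebesgue V \<le> 2 * measure lebesgue R" by (subst (asm) mult_le_cancel_left_pos) auto
  then show "measure lebesgue (\<Union>(thinned A r (Suc k)) \<inter> R) \<le> 1/2 * measure lebesgue R" by (simp add: V_def)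
qed

lemma sum_lifts_le:
  assumes X: "finite X" "X \<subseteq> lifts A"
  shows "(\<Sum>R\<in>X. average R g * indicator R x) \<le> (\<Sum>r<step. sparse_operator (thinned A r) g x)"
proof -
  have "(\<Sum>R\<in>X. average R g * indicator R x)
    = (\<Sum>r<step. \<Sum>R\<in>{R\<in>X. depth A R mod step = r}. average R g * indicator R x)"
    using X(1) by (intro sum.group[symmetric]) (auto simp: step_def)
  also have "\<dots> \<le> (\<Sum>r<step. sparse_operator (thinned A r) g x)"
  proof (rule sum_mono)
    fix r
    let ?X = "{R\<in>X. depth A R mod step = r}"
    have inj: "inj_on (\<lambda>R. (depth A R div step, R)) ?X" by (auto simp: inj_on_def)
    have "(\<Sum>R\<in>?X. average R g * indicator R x) = (\<Sum>(k, R)\<in>(\<lambda>R. (depth A R div step, R)) ` ?X. average R g * indicator R x)"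
      by (subst sum.reindex[OF inj]) simp
    also have "\<dots> \<le> sparse_operator (thinned A r) g x"
      using X by (intro sum_le_sparse_operator) (auto simp: thinned_def layer_def)
    finally show "(\<Sum>R\<in>?X. average R g * indicator R x) \<le> sparse_operator (thinned A r) g x" .
  qed
  finally show ?thesis .
qed

text \<open>For a fixed \<open>x\<close> each level contributes at most one cube, which is replaced
  by one of its lifts. Grouping the levels by the grid of the lift leaves sums over distinct cells,
  to which \<open>sum_lifts_le\<close> applies.\<close>

lemma sum_levels_le:
  assumes u: "\<And>Q R. cube Q \<Longrightarrow> cube R \<Longrightarrow> tripled Q \<subseteq> R \<Longrightarrow> side R = 16 * side Q \<Longrightarrow> u Q \<le> C * average R g"
  shows "(\<Sum>j<k. SUP Q\<in>{Q\<in>S j. x \<in> Q}. u Q) \<le> C * (\<Sum>A\<in>UNIV. \<Sum>r<step. sparse_operator (thinned A r) g x)"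
proof -
  define J where "J = {j\<in>{..<k}. \<exists>Q\<in>S j. x \<in> Q}"
  have fJ: "finite J" by (simp add: J_def)
  have "\<exists>Q A R. Q \<in> S j \<and> x \<in> Q \<and> R \<in> lifts A \<and> tripled Q \<subseteq> R \<and> side R = 16 * side Q" if "j \<in> J" for j
  proof -
    obtain Q where Q: "Q \<in> S j" "x \<in> Q" using \<open>j \<in> J\<close> by (auto simp: J_def)
    obtain A R where "R \<in> shifted_grid A" "side R = 16 * side Q" "tripled Q \<subseteq> R"
      by (rule tripled_subset_shifted_cell[OF S_grid[OF Q(1)]])
    then show ?thesis using Q unfolding lifts_def by blast
  qed
  then obtain q \<alpha> \<rho> where q: "\<And>j. j \<in> J \<Longrightarrow> q j \<in> S j" "\<And>j. j \<in> J \<Longrightarrow> x \<in> q j"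
    "\<And>j. j \<in> J \<Longrightarrow> \<rho> j \<in> lifts (\<alpha> j)" "\<And>j. j \<in> J \<Longrightarrow> tripled (q j) \<subseteq> \<rho> j" "\<And>j. j \<in> J \<Longrightarrow> side (\<rho> j) = 16 * side (q j)"
    by metis
  have x\<rho>: "x \<in> \<rho> j" if "j \<in> J" for j using q(2,4)[OF that] subset_tripled[OF S_cube[OF q(1)[OF that]]] by blast
  \<comment> \<open>Equal lifts come from stopping cubes of equal side that contain
    \<open>x\<close>, hence from the same cube, and a cube occurs at one level only since its core
    is nonempty.\<close>
  have inj: "inj_on \<rho> {j\<in>J. \<alpha> j = A}" for A
  proof (rule inj_onI)
    fix i j assume "i \<in> {j\<in>J. \<alpha> j = A}" "j \<in> {j\<in>J. \<alpha> j = A}" "\<rho> i = \<rho> j"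
    then have ij: "i \<in> J" "j \<in> J" "side (q i) = side (q j)" using q(5)[of i] q(5)[of j] by auto
    then have "q i = q j" using q(1,2) S_grid by (intro grid_eqI[of "q i" B "q j"]) blast+
    then show "i = j" using q(1) ij S_level_unique by metis
  qed
  have "(\<Sum>j<k. SUP Q\<in>{Q\<in>S j. x \<in> Q}. u Q) = (\<Sum>j\<in>J. SUP Q\<in>{Q\<in>S j. x \<in> Q}. u Q)"
  proof (rule sum.mono_neutral_right)
    show "\<forall>j\<in>{..<k} - J. (SUP Q\<in>{Q\<in>S j. x \<in> Q}. u Q) = 0"
    proof
      fix j assume "j \<in> {..<k} - J"
      then have e: "{Q\<in>S j. x \<in> Q} = {}" by (auto simp: J_def)
      show "(SUP Q\<in>{Q\<in>S j. x \<in> Q}. u Q) = 0" unfolding e by (simp add: bot_ennreal)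
    qed
  qed (auto simp: J_def)
  also have "\<dots> \<le> (\<Sum>j\<in>J. C * (average (\<rho> j) g * indicator (\<rho> j) x))"
  proof (rule sum_mono)
    fix j assume j: "j \<in> J"
    have "(SUP Q\<in>{Q\<in>S j. x \<in> Q}. u Q) \<le> u (q j)"
    proof (rule SUP_least)
      fix Q assume "Q \<in> {Q\<in>S j. x \<in> Q}"
      then have "Q = q j" using q(1,2)[OF j] S_disjoint[of Q j "q j"] by blast
      then show "u Q \<le> u (q j)" by simp
    qed
    also have "\<dots> \<le> C * average (\<rho> j) g"
      using q[OF j] S_cube lifts_cube by (intro u) blast+
    finally show "(SUP Q\<in>{Q\<in>S j. x \<in> Q}. u Q) \<le> C * (average (\<rho> j) g * indicator (\<rho> j) x)" using x\<rho>[OF j] by simp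
  qed
  also have "\<dots> = C * (\<Sum>j\<in>J. average (\<rho> j) g * indicator (\<rho> j) x)" by (rule sum_distrib_left[symmetric])
  also have "(\<Sum>j\<in>J. average (\<rho> j) g * indicator (\<rho> j) x)
      = (\<Sum>A\<in>UNIV. \<Sum>j\<in>{j\<in>J. \<alpha> j = A}. average (\<rho> j) g * indicator (\<rho> j) x)"
    using fJ by (intro sum.group[symmetric]) auto
  also have "\<dots> = (\<Sum>A\<in>UNIV. \<Sum>R\<in>\<rho> ` {j\<in>J. \<alpha> j = A}. average R g * indicator R x)"
    by (intro sum.cong refl) (simp add: sum.reindex[OF inj])
  also have "C * \<dots> \<le> C * (\<Sum>A\<in>UNIV. \<Sum>r<step. sparse_operator (thinned A r) g x)"
    using fJ q(3) by (intro mult_left_mono sum_mono sum_lifts_le) auto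
  finally show ?thesis .
qed

end

section \<open>Sparse domination\<close>

context cz_operator
begin

lemma sparse_domination:
  obtains C :: real and N :: nat where "0 < C" "\<And>f Q0. locally_integrable f \<Longrightarrow> Q0 \<in> shifted_grid UNIV \<Longrightarrow>
    \<exists>S. (\<forall>A. \<forall>r<N. sparse_family (shifted_grid A) (S A r)) \<and>
      (AE x in lebesgue. x \<in> Q0 \<longrightarrow> maximal_truncation K (cut (tripled Q0) f) x
        \<le> ennreal C * (\<Sum>A\<in>UNIV. \<Sum>r<N. sparse_operator (S A r) (\<lambda>y. ennreal (cmod (f y))) x))"
proof -
  obtain L where L: "0 < L" "\<And>f Q. locally_integrable f \<Longrightarrow> cube Q \<Longrightarrow>
    measure lebesgue (exceptional L f Q \<inter> Q) \<le> 1/2 * measure lebesgue Q"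
    by (rule exceptional_exists) blast
  define C where "C = 2 * (1 + compare_const + c * (10 * CARD('n)) ^ CARD('n)) * L"
  \<comment> \<open>The volume of the lifted cell relative to \<open>tripled Q\<close>: the price of
    replacing the average over the triple by the one over the cell.\<close>
  define d where "d = (16 / 3 :: real) ^ CARD('n)"
  have d: "0 < d" by (simp add: d_def)
  \<comment> \<open>The value of \<open>step\<close>, which depends on the dimension only and so can
    be named before \<open>f\<close> and \<open>Q0\<close>.\<close>
  define N :: nat where "N = 4 * 16 ^ CARD('n)"
  have "0 \<le> compare_const" using c tail_const_pos[OF \<delta>, where 'n='n] by (simp add: compare_const_def)
  then have C: "0 < C" unfolding C_def using c L(1) by (intro mult_pos_pos add_pos_nonneg) auto
  show ?thesis
  proof (rule that)
    show "0 < C * d" using C d by simp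
    fix f :: "real^'n \<Rightarrow> complex" and Q0 :: "(real^'n) set"
    assume f: "locally_integrable f" and Q0: "Q0 \<in> shifted_grid UNIV"
    interpret stopping T K c \<delta> B L f UNIV Q0
      by unfold_locales (use L f Q0 in auto)
    interpret sparse_lift UNIV stop Q0
      by unfold_locales (use sparse_stop in auto)
    have N: "N = step" by (simp add: N_def step_def)
    have C_eq: "step_const = C" by (simp add: step_const_def C_def)
    let ?g = "\<lambda>y. ennreal (cmod (f y))"
    have avg: "ennreal (triple_avg f Q) \<le> ennreal d * average R ?g"
      if Q: "cube Q" and R: "cube R" "tripled Q \<subseteq> R" "side R = 16 * side Q" for Q R
    proof -
      have sQ: "0 < side Q" by (rule cube_side_pos[OF Q])
      have int: "integrable lebesgue (cut (tripled Q) f)"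
        by (rule locally_integrable_cut_cube(1)[OF f cube_tripled[OF Q]])
      have eq: "1 / (3 * side Q) ^ CARD('n) = d / side R ^ CARD('n)"
        using sQ by (simp add: d_def R(3) power_mult_distrib power_divide)
      have "ennreal (triple_avg f Q) = ennreal (1 / (3 * side Q) ^ CARD('n)) * ennreal (LINT y|lebesgue. cmod (cut (tripled Q) f y))"
        using sQ by (subst ennreal_mult'[symmetric]) (auto simp: triple_avg_def)
      also have "ennreal (LINT y|lebesgue. cmod (cut (tripled Q) f y)) = (\<integral>\<^sup>+y\<in>tripled Q. ?g y \<partial>lebesgue)"
        using int by (subst nn_integral_eq_integral[symmetric]) (auto simp: nn_integral_cut)
      also have "\<dots> \<le> (\<integral>\<^sup>+y\<in>R. ?g y \<partial>lebesgue)" by (rule nn_integral_set_mono[OF R(2)])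
      also have "ennreal (1 / (3 * side Q) ^ CARD('n)) * (\<integral>\<^sup>+y\<in>R. ?g y \<partial>lebesgue) = ennreal d * average R ?g"
      proof -
        have p: "0 < side R ^ CARD('n)" using cube_side_pos[OF R(1)] by simp
        have "ennreal (d / side R ^ CARD('n)) = ennreal d * inverse (ennreal (side R ^ CARD('n)))"
          using p d by (simp add: divide_inverse ennreal_mult' inverse_ennreal)
        then show ?thesis unfolding eq by (simp add: average_def emeasure_cube[OF R(1)] divide_ennreal_def mult_ac)
      qed
      finally show ?thesis by (simp add: mult_left_mono)
    qed
    have "AE x in lebesgue. x \<in> Q0 \<longrightarrow> maximal_truncation K (cut (tripled Q0) f) x
        \<le> ennreal (C * d) * (\<Sum>A\<in>UNIV. \<Sum>r<N. sparse_operator (thinned A r) ?g x)"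
      using AE_not_all_stop
    proof eventually_elim
      case (elim x)
      show ?case
      proof
        assume "x \<in> Q0"
        then obtain k where "maximal_truncation K (cut (tripled Q0) f) x \<le> ennreal step_const * (\<Sum>j<k. level_avg j x)"
          using elim stop_pointwise_final by blast
        also have "\<dots> \<le> ennreal step_const * (ennreal d * (\<Sum>A\<in>UNIV. \<Sum>r<step. sparse_operator (thinned A r) ?g x))"
          unfolding level_avg_def by (intro mult_left_mono sum_levels_le avg) auto
        also have "\<dots> = ennreal (C * d) * (\<Sum>A\<in>UNIV. \<Sum>r<N. sparse_operator (thinned A r) ?g x)"
          using C by (simp add: C_eq N ennreal_mult' mult.assoc)
        finally show "maximal_truncation K (cut (tripled Q0) f) x
          \<le> ennreal (C * d) * (\<Sum>A\<in>UNIV. \<Sum>r<N. sparse_operator (thinned A r) ?g x)" .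
      qed
    qed
    then show "\<exists>S. (\<forall>A. \<forall>r<N. sparse_family (shifted_grid A) (S A r)) \<and>
      (AE x in lebesgue. x \<in> Q0 \<longrightarrow> maximal_truncation K (cut (tripled Q0) f) x
        \<le> ennreal (C * d) * (\<Sum>A\<in>UNIV. \<Sum>r<N. sparse_operator (S A r) ?g x))"
      using sparse_thinned by (intro exI[of _ thinned]) blast
  qed
qed

text \<open>Any fixed annulus about \<open>x\<close> is eventually inside the triple of the growing
  cell. The maximal truncations of the cut functions need not be monotone in \<open>k\<close>, which
  is why a lower limit appears.\<close>

lemma maximal_truncation_le_liminf:
  fixes f :: "real^'n \<Rightarrow> complex"
  defines "G \<equiv> (\<lambda>k x. maximal_truncation K (cut (tripled (cell UNIV (int k) 0)) f) x * indicator (cell UNIV (int k) 0) x)"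
  shows "maximal_truncation K f x \<le> (SUP m. INF k\<in>{m..}. G k x)"
proof (rule maximal_truncation_leI)
  fix \<epsilon> \<nu> :: real assume \<epsilon>: "0 < \<epsilon>" "\<epsilon> < \<nu>"
  define Q where "Q k = cell (UNIV :: 'n set) (int k) 0" for k
  obtain N1 where N1: "\<And>k. N1 \<le> k \<Longrightarrow> x \<in> Q k"
    using eventually_mem_cell[of x] unfolding eventually_sequentially Q_def by blast
  obtain N2 :: nat where N2: "\<nu> \<le> real N2" using real_arch_simple by blast
  have "ennreal (cmod (LINT y:annulus \<epsilon> \<nu> x|lebesgue. K x y * f y)) \<le> G k x" if k: "max N1 N2 \<le> k" for k
  proof -
    have xQ: "x \<in> Q k" using N1 k by simp
    have cQ: "cube (Q k)" by (simp add: Q_def)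
    have "real k < 2 ^ k" by simp
    moreover have "\<nu> \<le> real k" using N2 k by linarith
    ultimately have "\<nu> \<le> 2 ^ k" by linarith
    then have "\<nu> \<le> side (Q k)" by (simp add: Q_def)
    have "annulus \<epsilon> \<nu> x \<subseteq> tripled (Q k)"
    proof
      fix y assume "y \<in> annulus \<epsilon> \<nu> x"
      then have "norm (x - y) < \<nu>" by (simp add: annulus_def)
      then show "y \<in> tripled (Q k)" using not_tripled_dist_ge[OF cQ xQ, of y] \<open>\<nu> \<le> side (Q k)\<close> by linarith
    qed
    then have "(LINT y:annulus \<epsilon> \<nu> x|lebesgue. K x y * f y) = (LINT y:annulus \<epsilon> \<nu> x|lebesgue. K x y * cut (tripled (Q k)) f y)"
      unfolding set_lebesgue_integral_def
      by (intro Bochner_Integration.integral_cong) (auto simp: cut_def indicator_def)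
    then have "ennreal (cmod (LINT y:annulus \<epsilon> \<nu> x|lebesgue. K x y * f y)) \<le> maximal_truncation K (cut (tripled (Q k)) f) x"
      using annulus_le_maximal_truncation[OF \<epsilon>, of x "cut (tripled (Q k)) f"] by simp
    then show ?thesis using xQ by (simp add: G_def Q_def)
  qed
  then have "ennreal (cmod (LINT y:annulus \<epsilon> \<nu> x|lebesgue. K x y * f y)) \<le> (INF k\<in>{max N1 N2..}. G k x)"
    by (intro INF_greatest) auto
  also have "\<dots> \<le> (SUP m. INF k\<in>{m..}. G k x)" by (rule SUP_upper) simp
  finally show "ennreal (cmod (LINT y:annulus \<epsilon> \<nu> x|lebesgue. K x y * f y)) \<le> (SUP m. INF k\<in>{m..}. G k x)" .
qed

end

section \<open>Finite sums and lower limits in a Banach function norm\<close>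

context banach_function_norm
begin

lemma sum_le:
  assumes "finite I" "\<And>i. i \<in> I \<Longrightarrow> u i \<in> borel_measurable M"
  shows "\<rho> (\<lambda>x. \<Sum>i\<in>I. u i x) \<le> (\<Sum>i\<in>I. \<rho> (u i))"
  using assms
proof (induction I rule: finite_induct)
  case empty
  then show ?case using zero_iff[of "\<lambda>_. 0"] by simp
next
  case (insert i I)
  have "\<rho> (\<lambda>x. u i x + (\<Sum>i\<in>I. u i x)) \<le> \<rho> (u i) + \<rho> (\<lambda>x. \<Sum>i\<in>I. u i x)"
    using insert.prems by (intro triangle borel_measurable_sum) auto
  also have "\<dots> \<le> \<rho> (u i) + (\<Sum>i\<in>I. \<rho> (u i))" using insert by (intro add_left_mono) auto
  finally show ?case using insert.hyps by simp
qed

text \<open>Fatou's lemma from the monotone form: the infima over the tails increase, and each is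
  dominated by a single \<open>G m\<close>.\<close>

lemma liminf_le:
  assumes G: "\<And>k::nat. G k \<in> borel_measurable M" and h: "h \<in> borel_measurable M"
    and le: "\<And>x. h x \<le> (SUP m. INF k\<in>{m..}. G k x)" and b: "\<And>k. \<rho> (G k) \<le> b"
  shows "\<rho> h \<le> b"
proof -
  define F where "F m x = (INF k\<in>{m..}. G k x)" for m x
  define F' where "F' x = (SUP m. F m x)" for x
  have F: "F m \<in> borel_measurable M" for m unfolding F_def using G by (intro borel_measurable_INF) auto
  have F': "F' \<in> borel_measurable M" unfolding F'_def using F by (intro borel_measurable_SUP) auto
  have inc: "incseq (\<lambda>m. F m x)" for x
    unfolding F_def by (intro incseq_SucI INF_superset_mono) auto
  have "(\<lambda>m. F m x) \<longlonglongrightarrow> F' x" for x unfolding F'_def by (rule LIMSEQ_SUP[OF inc])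
  then have lim: "(\<lambda>m. \<rho> (F m)) \<longlonglongrightarrow> \<rho> F'" using fatou[of F F'] F F' inc by simp
  have "\<rho> (F m) \<le> b" for m
  proof -
    have "F m x \<le> G m x" for x unfolding F_def by (rule INF_lower) simp
    then have "\<rho> (F m) \<le> \<rho> (G m)" using F G by (intro monotone) auto
    then show ?thesis using b by (rule order_trans)
  qed
  then have "\<rho> F' \<le> b" using lim by (intro LIMSEQ_le_const2[OF lim]) auto
  moreover have "\<rho> h \<le> \<rho> F'" using le h F' by (intro monotone) (auto simp: F'_def F_def)
  ultimately show ?thesis by (rule order_trans[rotated])
qed

end

theorem theorem1p1:
  fixes T :: "(real^'n \<Rightarrow> complex) \<Rightarrow> real^'n \<Rightarrow> complex"
    and K :: "real^'n \<Rightarrow> real^'n \<Rightarrow> complex"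
  assumes "calderon_zygmund_operator T K"
  shows "\<exists>C::real. 0 < C \<and>
    (\<forall>(\<rho> :: (real^'n \<Rightarrow> ennreal) \<Rightarrow> ennreal) (f :: real^'n \<Rightarrow> complex).
       banach_function_norm lebesgue \<rho> \<longrightarrow> locally_integrable f \<longrightarrow>
       \<rho> (maximal_truncation K f) \<le>
         ennreal C * (SUP (D, S) \<in> {(D, S). dyadic_grid D \<and> sparse_family D S}.
           \<rho> (sparse_operator S (\<lambda>x. ennreal (cmod (f x))))))"
proof -
  interpret T: calderon_zygmund_operator T K by fact
  obtain c \<delta> where "cz_kernel K c \<delta>" by (rule calderon_zygmund_kernelE[OF T.kernel])
  then interpret K: cz_kernel K c \<delta> .
  obtain B0 where B0: "\<And>f. f \<in> L2_functions \<Longrightarrow> L2_norm (T f) \<le> B0 * L2_norm f" using T.L2_bounded by blast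
  interpret cz_operator T K c \<delta> "max B0 0"
  proof
    show "L2_norm (T f) \<le> max B0 0 * L2_norm f" if "f \<in> L2_functions" for f
      using B0[OF that] mult_right_mono[of B0 "max B0 0" "L2_norm f"] by (simp add: L2_norm_def)
  qed simp
  obtain C and N :: nat where C: "0 < C" and dom: "\<And>f Q0. locally_integrable f \<Longrightarrow> Q0 \<in> shifted_grid UNIV \<Longrightarrow>
    \<exists>S. (\<forall>A. \<forall>r<N. sparse_family (shifted_grid A) (S A r)) \<and>
      (AE x in lebesgue. x \<in> Q0 \<longrightarrow> maximal_truncation K (cut (tripled Q0) f) x
        \<le> ennreal C * (\<Sum>A\<in>UNIV. \<Sum>r<N. sparse_operator (S A r) (\<lambda>y. ennreal (cmod (f y))) x))"
    by (rule sparse_domination) blast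
  \<comment> \<open>One factor for the grids, one for the thinned families in each of them.
    \<open>Suc N\<close> keeps the constant positive whatever \<open>N\<close> is.\<close>
  define C' where "C' = C * (CARD('n set) * Suc N)"
  show ?thesis
  proof (intro exI[of _ C'] conjI allI impI)
    have "0 < CARD('n set)" by (rule zero_less_card_finite)
    then show "0 < C'" using C unfolding C'_def by (intro mult_pos_pos) (simp_all del: mult_Suc_right card_set)
    fix \<rho> :: "(real^'n \<Rightarrow> ennreal) \<Rightarrow> ennreal" and f :: "real^'n \<Rightarrow> complex"
    assume "banach_function_norm lebesgue \<rho>" and f: "locally_integrable f"
    then interpret X: banach_function_norm lebesgue \<rho> by simp
    define g where "g = (\<lambda>x. ennreal (cmod (f x)))"
    define b where "b = (SUP (D, S) \<in> {(D, S). dyadic_grid D \<and> sparse_family D S}. \<rho> (sparse_operator S g))"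
    define Q where "Q k = cell (UNIV :: 'n set) (int k) 0" for k
    define G where "G k x = maximal_truncation K (cut (tripled (Q k)) f) x * indicator (Q k) x" for k x
    have cut: "locally_integrable (cut (tripled (Q k)) f)" for k
      by (intro integrable_imp_locally_integrable locally_integrable_cut_cube(1) f cube_tripled) (simp add: Q_def)
    have G: "G k \<in> borel_measurable lebesgue" for k
      unfolding G_def by (intro borel_measurable_times_ennreal K.maximal_truncation_measurable cut borel_measurable_indicator)
        (simp add: Q_def)
    have "\<rho> (G k) \<le> ennreal C' * b" for k
    proof -
      obtain S where S: "\<And>A r. r < N \<Longrightarrow> sparse_family (shifted_grid A) (S A r)"
        "AE x in lebesgue. x \<in> Q k \<longrightarrow> maximal_truncation K (cut (tripled (Q k)) f) x
          \<le> ennreal C * (\<Sum>A\<in>UNIV. \<Sum>r<N. sparse_operator (S A r) g x)"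
        using dom[OF f, of "Q k"] unfolding Q_def g_def by auto
      have m: "sparse_operator (S A r) g \<in> borel_measurable lebesgue" if "r < N" for A r
        using S(1)[OF that] by (intro sparse_operator_measurable[of _ A]) (simp add: sparse_family_def)
      have m': "(\<lambda>x. \<Sum>r<N. sparse_operator (S A r) g x) \<in> borel_measurable lebesgue" for A
        using m by (intro borel_measurable_sum) auto
      have "\<rho> (G k) \<le> \<rho> (\<lambda>x. ennreal C * (\<Sum>A\<in>UNIV. \<Sum>r<N. sparse_operator (S A r) g x))"
      proof (rule X.monotone)
        show "(\<lambda>x. ennreal C * (\<Sum>A\<in>UNIV. \<Sum>r<N. sparse_operator (S A r) g x)) \<in> borel_measurable lebesgue"
          by (intro borel_measurable_times_ennreal borel_measurable_sum borel_measurable_const m) simp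
        show "AE x in lebesgue. G k x \<le> ennreal C * (\<Sum>A\<in>UNIV. \<Sum>r<N. sparse_operator (S A r) g x)"
          using S(2) by eventually_elim (auto simp: G_def indicator_def)
      qed (rule G)
      also have "\<dots> = ennreal C * \<rho> (\<lambda>x. \<Sum>A\<in>UNIV. \<Sum>r<N. sparse_operator (S A r) g x)"
        using C by (intro X.scale borel_measurable_sum m) auto
      finally have 1: "\<rho> (G k) \<le> ennreal C * \<rho> (\<lambda>x. \<Sum>A\<in>UNIV. \<Sum>r<N. sparse_operator (S A r) g x)" .
      have "\<rho> (\<lambda>x. \<Sum>A\<in>UNIV. \<Sum>r<N. sparse_operator (S A r) g x) \<le> (\<Sum>A\<in>UNIV. \<rho> (\<lambda>x. \<Sum>r<N. sparse_operator (S A r) g x))"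
        by (rule X.sum_le[OF _ m']) simp
      also have "\<dots> \<le> (\<Sum>A\<in>(UNIV :: 'n set set). \<Sum>r<N. \<rho> (sparse_operator (S A r) g))"
        by (intro sum_mono X.sum_le m) simp_all
      also have "\<dots> \<le> (\<Sum>A\<in>(UNIV :: 'n set set). \<Sum>r<N. b)"
      proof (intro sum_mono)
        fix A r assume "r \<in> {..<N}"
        then have "(shifted_grid A, S A r) \<in> {(D, S). dyadic_grid D \<and> sparse_family D S}"
          using S(1) dyadic_grid_shifted_grid by simp
        then show "\<rho> (sparse_operator (S A r) g) \<le> b" unfolding b_def by (rule SUP_upper2) simp
      qed
      also have "\<dots> = of_nat (CARD('n set) * N) * b" by (simp add: mult.assoc del: card_set)
      also have "\<dots> \<le> of_nat (CARD('n set) * Suc N) * b" by (intro mult_right_mono of_nat_mono) auto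
      finally have "ennreal C * \<rho> (\<lambda>x. \<Sum>A\<in>UNIV. \<Sum>r<N. sparse_operator (S A r) g x)
          \<le> ennreal C * (of_nat (CARD('n set) * Suc N) * b)" by (rule mult_left_mono) simp
      also have "\<dots> = ennreal C' * b"
        unfolding C'_def ennreal_of_nat_eq_real_of_nat mult.assoc[symmetric]
        by (subst ennreal_mult'[symmetric]) (use C in simp_all)
      finally show ?thesis by (rule order_trans[OF 1])
    qed
    moreover have "maximal_truncation K f x \<le> (SUP m. INF k\<in>{m..}. G k x)" for x
      unfolding G_def Q_def by (rule maximal_truncation_le_liminf)
    ultimately have "\<rho> (maximal_truncation K f) \<le> ennreal C' * b"
      by (rule X.liminf_le[OF G K.maximal_truncation_measurable[OF f], rotated])
    then show "\<rho> (maximal_truncation K f) \<le>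
         ennreal C' * (SUP (D, S) \<in> {(D, S). dyadic_grid D \<and> sparse_family D S}.
           \<rho> (sparse_operator S (\<lambda>x. ennreal (cmod (f x)))))"
      unfolding b_def g_def .
  qed
qed

end
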